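(* Let $D$ be an integral domain, let $\Theta$ be a pre-Jaffard family of $D$, and let $\{T_\alpha\}$ be its derived sequence with associated sets $\mathcal{N}^\alpha(\Theta)$. Fix an ordinal $\alpha$ and suppose that: (i) $\mathrm{Int}(D)T=\mathrm{Int}(T)$ for each $T\in\Theta\setminus\mathcal{N}^\alpha(\Theta)$ and for each $T=T_\gamma$ with $\gamma<\alpha$; (ii) $\mathrm{Pic}_{\mathrm{Int}}(T)$ is a free abelian group for each $T\in\Theta\setminus\mathcal{N}^\alpha(\Theta)$. Then there is an exact sequence $$0\longrightarrow\bigoplus_{T\in\Theta\setminus\mathcal{N}^\alpha(\Theta)}\mathrm{Pic}_{\mathrm{Int}}(T)\longrightarrow\mathrm{Pic}_{\mathrm{Int}}(D)\longrightarrow\mathrm{Pic}_{\mathrm{Int}}(D,T_\alpha)\longrightarrow 0.$$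
   Context: $D$ is an integral domain with quotient field $K$; for a domain $A$ with quotient field $K$, $\mathrm{Int}(A)=\{f\in K[X]\mid f(A)\subseteq A\}$ and $\mathrm{Pic}(A)$ is the group of invertible fractional ideals modulo principal ones. $\mathrm{Pic}_{\mathrm{Int}}(A):=\mathrm{Pic}(\mathrm{Int}(A))/\iota_A(\mathrm{Pic}(A))$ with $\iota_A([I])=[I\,\mathrm{Int}(A)]$. For a flat overring $T$ of $D$, $\mathrm{Int}(D)T$ is the subring of $K[X]$ of finite sums $\sum f_it_i$ ($f_i\in\mathrm{Int}(D)$, $t_i\in T$), and $\mathrm{Pic}_{\mathrm{Int}}(D,T):=\mathrm{Pic}(\mathrm{Int}(D)T)/\iota_{D,T}(\mathrm{Pic}(T))$ with $\iota_{D,T}([I])=[I\,\mathrm{Int}(D)T]$. An overring is a ring between $D$ and $K$, flat if flat as a $D$-module. A family $\Theta$ of overrings of a domain $R$ (quotient field $K$) is a pre-Jaffard family of $R$ if: $\Theta=\{K\}$ or $K\notin\Theta$; every member is flat over $R$; complete (every ideal $I$ of $R$ equals $\bigcap_{T\in\Theta}IT$); independent ($TT'=K$ for distinct members); compact in the Zariski topology on overrings (subbasic opens $\{T\mid x_1,\dots,x_n\in T\}$). A Jaffard family is a locally finite pre-Jaffard family (each nonzero $x\in R$ is a nonunit in only finitely many members); a Jaffard overring of $R$ is a member of some Jaffard family of $R$. Derived sequence of a pre-Jaffard family $\Theta$ of $D$, by transfinite recursion: $\mathcal{N}^0(\Theta)=\Theta$; $T_\alpha:=\bigcap_{T\in\mathcal{N}^\alpha(\Theta)}T$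 (the empty intersection being $K$; so $T_0=D$); $\mathcal{N}^{\gamma+1}(\Theta)$ is the set of elements of $\mathcal{N}^\gamma(\Theta)$ that are not Jaffard overrings of $T_\gamma$; for $\alpha$ limit, $\mathcal{N}^\alpha(\Theta)=\bigcap_{\beta<\alpha}\mathcal{N}^\beta(\Theta)$. *)

theory Defs
  imports "HOL-Analysis.Abstract_Topology"
          "HOL-Algebra.Product_Groups" "HOL-Algebra.Free_Abelian_Groups"
          "HOL-Computational_Algebra.Polynomial"
          "HOL-Computational_Algebra.Fraction_Field"
begin

text \<open>Convention: the quotient field K of the domain D is the whole field type.
  Subrings, overrings and fractional ideals are subsets of a field type.\<close>

definition fsubring :: "'f::field set \<Rightarrow> bool" where
  "fsubring R \<longleftrightarrow> 0 \<in> R \<and> 1 \<in> R \<and> (\<forall>x\<in>R. \<forall>y\<in>R. x + y \<in> R \<and> x - y \<in> R \<and> x * y \<in> R)"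

definition has_quotfield_univ :: "'f::field set \<Rightarrow> bool" where
  "has_quotfield_univ R \<longleftrightarrow> (\<forall>z. \<exists>a\<in>R. \<exists>b\<in>R. b \<noteq> 0 \<and> z = a / b)"

definition overring :: "'f::field set \<Rightarrow> 'f set \<Rightarrow> bool" where
  "overring R T \<longleftrightarrow> fsubring T \<and> R \<subseteq> T"

text \<open>Flatness of T as an R-module (equational criterion of flatness).\<close>
definition flat_over :: "'f::field set \<Rightarrow> 'f set \<Rightarrow> bool" where
  "flat_over R T \<longleftrightarrow>
    (\<forall>(n::nat) a x. (\<forall>i<n. a i \<in> R \<and> x i \<in> T) \<and> (\<Sum>i<n. a i * x i) = 0 \<longrightarrow>
      (\<exists>(m::nat) y b. (\<forall>j<m. y j \<in> T) \<and> (\<forall>i<n. \<forall>j<m. b i j \<in> R) \<and>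
         (\<forall>i<n. x i = (\<Sum>j<m. b i j * y j)) \<and> (\<forall>j<m. (\<Sum>i<n. a i * b i j) = 0)))"

definition set_prod :: "'a::comm_ring set \<Rightarrow> 'a set \<Rightarrow> 'a set" where
  "set_prod I J = {(\<Sum>i<n. a i * b i) | (n::nat) a b. \<forall>i<n. a i \<in> I \<and> b i \<in> J}"

definition is_ideal :: "'f::field set \<Rightarrow> 'f set \<Rightarrow> bool" where
  "is_ideal R I \<longleftrightarrow> I \<subseteq> R \<and> 0 \<in> I \<and> (\<forall>x\<in>I. \<forall>y\<in>I. x + y \<in> I) \<and> (\<forall>r\<in>R. \<forall>x\<in>I. r * x \<in> I)"

definition zariski :: "'f::field set \<Rightarrow> 'f set topology" where
  "zariski R = topology_generated_by {{T. overring R T \<and> set xs \<subseteq> T} | xs. True}"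

definition pre_jaffard :: "'f::field set \<Rightarrow> 'f set set \<Rightarrow> bool" where
  "pre_jaffard R \<Theta> \<longleftrightarrow>
     (\<Theta> = {UNIV} \<or> UNIV \<notin> \<Theta>) \<and>
     (\<forall>T\<in>\<Theta>. overring R T \<and> flat_over R T) \<and>
     (\<forall>I. is_ideal R I \<longrightarrow> I = (\<Inter>T\<in>\<Theta>. set_prod I T)) \<and>
     (\<forall>T\<in>\<Theta>. \<forall>T'\<in>\<Theta>. T \<noteq> T' \<longrightarrow> set_prod T T' = UNIV) \<and>
     compactin (zariski R) \<Theta>"

definition jaffard_family :: "'f::field set \<Rightarrow> 'f set set \<Rightarrow> bool" where
  "jaffard_family R \<Theta> \<longleftrightarrow> pre_jaffard R \<Theta> \<and>
     (\<forall>x\<in>R. x \<noteq> 0 \<longrightarrow> finite {T\<in>\<Theta>. inverse x \<notin> T})"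

definition jaffard_overring :: "'f::field set \<Rightarrow> 'f set \<Rightarrow> bool" where
  "jaffard_overring R T \<longleftrightarrow> (\<exists>\<Theta>. jaffard_family R \<Theta> \<and> T \<in> \<Theta>)"

text \<open>T_alpha = intersection of N^alpha (empty intersection = UNIV = K).\<close>
definition Tseq :: "('o \<Rightarrow> 'f set set) \<Rightarrow> 'o \<Rightarrow> 'f set" where
  "Tseq N \<beta> = \<Inter>(N \<beta>)"

text \<open>Derived sequence N^gamma of a pre-Jaffard family, indexed by an arbitrary
  well-ordered type (ordinals): zero, successor and limit cases.\<close>
definition derived_seq :: "'f::field set \<Rightarrow> 'f set set \<Rightarrow> ('o::wellorder \<Rightarrow> 'f set set) \<Rightarrow> bool" where
  "derived_seq D \<Theta> N \<longleftrightarrow>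
     (\<forall>\<gamma>. (\<forall>\<beta>. \<not> \<beta> < \<gamma>) \<longrightarrow> N \<gamma> = \<Theta>) \<and>
     (\<forall>\<beta> \<gamma>. \<beta> < \<gamma> \<and> (\<forall>\<delta>. \<not> (\<beta> < \<delta> \<and> \<delta> < \<gamma>)) \<longrightarrow>
         N \<gamma> = {T \<in> N \<beta>. \<not> jaffard_overring (Tseq N \<beta>) T}) \<and>
     (\<forall>\<gamma>. (\<exists>\<beta>. \<beta> < \<gamma>) \<and> (\<forall>\<beta><\<gamma>. \<exists>\<delta>. \<beta> < \<delta> \<and> \<delta> < \<gamma>) \<longrightarrow>
         N \<gamma> = (\<Inter>\<beta>\<in>{..<\<gamma>}. N \<beta>))"

definition Int_poly :: "'k::field set \<Rightarrow> 'k poly set" where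
  "Int_poly A = {p. \<forall>a\<in>A. poly p a \<in> A}"

definition IntT :: "'k::field set \<Rightarrow> 'k set \<Rightarrow> 'k poly set" where
  "IntT D T = set_prod (Int_poly D) ((\<lambda>t. [:t:]) ` T)"

definition embP :: "'k::field poly \<Rightarrow> 'k poly fract" where
  "embP p = Fract p 1"

definition embK :: "'k::field \<Rightarrow> 'k poly fract" where
  "embK a = Fract [:a:] 1"

definition frac_ideal :: "'f::field set \<Rightarrow> 'f set \<Rightarrow> bool" where
  "frac_ideal R I \<longleftrightarrow> I \<noteq> {0} \<and> 0 \<in> I \<and> (\<forall>x\<in>I. \<forall>y\<in>I. x + y \<in> I) \<and>
     (\<forall>r\<in>R. \<forall>x\<in>I. r * x \<in> I) \<and> (\<exists>d\<in>R. d \<noteq> 0 \<and> (\<forall>x\<in>I. d * x \<in> R))"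

definition invertible_frac :: "'f::field set \<Rightarrow> 'f set \<Rightarrow> bool" where
  "invertible_frac R I \<longleftrightarrow> frac_ideal R I \<and> (\<exists>J. frac_ideal R J \<and> set_prod I J = R)"

definition InvFrac :: "'f::field set \<Rightarrow> 'f set monoid" where
  "InvFrac R = \<lparr>carrier = {I. invertible_frac R I}, monoid.mult = set_prod, one = R\<rparr>"

definition Prin :: "'f::field set \<Rightarrow> 'f set set" where
  "Prin R = {{x * r | r. r \<in> R} | x. x \<noteq> 0}"

definition Pic :: "'f::field set \<Rightarrow> 'f set set monoid" where
  "Pic R = InvFrac R Mod Prin R"

definition pic_class :: "'f::field set \<Rightarrow> 'f set \<Rightarrow> 'f set set" where
  "pic_class R I = r_coset (InvFrac R) (Prin R) I"

text \<open>Pic_Int(A) = Pic(Int(A)) / iota_A(Pic(A)).\<close>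
definition Pic_Int :: "'k::field set \<Rightarrow> 'k poly fract set set set monoid" where
  "Pic_Int A = Pic (embP ` Int_poly A) Mod
     {pic_class (embP ` Int_poly A) (set_prod (embK ` I) (embP ` Int_poly A)) | I. invertible_frac A I}"

text \<open>Pic_Int(D,T) = Pic(Int(D)T) / iota_{D,T}(Pic(T)).\<close>
definition Pic_Int_rel :: "'k::field set \<Rightarrow> 'k set \<Rightarrow> 'k poly fract set set set monoid" where
  "Pic_Int_rel D T = Pic (embP ` IntT D T) Mod
     {pic_class (embP ` IntT D T) (set_prod (embK ` I) (embP ` IntT D T)) | I. invertible_frac T I}"

definition free_abelian :: "('e, 'm) monoid_scheme \<Rightarrow> bool" where
  "free_abelian G \<longleftrightarrow> (\<exists>B :: 'e set. G \<cong> free_Abelian_group B)"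

end

theory Submission
  imports Defs
begin

text \<open>
  If \<open>T\<close> is a Jaffard overring of \<open>T\<^sub>\<gamma>\<close> in \<open>N\<^sup>\<gamma>\<close> and \<open>T'\<close> is the intersection of the other members
  of \<open>N\<^sup>\<gamma>\<close>, then \<open>T \<inter> T' = T\<^sub>\<gamma>\<close> and \<open>T + T' = K\<close>. Hence \<open>M = MT \<inter> MT'\<close> for all modules \<open>M\<close>, and
  \<open>I \<mapsto> (IT, IT')\<close> splits the group of invertible \<open>Int(D)T\<^sub>\<gamma>\<close>-ideals.
  Well-order \<open>\<Theta> - N\<^sup>\<alpha>\<close> compatibly with the level at which an overring leaves the derived sequence.
  For an initial segment \<open>W\<close> let \<open>R\<close> be the intersection of \<open>\<Theta> - W\<close>. Zariski compactness of \<open>\<Theta>\<close>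
  shows that \<open>R\<close> is the union of the rings belonging to the segments \<open>{T. T \<le> S}\<close> with \<open>S \<in> W\<close>, to one of
  which every finitely generated object over \<open>R\<close> descends. By transfinite induction the map
  \<open>Pic_Int(D) \<rightarrow> Pic_Int(D, R)\<close> is onto and its kernel has a well-ordered filtration with factors
  \<open>Pic_Int(T)\<close>, \<open>T \<in> W\<close>. Since these are free, they lift to \<open>Pic_Int(D)\<close>, and the kernel is their
  direct sum.
\<close>

section \<open>Products of additive subsets\<close>

text \<open>The overrings are removed one at a time. A level may contain infinitely many Jaffard
  overrings; removed singly, an infinite level and a limit ordinal lead to the same limit step. The
  price is that the intermediate rings \<open>R\<close> need not be of the form
  \<open>T\<^sub>\<gamma>\<close>, so Int(R) is out of reach. All arguments use the rings Int(D)R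
  instead, and hypothesis (i) enters when Pic_Int(T) is identified with Pic_Int(D,T). A Jaffard
  overring \<open>T\<close> of \<open>T\<^sub>\<gamma>\<close> belongs to some Jaffard family that
  need not be related to \<open>N\<^sup>\<gamma>\<close>. Flatness places the complement of
  \<open>T\<close> in that family inside every other member of \<open>N\<^sup>\<gamma>\<close>. A
  trivial class consists of ideals x H Int(D)R with x a rational function and H an invertible ideal
  of \<open>R\<close>. For modules with I K = K[X] the factor x is a constant and can be moved into
  H. Equality of classes then becomes an equation between sets, which can be glued along a pair of
  overrings and descended along a chain.\<close>

notation set_prod (infixl "\<star>" 75)

definition add_closed :: "'a::comm_ring set \<Rightarrow> bool" where
  "add_closed M \<longleftrightarrow> 0 \<in> M \<and> (\<forall>x\<in>M. \<forall>y\<in>M. x + y \<in> M)"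

lemma set_prod_0 [simp]: "0 \<in> I \<star> J"
  unfolding set_prod_def by (rule CollectI, rule exI[of _ 0]) auto

lemma set_prod_cons:
  assumes "a \<in> I" "b \<in> J" "x \<in> I \<star> J"
  shows "a * b + x \<in> I \<star> J"
proof -
  obtain n f g where x: "x = (\<Sum>i<(n::nat). f i * g i)" and fg: "\<forall>i<n. f i \<in> I \<and> g i \<in> J"
    using assms(3) unfolding set_prod_def by blast
  have "a * b + x = (\<Sum>i<Suc n. (f(n := a)) i * (g(n := b)) i)"
    by (simp add: x add.commute)
  moreover have "\<forall>i<Suc n. (f(n := a)) i \<in> I \<and> (g(n := b)) i \<in> J"
    using fg assms by (auto simp: less_Suc_eq)
  ultimately show ?thesis unfolding set_prod_def by blast
qed

lemma set_prod_mult: "a \<in> I \<Longrightarrow> b \<in> J \<Longrightarrow> a * b \<in> I \<star> J"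
  using set_prod_cons[of a I b J 0] by simp

lemma set_prod_induct [consumes 1, case_names zero cons]:
  assumes "x \<in> I \<star> J" and "P 0"
    and "\<And>a b x. a \<in> I \<Longrightarrow> b \<in> J \<Longrightarrow> x \<in> I \<star> J \<Longrightarrow> P x \<Longrightarrow> P (a * b + x)"
  shows "P x"
proof -
  obtain n f g where x: "x = (\<Sum>i<(n::nat). f i * g i)" and fg: "\<forall>i<n. f i \<in> I \<and> g i \<in> J"
    using assms(1) unfolding set_prod_def by blast
  have "m \<le> n \<Longrightarrow> (\<Sum>i<m. f i * g i) \<in> I \<star> J \<and> P (\<Sum>i<m. f i * g i)" for m
  proof (induction m)
    case (Suc m)
    then show ?case using fg assms(3)[of "f m" "g m"] set_prod_cons[of "f m" I "g m" J]
      by simp (metis add.commute)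
  qed (use assms(2) in simp)
  then show ?thesis by (simp add: x)
qed

lemma set_prod_add: "x \<in> I \<star> J \<Longrightarrow> y \<in> I \<star> J \<Longrightarrow> x + y \<in> I \<star> J"
  by (induction rule: set_prod_induct) (auto simp: add.assoc set_prod_cons)

lemma add_closed_set_prod [simp]: "add_closed (I \<star> J)"
  by (simp add: add_closed_def set_prod_add)

lemma set_prod_subsetI:
  assumes "add_closed M" "\<And>a b. a \<in> I \<Longrightarrow> b \<in> J \<Longrightarrow> a * b \<in> M"
  shows "I \<star> J \<subseteq> M"
proof
  fix x assume "x \<in> I \<star> J"
  then show "x \<in> M"
    by (induction rule: set_prod_induct) (use assms in \<open>auto simp: add_closed_def\<close>)
qed

lemma set_prod_mono: "I \<subseteq> I' \<Longrightarrow> J \<subseteq> J' \<Longrightarrow> I \<star> J \<subseteq> I' \<star> J'"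
  by (intro set_prod_subsetI add_closed_set_prod set_prod_mult) auto

lemma set_prod_commute: "I \<star> J = J \<star> I"
proof -
  have "I \<star> J \<subseteq> J \<star> I" for I J :: "'a::comm_ring set"
    by (intro set_prod_subsetI add_closed_set_prod) (metis mult.commute set_prod_mult)
  then show ?thesis by blast
qed

lemma set_prod_assoc: "I \<star> J \<star> L = I \<star> (J \<star> L)"
proof -
  have *: "I \<star> J \<star> L \<subseteq> I \<star> (J \<star> L)" for I J L :: "'a::comm_ring set"
  proof (intro set_prod_subsetI add_closed_set_prod)
    fix x l assume "x \<in> I \<star> J" and l: "l \<in> L"
    then show "x * l \<in> I \<star> (J \<star> L)"
      by (induction rule: set_prod_induct)
         (auto simp: ring_distribs mult.assoc l intro!: set_prod_cons set_prod_mult)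
  qed
  have "I \<star> (J \<star> L) = L \<star> J \<star> I" by (metis set_prod_commute)
  also have "\<dots> \<subseteq> L \<star> (J \<star> I)" by (rule *)
  also have "\<dots> = I \<star> J \<star> L" by (metis set_prod_commute)
  finally show ?thesis using * by blast
qed

interpretation set_prod: abel_semigroup set_prod
  by unfold_locales (rule set_prod_assoc set_prod_commute)+

lemmas set_prod_ac = set_prod.assoc set_prod.commute set_prod.left_commute

lemma set_prod_absorb: "M \<star> C = M \<Longrightarrow> M \<star> N \<star> C = M \<star> N"
proof -
  have "M \<star> N \<star> C = M \<star> C \<star> N" by (simp add: set_prod_ac)
  then show "M \<star> C = M \<Longrightarrow> M \<star> N \<star> C = M \<star> N" by simp
qed

lemma fsubringD:
  assumes "fsubring S"
  shows "0 \<in> S" "1 \<in> S" "x \<in> S \<Longrightarrow> y \<in> S \<Longrightarrow> x + y \<in> S"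
    "x \<in> S \<Longrightarrow> y \<in> S \<Longrightarrow> x - y \<in> S" "x \<in> S \<Longrightarrow> y \<in> S \<Longrightarrow> x * y \<in> S" "x \<in> S \<Longrightarrow> - x \<in> S"
proof -
  show "- x \<in> S" if "x \<in> S"
    using assms that unfolding fsubring_def by (metis diff_0)
qed (use assms in \<open>auto simp: fsubring_def\<close>)

lemma fsubring_add_closed: "fsubring S \<Longrightarrow> add_closed S"
  by (simp add: add_closed_def fsubringD)

lemma fsubring_Inter: "(\<And>S. S \<in> \<S> \<Longrightarrow> fsubring S) \<Longrightarrow> fsubring (\<Inter>\<S>)"
  by (auto simp: fsubring_def)

lemma fsubring_Int: "fsubring R \<Longrightarrow> fsubring S \<Longrightarrow> fsubring (R \<inter> S)"
  using fsubring_Inter[of "{R, S}"] by auto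

lemma fsubring_UNIV: "fsubring UNIV"
  by (simp add: fsubring_def)

lemma set_prod_superset: "1 \<in> J \<Longrightarrow> I \<subseteq> I \<star> (J :: 'a::field set)"
  using set_prod_mult[of _ I 1 J] by auto

text \<open>For a ring \<open>S\<close> the equation \<open>M \<star> S = M\<close> thus encodes
  that \<open>M\<close> is an \<open>S\<close>-module. In this form module closure can be rewritten
  with the semigroup laws.\<close>

lemma set_prod_module_iff:
  fixes S :: "'a::field set"
  assumes "fsubring S"
  shows "M \<star> S = M \<longleftrightarrow> add_closed M \<and> (\<forall>m\<in>M. \<forall>s\<in>S. m * s \<in> M)"
proof
  assume "M \<star> S = M"
  then show "add_closed M \<and> (\<forall>m\<in>M. \<forall>s\<in>S. m * s \<in> M)"
    using add_closed_set_prod[of M S] set_prod_mult[of _ M _ S] by auto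
next
  assume "add_closed M \<and> (\<forall>m\<in>M. \<forall>s\<in>S. m * s \<in> M)"
  then show "M \<star> S = M"
    using set_prod_superset[of S M] assms
    by (intro antisym set_prod_subsetI) (auto simp: fsubringD)
qed

lemma set_prod_subring:
  fixes S :: "'a::field set"
  assumes "fsubring S" "1 \<in> M" "M \<subseteq> S"
  shows "M \<star> S = S" "S \<star> M = S"
proof -
  have "S \<star> M \<subseteq> S"
    using assms by (intro set_prod_subsetI fsubring_add_closed) (auto simp: fsubringD)
  then show "S \<star> M = S" using set_prod_superset[of M S] assms by blast
  then show "M \<star> S = S" by (simp add: set_prod_commute)
qed

lemma set_prod_idem: "fsubring S \<Longrightarrow> S \<star> S = (S :: 'a::field set)"
  by (rule set_prod_subring(1)[OF _ fsubringD(2) order_refl])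

lemma fsubring_set_prod:
  fixes R S :: "'a::field set"
  assumes "fsubring R" "fsubring S"
  shows "fsubring (R \<star> S)"
proof -
  have RS: "R \<star> S \<star> (R \<star> S) = R \<star> S"
  proof -
    have "R \<star> S \<star> (R \<star> S) = (R \<star> R) \<star> (S \<star> S)" by (simp add: set_prod_ac)
    then show ?thesis using assms by (simp only: set_prod_idem)
  qed
  have one: "1 \<in> R \<star> S" using set_prod_mult[of 1 R 1 S] assms by (simp add: fsubringD)
  have neg: "- x \<in> R \<star> S" if "x \<in> R \<star> S" for x
    using that
  proof (induction rule: set_prod_induct)
    case (cons a b x)
    then have "(- a) * b + (- x) \<in> R \<star> S"
      using assms by (intro set_prod_cons) (auto simp: fsubringD)
    then show ?case by simp
  qed simp
  have mul: "x * y \<in> R \<star> S" if "x \<in> R \<star> S" "y \<in> R \<star> S" for x y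
    using set_prod_mult[OF that] RS by simp
  show ?thesis
    unfolding fsubring_def
    using one mul set_prod_add neg by (metis diff_conv_add_uminus set_prod_0)
qed

lemma image_set_prod:
  fixes e :: "'a::comm_ring \<Rightarrow> 'b::comm_ring"
  assumes "\<And>x y. e (x + y) = e x + e y" "\<And>x y. e (x * y) = e x * e y"
  shows "e ` (I \<star> J) = e ` I \<star> e ` J"
proof
  have e0: "e 0 = 0" using assms(1)[of 0 0] by simp
  have "e x \<in> e ` I \<star> e ` J" if "x \<in> I \<star> J" for x
    using that by (induction rule: set_prod_induct) (auto simp: e0 assms intro!: set_prod_cons)
  then show "e ` (I \<star> J) \<subseteq> e ` I \<star> e ` J" by blast
  have "add_closed (e ` (I \<star> J))"
    unfolding add_closed_def by (auto simp: assms(1)[symmetric] set_prod_add)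
      (metis e0 image_eqI set_prod_0)
  then show "e ` I \<star> e ` J \<subseteq> e ` (I \<star> J)"
    by (rule set_prod_subsetI) (auto simp: assms(2)[symmetric] set_prod_mult)
qed

lemma set_prod_finite_support:
  assumes "x \<in> I \<star> J"
  obtains F G where "finite F" "F \<subseteq> I" "finite G" "G \<subseteq> J" "x \<in> F \<star> G"
proof -
  from assms have "\<exists>F G. finite F \<and> F \<subseteq> I \<and> finite G \<and> G \<subseteq> J \<and> x \<in> F \<star> G"
  proof (induction rule: set_prod_induct)
    case zero
    show ?case by (rule exI[of _ "{}"], rule exI[of _ "{}"]) simp
  next
    case (cons a b x)
    then obtain F G where FG: "finite F" "F \<subseteq> I" "finite G" "G \<subseteq> J" "x \<in> F \<star> G" by blast
    have "x \<in> insert a F \<star> insert b G"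
      using FG(5) set_prod_mono[of F "insert a F" G "insert b G"] by blast
    then have "a * b + x \<in> insert a F \<star> insert b G" by (intro set_prod_cons) auto
    then show ?case using FG cons by (intro exI[of _ "insert a F"] exI[of _ "insert b G"]) auto
  qed
  then show ?thesis using that by blast
qed

section \<open>Jaffard overrings and complements\<close>

text \<open>The ideal usually written (T :_R z). For \<open>T = R\<close> it is the ideal of
  denominators of \<open>z\<close>.\<close>

definition conductor :: "'a::field set \<Rightarrow> 'a set \<Rightarrow> 'a \<Rightarrow> 'a set" where
  "conductor R T z = {r \<in> R. r * z \<in> T}"

lemma is_ideal_conductor:
  assumes "overring R T" "fsubring R" shows "is_ideal R (conductor R T z)"
  using assms unfolding is_ideal_def conductor_def overring_def
  by (auto simp: ring_distribs mult.assoc fsubringD dest: subsetD intro: fsubringD)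

text \<open>For \<open>s = a / b\<close> the equational criterion is applied to the relation
  \<open>a * 1 + b * (- s) = 0\<close>. The coefficients \<open>d 0 j\<close> that it attaches to 1
  are denominators of \<open>s\<close>, and they generate the unit ideal of
  \<open>S\<close>.\<close>

lemma flat_conductor:
  assumes R: "fsubring R" "has_quotfield_univ R" and S: "overring R S" "flat_over R S" and s: "s \<in> S"
  shows "1 \<in> conductor R R s \<star> S"
proof -
  obtain a b where ab: "a \<in> R" "b \<in> R" "b \<noteq> 0" "s = a / b"
    using R(2) unfolding has_quotfield_univ_def by blast
  define c where "c i = (if i = 0 then a else b)" for i :: nat
  define x where "x i = (if i = 0 then 1 else - s)" for i :: nat
  have Sr: "fsubring S" using S(1) by (simp add: overring_def)
  have "(\<forall>i<2. c i \<in> R \<and> x i \<in> S) \<and> (\<Sum>i<2. c i * x i) = 0"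
    using ab s Sr by (auto simp: c_def x_def numeral_2_eq_2 fsubringD)
  then obtain m y d where y: "\<forall>j<(m::nat). y j \<in> S" and d: "\<forall>i<2. \<forall>j<m. d i j \<in> R"
    and x1: "\<forall>i<2. x i = (\<Sum>j<m. d i j * y j)" and rel: "\<forall>j<m. (\<Sum>i<2. c i * d i j) = 0"
    using S(2)[unfolded flat_over_def, rule_format, of 2 c x] by blast
  have "d 0 j \<in> conductor R R s" if "j < m" for j
  proof -
    have "a * d 0 j + b * d 1 j = 0" using rel that by (auto simp: c_def numeral_2_eq_2)
    moreover have "a = b * s" using ab by simp
    ultimately have "b * (s * d 0 j + d 1 j) = 0" by (simp only: ring_distribs mult.assoc)
    then have "d 0 j * s = - d 1 j" using ab by (simp add: eq_neg_iff_add_eq_0 mult.commute)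
    then show ?thesis using d that R(1) by (simp add: conductor_def fsubringD)
  qed
  moreover have "1 = (\<Sum>j<m. d 0 j * y j)" using x1[rule_format, of 0] by (simp add: x_def)
  ultimately show ?thesis using y unfolding set_prod_def by blast
qed

text \<open>The product of \<open>I\<close> and \<open>J\<close> still extends to the unit ideal of
  \<open>S\<close>, and it is contained in the intersection.\<close>

lemma one_in_set_prod_Int:
  assumes "fsubring R" "fsubring S" "is_ideal R I" "is_ideal R J" "1 \<in> I \<star> S" "1 \<in> J \<star> S"
  shows "1 \<in> (I \<inter> J) \<star> S"
proof -
  have "1 * 1 \<in> (I \<star> S) \<star> (J \<star> S)" using assms(5,6) by (rule set_prod_mult)
  also have "(I \<star> S) \<star> (J \<star> S) = (I \<star> J) \<star> (S \<star> S)" by (simp add: set_prod_ac)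
  also have "\<dots> \<subseteq> (I \<inter> J) \<star> S"
  proof (rule set_prod_mono)
    show "I \<star> J \<subseteq> I \<inter> J"
    proof (rule set_prod_subsetI)
      show "add_closed (I \<inter> J)" using assms by (auto simp: add_closed_def is_ideal_def)
      fix a b assume "a \<in> I" "b \<in> J"
      then show "a * b \<in> I \<inter> J" using assms(3,4) unfolding is_ideal_def
        by (metis IntI mult.commute subsetD)
    qed
    show "S \<star> S \<subseteq> S"
      using set_prod_subring(1)[of S S] assms(2) by (simp add: fsubringD)
  qed
  finally show ?thesis by simp
qed

lemma is_ideal_self: "fsubring R \<Longrightarrow> is_ideal R R"
  by (simp add: is_ideal_def fsubringD)

lemma is_ideal_Int: "is_ideal R I \<Longrightarrow> is_ideal R J \<Longrightarrow> is_ideal R (I \<inter> J)"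
  by (auto simp: is_ideal_def)

text \<open>The leading \<open>R\<close> keeps the intersection an ideal of \<open>R\<close> when
  \<open>F\<close> is empty.\<close>

lemma one_in_set_prod_INT:
  assumes R: "fsubring R" "fsubring S" and fin: "finite F"
    and F: "\<And>i. i \<in> F \<Longrightarrow> is_ideal R (I i) \<and> 1 \<in> I i \<star> S"
  shows "is_ideal R (R \<inter> (\<Inter>i\<in>F. I i)) \<and> 1 \<in> (R \<inter> (\<Inter>i\<in>F. I i)) \<star> S"
  using fin F
proof (induction F)
  case empty
  have "1 * 1 \<in> R \<star> S" using R by (intro set_prod_mult) (auto simp: fsubringD)
  then show ?case using R by (simp add: is_ideal_self)
next
  case (insert j F)
  have "R \<inter> (\<Inter>i\<in>insert j F. I i) = I j \<inter> (R \<inter> (\<Inter>i\<in>F. I i))" by auto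
  then show ?case
    using insert one_in_set_prod_Int[OF R, of "I j" "R \<inter> (\<Inter>i\<in>F. I i)"] is_ideal_Int by (metis insertCI)
qed

text \<open>Write \<open>z\<close> as a finite sum of products of elements of \<open>T\<close> and
  \<open>S\<close>. An element of \<open>R\<close> that is a denominator of every factor from
  \<open>S\<close> carries \<open>z\<close> into \<open>T\<close>, and by flatness such elements
  generate the unit ideal of \<open>S\<close>.\<close>

lemma conductor_coprime:
  assumes R: "fsubring R" "has_quotfield_univ R" and S: "overring R S" "flat_over R S"
    and T: "overring R T" and TS: "T \<star> S = UNIV"
  shows "1 \<in> conductor R T z \<star> S"
proof -
  have r: "fsubring S" "fsubring T" using S T by (auto simp: overring_def)
  have "z \<in> T \<star> S" using TS by simp
  then obtain F G where FG: "finite G" "F \<subseteq> T" "G \<subseteq> S" "z \<in> F \<star> G"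
    by (metis set_prod_finite_support)
  have "1 \<in> (R \<inter> (\<Inter>s\<in>G. conductor R R s)) \<star> S"
    using FG R S r by (intro one_in_set_prod_INT[THEN conjunct2])
      (auto intro!: flat_conductor is_ideal_conductor simp: overring_def)
  moreover have "R \<inter> (\<Inter>s\<in>G. conductor R R s) \<subseteq> conductor R T z"
  proof
    fix c assume c: "c \<in> R \<inter> (\<Inter>s\<in>G. conductor R R s)"
    have "c * z \<in> T"
      using FG(4)
    proof (induction rule: set_prod_induct)
      case (cons a b x)
      have "c * b \<in> T" using c cons T by (auto simp: conductor_def overring_def)
      moreover have "a \<in> T" using FG cons by blast
      ultimately have "a * (c * b) + c * x \<in> T" using r cons by (simp add: fsubringD)
      then show ?case by (simp add: algebra_simps)
    qed (simp add: r fsubringD)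
    then show "c \<in> conductor R T z" using c by (simp add: conductor_def)
  qed
  ultimately show ?thesis using set_prod_mono[of _ _ S S] by blast
qed

lemma pre_jaffardD:
  assumes "pre_jaffard R \<Theta>"
  shows "S \<in> \<Theta> \<Longrightarrow> overring R S" "S \<in> \<Theta> \<Longrightarrow> flat_over R S"
    "is_ideal R I \<Longrightarrow> I = (\<Inter>S\<in>\<Theta>. I \<star> S)"
    "S \<in> \<Theta> \<Longrightarrow> S' \<in> \<Theta> \<Longrightarrow> S \<noteq> S' \<Longrightarrow> S \<star> S' = UNIV"
    "compactin (zariski R) \<Theta>"
  using assms unfolding pre_jaffard_def by simp_all

lemma pre_jaffard_Inter:
  assumes "fsubring R" "pre_jaffard R \<Theta>"
  shows "\<Inter>\<Theta> = R"
proof -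
  have "R = (\<Inter>S\<in>\<Theta>. R \<star> S)"
    by (rule pre_jaffardD(3)[OF assms(2) is_ideal_self[OF assms(1)]])
  also have "\<dots> = (\<Inter>S\<in>\<Theta>. S)"
  proof (rule INF_cong[OF refl])
    fix S assume "S \<in> \<Theta>"
    then have "overring R S" using assms pre_jaffardD by blast
    then show "R \<star> S = S" using assms(1) unfolding overring_def by (simp add: set_prod_subring fsubringD)
  qed
  finally show ?thesis by simp
qed

text \<open>If \<open>r\<close> carries \<open>z\<close> into \<open>T\<close>, \<open>r'\<close>
  carries it into the intersection of the other members, and \<open>r + r' = 1\<close>, then
  \<open>z = r * z + r' * z\<close> is the splitting. So the ideal of all sums of two such
  multipliers has to be the whole of \<open>R\<close>.\<close>

lemma jaffard_family_sum:
  assumes R: "fsubring R" "has_quotfield_univ R" and jaf: "jaffard_family R \<Lambda>" and T: "T \<in> \<Lambda>"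
  shows "\<exists>a\<in>T. \<exists>b\<in>\<Inter>(\<Lambda> - {T}). z = a + b"
proof -
  define T' where "T' = \<Inter>(\<Lambda> - {T})"
  have ov: "\<And>S. S \<in> \<Lambda> \<Longrightarrow> overring R S \<and> flat_over R S"
    and comp: "\<And>I. is_ideal R I \<Longrightarrow> I = (\<Inter>S\<in>\<Lambda>. I \<star> S)"
    and ind: "\<And>S S'. S \<in> \<Lambda> \<Longrightarrow> S' \<in> \<Lambda> \<Longrightarrow> S \<noteq> S' \<Longrightarrow> S \<star> S' = UNIV"
    and lf: "\<And>x. x \<in> R \<Longrightarrow> x \<noteq> 0 \<Longrightarrow> finite {S\<in>\<Lambda>. inverse x \<notin> S}"
    using jaf pre_jaffardD[of R \<Lambda>] unfolding jaffard_family_def by simp_all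
  have rings: "\<And>S. S \<in> \<Lambda> \<Longrightarrow> fsubring S" using ov by (simp add: overring_def)
  have T'ov: "overring R T'" using ov rings by (auto simp: overring_def T'_def intro!: fsubring_Inter)
  have Tov: "overring R T" using ov T by blast
  define J where "J = conductor R T z"
  define J' where "J' = conductor R T' z"
  have idJ: "is_ideal R J" "is_ideal R J'"
    using Tov T'ov R by (auto simp: J_def J'_def intro!: is_ideal_conductor)
  define I where "I = {r + r' | r r'. r \<in> J \<and> r' \<in> J'}"
  have JI: "J \<subseteq> I" "J' \<subseteq> I"
    using idJ unfolding I_def is_ideal_def by (auto, metis add.right_neutral, metis add.left_neutral)
  have idI: "is_ideal R I"
    unfolding is_ideal_def
  proof (intro conjI ballI)
    have "J \<subseteq> R" "J' \<subseteq> R" using idJ by (auto simp: is_ideal_def)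
    then show "I \<subseteq> R" using R by (auto simp: I_def intro!: fsubringD(3))
    show "0 \<in> I" using idJ JI by (auto simp: is_ideal_def)
  next
    fix x y assume "x \<in> I" "y \<in> I"
    then obtain r r' s s' where "x = r + r'" "y = s + s'" "r \<in> J" "r' \<in> J'" "s \<in> J" "s' \<in> J'"
      by (auto simp: I_def)
    then have "x + y = (r + s) + (r' + s')" "r + s \<in> J" "r' + s' \<in> J'"
      using idJ by (auto simp: is_ideal_def)
    then show "x + y \<in> I" unfolding I_def by blast
  next
    fix r x assume "r \<in> R" "x \<in> I"
    then obtain s s' where "x = s + s'" "s \<in> J" "s' \<in> J'" by (auto simp: I_def)
    then have "r * x = r * s + r * s'" "r * s \<in> J" "r * s' \<in> J'"
      using idJ \<open>r \<in> R\<close> by (auto simp: is_ideal_def ring_distribs)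
    then show "r * x \<in> I" unfolding I_def by blast
  qed
  \<comment> \<open>By completeness \<open>I = R\<close> can be tested in each member: away from \<open>T\<close> already \<open>J\<close> generates the
    unit ideal, and in \<open>T\<close> only finitely many members obstruct \<open>J'\<close>.\<close>
  have "1 \<in> I \<star> S" if S: "S \<in> \<Lambda>" for S
  proof (cases "S = T")
    case False
    then have "1 \<in> J \<star> S"
      unfolding J_def using S T ov ind R by (intro conductor_coprime) auto
    then show ?thesis using JI set_prod_mono[of J I S S] by blast
  next
    case True
    obtain c d where cd: "c \<in> R" "d \<in> R" "d \<noteq> 0" "z = c / d"
      using R(2) unfolding has_quotfield_univ_def by blast
    \<comment> \<open>A member outside \<open>F\<close> and different from \<open>T\<close> contains
      \<open>inverse d\<close>, hence \<open>z\<close>. Only the members of \<open>F\<close>, finite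
      in number by local finiteness, restrict a multiplier of \<open>z\<close>.\<close>
    define F where "F = {S\<in>\<Lambda>. inverse d \<notin> S} - {T}"
    have "1 \<in> (R \<inter> (\<Inter>S\<in>F. conductor R S z)) \<star> T"
    proof (rule one_in_set_prod_INT[THEN conjunct2])
      show "finite F" using lf cd by (simp add: F_def)
      fix U assume "U \<in> F"
      then show "is_ideal R (conductor R U z) \<and> 1 \<in> conductor R U z \<star> T"
        using ov T ind R by (auto simp: F_def intro!: is_ideal_conductor conductor_coprime)
    qed (use R T rings in auto)
    moreover have "R \<inter> (\<Inter>S\<in>F. conductor R S z) \<subseteq> J'"
    proof
      fix r assume r: "r \<in> R \<inter> (\<Inter>S\<in>F. conductor R S z)"
      have "r * z \<in> S" if S: "S \<in> \<Lambda> - {T}" for S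
      proof (cases "S \<in> F")
        case True
        then show ?thesis using r by (auto simp: conductor_def)
      next
        case False
        then have "inverse d \<in> S" "r \<in> S" "c \<in> S"
          using S r cd ov by (auto simp: F_def overring_def)
        then show ?thesis using rings S cd by (simp add: divide_inverse fsubringD)
      qed
      then show "r \<in> J'" using r by (auto simp: J'_def T'_def conductor_def)
    qed
    ultimately show ?thesis using JI set_prod_mono[of _ I T T] True by blast
  qed
  then have "1 \<in> I" using comp[OF idI] by blast
  then obtain r r' where "r + r' = 1" "r \<in> J" "r' \<in> J'" by (auto simp: I_def)
  then have "z = r * z + r' * z" "r * z \<in> T" "r' * z \<in> T'"
    by (auto simp: J_def J'_def conductor_def ring_distribs[symmetric])
  then show ?thesis unfolding T'_def by blast
qed

text \<open>For \<open>c\<close> in \<open>conductor R T x\<close> the product \<open>c * x\<close>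
  lies in \<open>T\<close> and in \<open>T'\<close>, hence in \<open>R\<close>. As these
  \<open>c\<close> generate the unit ideal of \<open>S\<close>, \<open>x\<close> lies in
  \<open>S\<close>. This compares a complement of \<open>T\<close> taken from one family with the
  members of another.\<close>

lemma complement_subset:
  assumes R: "fsubring R" "has_quotfield_univ R" and S: "overring R S" "flat_over R S"
    and T: "overring R T" and TS: "T \<star> S = UNIV" and T': "overring R T'" "T \<inter> T' \<subseteq> R"
  shows "T' \<subseteq> S"
proof
  fix x assume x: "x \<in> T'"
  have r: "fsubring S" "fsubring T'" using S T' by (auto simp: overring_def)
  have "1 \<in> conductor R T x \<star> S" by (rule conductor_coprime) fact+
  moreover have "c * x \<in> R" if "c \<in> conductor R T x" for c
  proof -
    from that have "c \<in> R" "c * x \<in> T" by (auto simp: conductor_def)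
    moreover from this have "c * x \<in> T'" using T' x r by (auto simp: overring_def intro: fsubringD)
    ultimately show ?thesis using T'(2) by blast
  qed
  ultimately have "conductor R T x \<star> S \<subseteq> {u. u * x \<in> S}"
    using r S
    by (intro set_prod_subsetI)
       (auto simp: add_closed_def ring_distribs fsubringD overring_def,
        metis fsubringD(5) mult.assoc mult.commute subsetD)
  then show "x \<in> S" using \<open>1 \<in> conductor R T x \<star> S\<close> by auto
qed

lemma common_denominator:
  assumes "fsubring R" "has_quotfield_univ R" "finite Z"
  shows "\<exists>d\<in>R. d \<noteq> 0 \<and> (\<forall>z\<in>Z. d * z \<in> R)"
  using assms(3)
proof (induction Z)
  case empty then show ?case using assms by (intro bexI[of _ 1]) (auto simp: fsubringD)
next
  case (insert z Z)
  then obtain d where d: "d \<in> R" "d \<noteq> 0" "\<forall>z\<in>Z. d * z \<in> R" by blast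
  obtain u v where uv: "u \<in> R" "v \<in> R" "v \<noteq> 0" "z = u / v"
    using assms(2) unfolding has_quotfield_univ_def by blast
  have "(d * v) * y \<in> R" if "y \<in> insert z Z" for y
  proof (cases "y = z")
    case True then show ?thesis using d uv assms by (simp add: fsubringD)
  next
    case False
    then have "v * (d * y) \<in> R" using d uv assms that by (simp add: fsubringD)
    then show ?thesis by (simp add: ac_simps)
  qed
  then show ?case using d uv assms by (intro bexI[of _ "d * v"]) (auto simp: fsubringD)
qed

text \<open>A common denominator turns a relation with coefficients in \<open>R\<close> into one
  with coefficients in \<open>D\<close>, and what solves the latter over \<open>D\<close> also
  solves the former.\<close>

lemma flat_over_overring:
  assumes D: "fsubring D" "has_quotfield_univ D" and S: "flat_over D S"
    and R: "overring D R"
  shows "flat_over R S"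
  unfolding flat_over_def
proof (intro allI impI)
  fix n :: nat and a x :: "nat \<Rightarrow> 'a"
  assume ax: "(\<forall>i<n. a i \<in> R \<and> x i \<in> S) \<and> (\<Sum>i<n. a i * x i) = 0"
  obtain d where d: "d \<in> D" "d \<noteq> 0" "\<forall>i<n. d * a i \<in> D"
    using common_denominator[OF D, of "a ` {..<n}"] by auto
  have "(\<Sum>i<n. d * a i * x i) = 0" using ax by (simp add: mult.assoc sum_distrib_left[symmetric])
  then obtain m y b where *: "\<forall>j<(m::nat). y j \<in> S" "\<forall>i<n. \<forall>j<m. b i j \<in> D"
    "\<forall>i<n. x i = (\<Sum>j<m. b i j * y j)" "\<forall>j<m. (\<Sum>i<n. d * a i * b i j) = 0"
    using S[unfolded flat_over_def, rule_format, of n "\<lambda>i. d * a i" x] d ax by blast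
  then have "\<forall>j<m. (\<Sum>i<n. a i * b i j) = 0"
    using d by (simp add: mult.assoc sum_distrib_left[symmetric])
  moreover have "\<forall>i<n. \<forall>j<m. b i j \<in> R" using * R by (auto simp: overring_def)
  ultimately show "\<exists>(m::nat) y b. (\<forall>j<m. y j \<in> S) \<and> (\<forall>i<n. \<forall>j<m. b i j \<in> R) \<and>
         (\<forall>i<n. x i = (\<Sum>j<m. b i j * y j)) \<and> (\<forall>j<m. (\<Sum>i<n. a i * b i j) = 0)"
    using * by (intro exI[of _ m] exI[of _ y] exI[of _ b]) simp
qed

text \<open>The Jaffard family \<open>\<Lambda>\<close> behind \<open>jaffard_overring\<close> is
  only known to contain \<open>T\<close>. The complement of \<open>T\<close> in
  \<open>\<Lambda>\<close> lies in every other member of \<open>N\<close>, so its decomposition of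
  \<open>z\<close> also serves for the larger complement formed in \<open>N\<close>.\<close>

lemma jaffard_overring_complement:
  assumes D: "fsubring D" "has_quotfield_univ D"
    and N: "\<And>S. S \<in> N \<Longrightarrow> overring D S \<and> flat_over D S"
    and ind: "\<And>S S'. S \<in> N \<Longrightarrow> S' \<in> N \<Longrightarrow> S \<noteq> S' \<Longrightarrow> S \<star> S' = UNIV"
    and T: "T \<in> N" "jaffard_overring (\<Inter>N) T"
  shows "\<exists>a\<in>T. \<exists>b\<in>\<Inter>(N - {T}). z = a + b"
proof -
  define R where "R = \<Inter>N"
  have rR: "fsubring R" unfolding R_def using N by (intro fsubring_Inter) (simp add: overring_def)
  have DR: "overring D R" using rR N by (auto simp: overring_def R_def)
  have qR: "has_quotfield_univ R"
    using D(2) DR unfolding has_quotfield_univ_def overring_def by blast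
  obtain \<Lambda> where L: "jaffard_family R \<Lambda>" "T \<in> \<Lambda>"
    using T(2) unfolding jaffard_overring_def R_def by blast
  define T' where "T' = \<Inter>(\<Lambda> - {T})"
  have ovL: "\<And>S. S \<in> \<Lambda> \<Longrightarrow> overring R S"
    using L pre_jaffardD(1) unfolding jaffard_family_def by blast
  have T'ov: "overring R T'" using ovL rR by (auto simp: overring_def T'_def intro!: fsubring_Inter)
  have "R = \<Inter>\<Lambda>"
    using L pre_jaffard_Inter[OF rR] by (simp add: jaffard_family_def)
  then have "T \<inter> T' \<subseteq> R" using L(2) unfolding T'_def by blast
  have "T' \<subseteq> \<Inter>(N - {T})"
  proof (rule Inter_greatest)
    fix S assume S: "S \<in> N - {T}"
    show "T' \<subseteq> S"
    proof (rule complement_subset[of R S T T'])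
      show "overring R S" using S N by (auto simp: overring_def R_def)
      show "flat_over R S" using flat_over_overring[OF D _ DR] N S by blast
      show "T \<star> S = UNIV" using ind S T by auto
      show "overring R T" using ovL L by blast
    qed fact+
  qed
  then show ?thesis using jaffard_family_sum[OF rR qR L, of z] unfolding T'_def by blast
qed

section \<open>Matlis pairs and invertible modules\<close>

text \<open>\<open>T\<close> and \<open>T'\<close> are overrings with \<open>K/R = T/R \<oplus> T'/R\<close>.\<close>

definition matlis_pair :: "'a::field set \<Rightarrow> 'a set \<Rightarrow> 'a set \<Rightarrow> bool" where
  "matlis_pair R T T' \<longleftrightarrow> fsubring T \<and> fsubring T' \<and> T \<inter> T' = R \<and> (\<forall>z. \<exists>a\<in>T. \<exists>b\<in>T'. z = a + b)"

lemma matlis_pair_sym: "matlis_pair R T T' \<Longrightarrow> matlis_pair R T' T"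
  unfolding matlis_pair_def by (metis Int_commute add.commute)

text \<open>Splitting \<open>1 / d\<close> for a common denominator \<open>d\<close> of
  \<open>Z\<close> gives a partition of unity in \<open>R\<close>, since
  \<open>d * a = 1 - d * b\<close> lies in both rings. The multiplier \<open>d * b\<close> carries
  every \<open>z\<close> in both \<open>Z\<close> and \<open>T\<close> into \<open>R\<close>,
  because \<open>b * (d * z)\<close> lies in \<open>T'\<close>; symmetrically for
  \<open>d * a\<close> and \<open>T'\<close>.\<close>

lemma matlis_partition:
  assumes m: "matlis_pair R T T'" and q: "has_quotfield_univ R" and Z: "finite Z"
  obtains d a b where "d \<in> R" "a \<in> T" "b \<in> T'" "d * a \<in> R" "d * b \<in> R" "d * a + d * b = 1"
    "\<And>z. z \<in> Z \<Longrightarrow> d * z \<in> R"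
proof -
  have r: "fsubring T" "fsubring T'" and R: "R = T \<inter> T'" using m by (auto simp: matlis_pair_def)
  then have "fsubring R" by (simp add: fsubring_Int)
  then obtain d where d: "d \<in> R" "d \<noteq> 0" "\<forall>z\<in>Z. d * z \<in> R"
    using common_denominator q Z by blast
  obtain a b where ab: "a \<in> T" "b \<in> T'" "1 / d = a + b" using m unfolding matlis_pair_def by blast
  then have sum: "d * a + d * b = 1" using d by (simp add: ring_distribs[symmetric] flip: ab(3))
  have "d * a \<in> T" "d * b \<in> T'" "1 \<in> T" "1 \<in> T'" using d ab r R by (auto simp: fsubringD)
  moreover have "d * a = 1 - d * b" "d * b = 1 - d * a" using sum by (auto simp: algebra_simps)
  ultimately have "d * a \<in> R" "d * b \<in> R" using R r by (metis IntI fsubringD(4))+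
  then show ?thesis using that d ab sum by blast
qed

text \<open>Instantiated twice: with the embedding of \<open>K\<close> into \<open>K(X)\<close> and \<open>A = Int(D)\<close>, and with the
  identity and \<open>A = D\<close>. In the second case \<open>inv_mod R\<close> consists of the invertible ideals of \<open>R\<close>.\<close>

locale scalar_extension =
  fixes D :: "'k::field set" and e :: "'k \<Rightarrow> 'q::field" and A :: "'q set"
  assumes D: "fsubring D" "has_quotfield_univ D"
    and e_add: "e (x + y) = e x + e y" and e_mult: "e (x * y) = e x * e y" and e_1 [simp]: "e 1 = 1"
    and A: "fsubring A" "e ` D \<subseteq> A"
begin

lemma e_0 [simp]: "e 0 = 0"
  by (metis add.right_neutral add_left_cancel e_add)

lemma e_diff: "e (x - y) = e x - e y"
  using e_add[of "x - y" y] by simp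

lemma e_image_set_prod: "e ` (M \<star> N) = e ` M \<star> e ` N"
  by (rule image_set_prod) (simp_all add: e_add e_mult)

lemma fsubring_image: "fsubring R \<Longrightarrow> fsubring (e ` R)"
  unfolding fsubring_def
  by (auto simp: e_add[symmetric] e_mult[symmetric] e_diff[symmetric])
     (metis e_0 e_1 image_eqI)+

lemma image_prod_image:
  "fsubring R' \<Longrightarrow> fsubring R \<Longrightarrow> R \<subseteq> R' \<Longrightarrow> e ` R \<star> e ` R' = e ` R'"
  by (rule set_prod_subring) (auto intro: fsubring_image simp: image_iff, metis e_1 fsubringD(2))

section \<open>Scalar extension and invertible modules\<close>

definition ext :: "'k set \<Rightarrow> 'q set" where
  "ext R = A \<star> e ` R"

lemma fsubring_ext: "fsubring R \<Longrightarrow> fsubring (ext R)"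
  unfolding ext_def by (intro fsubring_set_prod A fsubring_image)

lemma ext_idem: "fsubring R \<Longrightarrow> ext R \<star> ext R = ext R"
  by (intro set_prod_idem fsubring_ext)

lemma ext_image: "fsubring R \<Longrightarrow> fsubring R' \<Longrightarrow> R \<subseteq> R' \<Longrightarrow> ext R \<star> e ` R' = ext R'"
  unfolding ext_def by (simp only: set_prod.assoc image_prod_image)

lemma ext_image_self: "fsubring R \<Longrightarrow> ext R \<star> e ` R = ext R"
  by (simp add: ext_image)

lemma ext_D: "ext D = A"
  unfolding ext_def using D by (intro set_prod_subring A) (auto simp: image_iff, metis e_1 fsubringD(2))

lemma one_ext: "fsubring R \<Longrightarrow> 1 \<in> ext R"
  using fsubring_ext fsubringD by blast

text \<open>The normalization \<open>I K = A K\<close> makes \<open>inv_mod\<close> split along Matlis pairs; in \<open>K(X)\<close> it costs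
  nothing, since ideals of \<open>K[X]\<close> are principal.\<close>

definition inv_mod :: "'k set \<Rightarrow> 'q set \<Rightarrow> bool" where
  "inv_mod R I \<longleftrightarrow> I \<star> ext R = I \<and> (\<exists>J. I \<star> J = ext R) \<and> I \<star> e ` UNIV = ext UNIV"

lemma inv_mod_image:
  assumes "fsubring R" "inv_mod R I" shows "I \<star> e ` R = I"
proof -
  have "I \<star> e ` R = I \<star> (ext R \<star> e ` R)" using assms by (metis inv_mod_def set_prod.assoc)
  then show ?thesis using assms by (simp add: ext_image inv_mod_def)
qed

lemma inv_mod_ext: "fsubring R \<Longrightarrow> inv_mod R (ext R)"
  unfolding inv_mod_def using ext_idem ext_image[OF _ fsubring_UNIV] by auto

lemma inv_mod_mult:
  assumes R: "fsubring R" and I: "inv_mod R I" and J: "inv_mod R J"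
  shows "inv_mod R (I \<star> J)"
proof -
  obtain I' J' where I': "I \<star> I' = ext R" and J': "J \<star> J' = ext R"
    using I J unfolding inv_mod_def by blast
  have "I \<star> J \<star> (I' \<star> J') = (I \<star> I') \<star> (J \<star> J')" by (simp add: set_prod_ac)
  then have "I \<star> J \<star> (I' \<star> J') = ext R" by (simp add: I' J' ext_idem R)
  moreover have "I \<star> J \<star> e ` UNIV = (I \<star> e ` UNIV) \<star> (J \<star> e ` UNIV)"
  proof -
    have "e ` UNIV \<star> e ` UNIV = e ` UNIV" by (simp add: image_prod_image fsubring_UNIV)
    then show ?thesis by (metis set_prod.assoc set_prod.left_commute)
  qed
  ultimately show ?thesis using I J unfolding inv_mod_def
    by (auto simp: set_prod.assoc ext_idem fsubring_UNIV)
qed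

lemma inv_mod_inverse:
  assumes R: "fsubring R" and I: "inv_mod R I"
  obtains J where "inv_mod R J" "I \<star> J = ext R"
proof -
  obtain J where J: "I \<star> J = ext R" using I by (auto simp: inv_mod_def)
  define J' where "J' = J \<star> ext R"
  have 1: "I \<star> J' = ext R" by (simp add: J'_def J ext_idem R flip: set_prod.assoc)
  have 2: "J' \<star> ext R = J'" by (simp add: J'_def set_prod.assoc ext_idem R)
  have "J' \<star> e ` UNIV = J' \<star> (ext R \<star> e ` UNIV)" by (metis 2 set_prod.assoc)
  also have "\<dots> = J' \<star> (I \<star> e ` UNIV)" using I R by (simp add: inv_mod_def ext_image fsubring_UNIV)
  also have "\<dots> = ext R \<star> e ` UNIV" by (metis 1 set_prod.assoc set_prod.commute)
  finally have "J' \<star> e ` UNIV = ext UNIV" using R by (simp add: ext_image fsubring_UNIV)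
  then have "inv_mod R J'" using 1 2 by (auto simp: inv_mod_def set_prod.commute)
  then show ?thesis using that 1 by blast
qed

lemma inv_mod_extend:
  assumes R: "fsubring R" "fsubring R'" "R \<subseteq> R'" and I: "inv_mod R I"
  shows "inv_mod R' (I \<star> e ` R')"
proof -
  obtain J where J: "I \<star> J = ext R" using I by (auto simp: inv_mod_def)
  have RR: "e ` R' \<star> e ` R' = e ` R'" by (simp add: R image_prod_image)
  have "I \<star> e ` R' \<star> (J \<star> e ` R') = (I \<star> J) \<star> (e ` R' \<star> e ` R')" by (simp add: set_prod_ac)
  then have 1: "I \<star> e ` R' \<star> (J \<star> e ` R') = ext R'" by (simp add: J RR ext_image R)
  have "I \<star> e ` R' \<star> ext R' = I \<star> e ` R' \<star> (ext R \<star> e ` R')" by (simp add: ext_image R)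
  also have "\<dots> = (I \<star> ext R) \<star> (e ` R' \<star> e ` R')" by (simp add: set_prod_ac)
  finally have 2: "I \<star> e ` R' \<star> ext R' = I \<star> e ` R'" using I by (simp add: RR inv_mod_def)
  have "I \<star> e ` R' \<star> e ` UNIV = I \<star> (e ` R' \<star> e ` UNIV)" by (simp add: set_prod_ac)
  then have "I \<star> e ` R' \<star> e ` UNIV = ext UNIV"
    using I R by (simp add: image_prod_image fsubring_UNIV inv_mod_def)
  then show ?thesis using 1 2 by (auto simp: inv_mod_def)
qed

lemma extend_mult:
  assumes "fsubring R"
  shows "(I \<star> J) \<star> e ` R = (I \<star> e ` R) \<star> (J \<star> e ` R)"
proof -
  have "e ` R \<star> e ` R = e ` R" using assms by (simp add: image_prod_image)
  then show ?thesis by (metis set_prod.assoc set_prod.left_commute)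
qed

lemma extend_extend:
  assumes "fsubring R" "fsubring R'" "R \<subseteq> R'"
  shows "I \<star> e ` R \<star> e ` R' = I \<star> e ` R'"
  using assms by (simp add: set_prod.assoc image_prod_image)

text \<open>\<open>Z\<close> consists of the scalars in one expression of \<open>m\<close>. It is
  fixed before \<open>r\<close> and \<open>S\<close>, so the same expression can be multiplied by a
  part of a partition of unity or, with \<open>r = 1\<close>, be read over fewer scalars.\<close>

lemma extend_denominators:
  assumes "m \<in> M \<star> e ` T"
  shows "\<exists>Z. finite Z \<and> Z \<subseteq> T \<and> (\<forall>r S. (\<forall>z\<in>Z. r * z \<in> S) \<longrightarrow> e r * m \<in> M \<star> e ` S)"
  using assms
proof (induction rule: set_prod_induct)
  case zero show ?case by (rule exI[of _ "{}"]) simp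
next
  case (cons a b x)
  then obtain Z t where Z: "finite Z" "Z \<subseteq> T" "\<forall>r S. (\<forall>z\<in>Z. r * z \<in> S) \<longrightarrow> e r * x \<in> M \<star> e ` S"
    and t: "b = e t" "t \<in> T" by blast
  have "e r * (a * b + x) \<in> M \<star> e ` S" if "\<forall>z\<in>insert t Z. r * z \<in> S" for r S
  proof -
    have "a * e (r * t) + e r * x \<in> M \<star> e ` S"
      using that Z cons by (intro set_prod_cons) auto
    then show ?thesis by (simp add: t e_mult algebra_simps)
  qed
  then show ?case using Z t by (intro exI[of _ "insert t Z"]) auto
qed

text \<open>For \<open>m\<close> in both extensions, \<open>d * b\<close> carries the scalars of its
  expression over \<open>T\<close> into \<open>R\<close>, and \<open>d * a\<close> those of its
  expression over \<open>T'\<close>. Then \<open>m\<close> is the sum of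
  \<open>e (d * a) * m\<close> and \<open>e (d * b) * m\<close>, both of which lie in
  \<open>M\<close>.\<close>

lemma matlis_module:
  assumes m: "matlis_pair R T T'" and q: "has_quotfield_univ R" and M: "M \<star> e ` R = M"
  shows "M \<star> e ` T \<inter> M \<star> e ` T' = M"
proof -
  have r: "fsubring T" "fsubring T'" and R: "R = T \<inter> T'" using m by (auto simp: matlis_pair_def)
  have "m \<in> M" if m1: "m \<in> M \<star> e ` T" and m2: "m \<in> M \<star> e ` T'" for m
  proof -
    obtain Z1 where Z1: "finite Z1" "Z1 \<subseteq> T"
      "\<forall>r S. (\<forall>z\<in>Z1. r * z \<in> S) \<longrightarrow> e r * m \<in> M \<star> e ` S"
      using extend_denominators[OF m1] by auto
    obtain Z2 where Z2: "finite Z2" "Z2 \<subseteq> T'"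
      "\<forall>r S. (\<forall>z\<in>Z2. r * z \<in> S) \<longrightarrow> e r * m \<in> M \<star> e ` S"
      using extend_denominators[OF m2] by auto
    obtain d a b where d: "d \<in> R" "a \<in> T" "b \<in> T'" "d * a \<in> R" "d * b \<in> R" "d * a + d * b = 1"
      "\<And>z. z \<in> Z1 \<union> Z2 \<Longrightarrow> d * z \<in> R"
      using matlis_partition[OF m q, of "Z1 \<union> Z2"] Z1(1) Z2(1) by blast
    have "d * b * z \<in> R" if "z \<in> Z1" for z
    proof -
      have "b * (d * z) \<in> T'" "(d * b) * z \<in> T" using d(3,5,7) that Z1(2) r R by (auto intro: fsubringD(5))
      then show ?thesis using R by (simp add: ac_simps)
    qed
    then have 1: "e (d * b) * m \<in> M" using Z1(3)[rule_format, of "d * b" R] M by simp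
    have "d * a * z \<in> R" if "z \<in> Z2" for z
    proof -
      have "a * (d * z) \<in> T" "(d * a) * z \<in> T'" using d(2,4,7) that Z2(2) r R by (auto intro: fsubringD(5))
      then show ?thesis using R by (simp add: ac_simps)
    qed
    then have 2: "e (d * a) * m \<in> M" using Z2(3)[rule_format, of "d * a" R] M by simp
    have "m = e (d * a) * m + e (d * b) * m"
      using d(6) by (metis e_1 e_add distrib_right mult_1)
    then show "m \<in> M" using 1 2 M by (metis set_prod_add)
  qed
  moreover have "1 \<in> e ` T" "1 \<in> e ` T'" using r by (metis e_1 fsubringD(2) image_eqI)+
  then have "M \<subseteq> M \<star> e ` T" "M \<subseteq> M \<star> e ` T'" by (simp_all add: set_prod_superset)
  ultimately show ?thesis by blast
qed

lemma matlis_module_eqI: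
  assumes "matlis_pair R T T'" "has_quotfield_univ R" "M \<star> e ` R = M" "M' \<star> e ` R = M'"
    "M \<star> e ` T = M' \<star> e ` T" "M \<star> e ` T' = M' \<star> e ` T'"
  shows "M = M'"
  using matlis_module[OF assms(1,2,3), unfolded assms(5,6)]
    matlis_module[OF assms(1,2,4)] by simp

text \<open>Both modules have the same span over \<open>K\<close>, so some \<open>d\<close> in
  \<open>R\<close> carries a given \<open>m\<close> of \<open>M1\<close> into \<open>M2\<close>. A
  partition of unity gives m = (d m) a + (d b) m, where d m and (d b) m lie in both modules and a
  lies in \<open>T\<close>.\<close>

lemma matlis_Int:
  assumes m: "matlis_pair R T T'" and q: "has_quotfield_univ R"
    and M1: "M1 \<star> e ` T = M1" and M2: "M2 \<star> e ` T' = M2"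
    and K: "M1 \<star> e ` UNIV = M2 \<star> e ` UNIV"
  shows "(M1 \<inter> M2) \<star> e ` T = M1"
proof
  show "(M1 \<inter> M2) \<star> e ` T \<subseteq> M1" using set_prod_mono[of "M1 \<inter> M2" M1 "e ` T" "e ` T"] M1 by auto
  have r: "fsubring T" "fsubring T'" and R: "R = T \<inter> T'" using m by (auto simp: matlis_pair_def)
  have mod1: "x * e t \<in> M1" if "x \<in> M1" "t \<in> T" for x t using set_prod_mult[of x M1 "e t" "e ` T"] that M1 by auto
  have mod2: "x * e t \<in> M2" if "x \<in> M2" "t \<in> T'" for x t using set_prod_mult[of x M2 "e t" "e ` T'"] that M2 by auto
  show "M1 \<subseteq> (M1 \<inter> M2) \<star> e ` T"
  proof
    fix m assume m1: "m \<in> M1"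
    have "1 \<in> e ` UNIV" by (metis e_1 rangeI)
    then have "m \<in> M2 \<star> e ` UNIV" using m1 K set_prod_superset by blast
    then obtain Z where Z: "finite Z" "\<forall>r S. (\<forall>z\<in>Z. r * z \<in> S) \<longrightarrow> e r * m \<in> M2 \<star> e ` S"
      using extend_denominators[of m M2 UNIV] by auto
    obtain d a b where d: "d \<in> R" "a \<in> T" "b \<in> T'" "d * a \<in> R" "d * b \<in> R" "d * a + d * b = 1"
      "\<And>z. z \<in> Z \<Longrightarrow> d * z \<in> R"
      using matlis_partition[OF m q Z(1)] by blast
    have dm: "e d * m \<in> M2" using Z(2)[rule_format, of d T'] d R M2 by auto
    have dbm: "e (d * b) * m \<in> M2" using mod2[OF dm, of b] d by (simp add: e_mult ac_simps)
    have 1: "e d * m \<in> M1 \<inter> M2" using dm mod1[OF m1, of d] d R by (simp add: ac_simps)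
    have 2: "e (d * b) * m \<in> M1 \<inter> M2" using dbm mod1[OF m1, of "d * b"] d R by (simp add: ac_simps)
    have "(e d * m) * e a + ((e (d * b) * m) * e 1 + 0) \<in> (M1 \<inter> M2) \<star> e ` T"
      using 1 2 d r by (intro set_prod_cons imageI set_prod_0) (auto intro: fsubringD)
    moreover have "(e d * m) * e a + ((e (d * b) * m) * e 1 + 0) = e (d * a + d * b) * m"
      by (simp add: e_add e_mult algebra_simps)
    ultimately show "m \<in> (M1 \<inter> M2) \<star> e ` T" using d(6) by simp
  qed
qed

text \<open>The inverse of the glued module is the intersection of the inverses \<open>J1\<close>
  and \<open>J2\<close>; the product is compared with \<open>ext R\<close> after extension to
  \<open>T\<close> and \<open>T'\<close>. Together with \<open>matlis_module\<close> this is the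
  splitting of the group of invertible modules.\<close>

lemma inv_mod_Int:
  assumes m: "matlis_pair R T T'" and q: "has_quotfield_univ R"
    and I1: "inv_mod T I1" and I2: "inv_mod T' I2"
  shows "inv_mod R (I1 \<inter> I2)" "(I1 \<inter> I2) \<star> e ` T = I1" "(I1 \<inter> I2) \<star> e ` T' = I2"
proof -
  have r: "fsubring T" "fsubring T'" and R: "R = T \<inter> T'" using m by (auto simp: matlis_pair_def)
  then have rR: "fsubring R" by (simp add: fsubring_Int)
  have RT: "R \<subseteq> T" "R \<subseteq> T'" using R by auto
  \<comment> \<open>Claimed for arbitrary pairs, because it is also applied to the inverses.\<close>
  have key: "(I1 \<inter> I2) \<star> e ` T = I1 \<and> (I1 \<inter> I2) \<star> e ` T' = I2" if "inv_mod T I1" "inv_mod T' I2" for I1 I2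
  proof
    have K: "I1 \<star> e ` UNIV = I2 \<star> e ` UNIV" using that by (simp add: inv_mod_def)
    show "(I1 \<inter> I2) \<star> e ` T = I1"
      by (rule matlis_Int[OF m q _ _ K]) (use that r in \<open>simp_all add: inv_mod_image\<close>)
    show "(I1 \<inter> I2) \<star> e ` T' = I2" unfolding Int_commute[of I1]
      by (rule matlis_Int[OF matlis_pair_sym[OF m] q _ _ K[symmetric]]) (use that r in \<open>simp_all add: inv_mod_image\<close>)
  qed
  then show *: "(I1 \<inter> I2) \<star> e ` T = I1" "(I1 \<inter> I2) \<star> e ` T' = I2" using I1 I2 by auto
  have modR: "(I1 \<inter> I2) \<star> e ` R = I1 \<inter> I2" if "inv_mod T I1" "inv_mod T' I2" for I1 I2
  proof -
    have "I1 \<star> e ` T = I1" "I2 \<star> e ` T' = I2" using that r by (simp_all add: inv_mod_image)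
    then show ?thesis
      using set_prod_module_iff[OF fsubring_image[OF r(1)], of I1] set_prod_module_iff[OF fsubring_image[OF r(2)], of I2]
      by (subst set_prod_module_iff[OF fsubring_image[OF rR]]) (use RT in \<open>auto simp: add_closed_def\<close>)
  qed
  obtain J1 where J1: "inv_mod T J1" "I1 \<star> J1 = ext T" using inv_mod_inverse[OF r(1) I1] .
  obtain J2 where J2: "inv_mod T' J2" "I2 \<star> J2 = ext T'" using inv_mod_inverse[OF r(2) I2] .
  have eq1: "(I1 \<inter> I2) \<star> (J1 \<inter> J2) = ext R"
  proof (rule matlis_module_eqI[OF m q])
    show "(I1 \<inter> I2) \<star> (J1 \<inter> J2) \<star> e ` R = (I1 \<inter> I2) \<star> (J1 \<inter> J2)"
      by (simp add: set_prod.assoc modR J1 J2)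
  qed (use * key[OF J1(1) J2(1)] r rR RT in \<open>simp_all add: extend_mult ext_image J1 J2\<close>)
  have eq2: "(I1 \<inter> I2) \<star> ext R = I1 \<inter> I2"
  proof (rule matlis_module_eqI[OF m q])
    show "(I1 \<inter> I2) \<star> ext R \<star> e ` R = (I1 \<inter> I2) \<star> ext R"
      by (simp add: set_prod.assoc ext_image rR)
  qed (use * I1 I2 r rR RT in \<open>simp_all add: extend_mult[of _ "_ \<inter> _"] ext_image modR inv_mod_def\<close>)
  have "(I1 \<inter> I2) \<star> e ` UNIV = (I1 \<inter> I2) \<star> e ` T \<star> e ` UNIV"
    by (simp add: extend_extend r fsubring_UNIV)
  then have "(I1 \<inter> I2) \<star> e ` UNIV = ext UNIV" using * I1 by (simp add: inv_mod_def)
  then show "inv_mod R (I1 \<inter> I2)" using eq1 eq2 by (auto simp: inv_mod_def)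
qed

text \<open>\<open>F\<close> and \<open>G\<close> come from an expression of 1 in
  \<open>I \<star> J\<close>, and \<open>I\<close> is contained in
  \<open>F \<star> (I \<star> G)\<close>. The conditions on \<open>F\<close> and \<open>G\<close>
  form a finite certificate of invertibility, which \<open>inv_mod_generated\<close> reads back over
  another ring.\<close>

lemma inv_mod_generators:
  assumes R: "fsubring R" and I: "inv_mod R I"
  obtains F G where "finite F" "finite G" "1 \<in> F \<star> G" "F \<star> G \<subseteq> ext R" "I = F \<star> ext R" "F \<subseteq> I"
proof -
  obtain J where J: "I \<star> J = ext R" using I by (auto simp: inv_mod_def)
  then have "1 \<in> I \<star> J" using one_ext R by simp
  then obtain F G where FG: "finite F" "F \<subseteq> I" "finite G" "G \<subseteq> J" "1 \<in> F \<star> G"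
    using set_prod_finite_support by metis
  have sub: "F \<star> G \<subseteq> ext R" "I \<star> G \<subseteq> ext R"
    using set_prod_mono[OF FG(2,4)] set_prod_mono[OF order_refl FG(4), of I] J by auto
  have "F \<star> ext R \<subseteq> I" using set_prod_mono[OF FG(2) order_refl, of "ext R"] I by (simp add: inv_mod_def)
  moreover have "I \<subseteq> I \<star> (F \<star> G)" using FG set_prod_superset by blast
  then have "I \<subseteq> F \<star> (I \<star> G)" by (simp add: set_prod_ac)
  then have "I \<subseteq> F \<star> ext R" using set_prod_mono[OF order_refl sub(2)] by blast
  ultimately show ?thesis using that FG sub by blast
qed

lemma inv_mod_generated:
  assumes R: "fsubring R" and FG: "1 \<in> F \<star> G" "F \<star> G \<subseteq> ext R" and K: "F \<star> ext UNIV = ext UNIV"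
  shows "inv_mod R (F \<star> ext R)"
proof -
  have "F \<star> ext R \<star> (G \<star> ext R) = (F \<star> G) \<star> (ext R \<star> ext R)" by (simp add: set_prod_ac)
  also have "\<dots> = (F \<star> G) \<star> ext R" by (simp add: ext_idem R)
  also have "\<dots> = ext R" using set_prod_subring(1)[OF fsubring_ext[OF R] FG] .
  finally have "F \<star> ext R \<star> (G \<star> ext R) = ext R" .
  then show ?thesis unfolding inv_mod_def
    by (auto simp: set_prod.assoc ext_idem R ext_image fsubring_UNIV K)
qed

end

section \<open>Descent along a chain of rings\<close>

lemma chain_finite_subset:
  assumes "\<C> \<noteq> {}" "\<And>R S. R \<in> \<C> \<Longrightarrow> S \<in> \<C> \<Longrightarrow> R \<subseteq> S \<or> S \<subseteq> R" "finite X" "X \<subseteq> \<Union>\<C>"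
  obtains R where "R \<in> \<C>" "X \<subseteq> R"
proof -
  have "subset.chain UNIV \<C>" using assms(2) by (auto simp: subset_chain_def)
  then show ?thesis using finite_subset_Union_chain[OF assms(3,4,1)] that by blast
qed

locale ring_chain = scalar_extension +
  fixes \<C> :: "'a set set" and R :: "'a set"
  assumes ne: "\<C> \<noteq> {}" and chain: "\<And>R S. R \<in> \<C> \<Longrightarrow> S \<in> \<C> \<Longrightarrow> R \<subseteq> S \<or> S \<subseteq> R"
    and rings: "\<And>R. R \<in> \<C> \<Longrightarrow> fsubring R" and R: "fsubring R" "R = \<Union>\<C>"
begin

lemma chain_subset: "S \<in> \<C> \<Longrightarrow> S \<subseteq> R"
  using R by blast

lemma extend_chain:
  assumes "finite X" "X \<subseteq> M \<star> e ` R" "S0 \<in> \<C>"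
  obtains S where "S \<in> \<C>" "S0 \<subseteq> S" "X \<subseteq> M \<star> e ` S"
proof -
  have "\<exists>Z. finite Z \<and> Z \<subseteq> R \<and> x \<in> M \<star> e ` Z" if x: "x \<in> X" for x
  proof -
    obtain Z where Z: "finite Z" "Z \<subseteq> R" "\<forall>r S. (\<forall>z\<in>Z. r * z \<in> S) \<longrightarrow> e r * x \<in> M \<star> e ` S"
      using extend_denominators[OF subsetD[OF assms(2) x]] by blast
    have "e 1 * x \<in> M \<star> e ` Z" using Z(3)[rule_format, of 1 Z] by simp
    then show ?thesis using Z by auto
  qed
  then obtain Z where Z: "\<And>x. x \<in> X \<Longrightarrow> finite (Z x) \<and> Z x \<subseteq> R \<and> x \<in> M \<star> e ` Z x" by metis
  obtain S1 where S1: "S1 \<in> \<C>" "\<Union>(Z ` X) \<subseteq> S1"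
    using chain_finite_subset[OF ne chain, of "\<Union>(Z ` X)"] Z assms(1) R(2) by (metis (no_types, lifting) UN_least finite_UN)
  have "x \<in> M \<star> e ` (S0 \<union> S1)" if "x \<in> X" for x
    using Z[OF that] S1 that set_prod_mono[of M M "e ` Z x" "e ` (S0 \<union> S1)"] by blast
  moreover have "S0 \<union> S1 \<in> \<C>" using chain[OF S1(1) assms(3)] S1 assms(3) by (auto simp: sup.absorb1 sup.absorb2)
  ultimately show ?thesis using that[of "S0 \<union> S1"] by blast
qed

text \<open>The finitely many products of elements of \<open>F\<close> and \<open>G\<close> lie in
  \<open>ext S\<close> for a single member \<open>S\<close>, so \<open>F\<close> generates an
  invertible module already there. The normalization \<open>F \<star> ext UNIV = ext UNIV\<close>
  does not depend on the ring.\<close>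

lemma inv_mod_descend:
  assumes I: "inv_mod R I"
  obtains S J where "S \<in> \<C>" "inv_mod S J" "J \<star> e ` R = I"
proof -
  obtain F G where FG: "finite F" "finite G" "1 \<in> F \<star> G" "F \<star> G \<subseteq> ext R" "I = F \<star> ext R"
    using inv_mod_generators[OF R(1) I] by metis
  define X where "X = (\<lambda>(x, y). x * y) ` (F \<times> G)"
  have "finite X" using FG by (simp add: X_def)
  moreover have "X \<subseteq> A \<star> e ` R" using FG(4) unfolding X_def ext_def by (auto intro: set_prod_mult)
  ultimately obtain S where S: "S \<in> \<C>" "X \<subseteq> A \<star> e ` S"
    using extend_chain ne by (metis ex_in_conv)
  have sub: "F \<star> G \<subseteq> ext S"
    using S(2) unfolding ext_def by (intro set_prod_subsetI add_closed_set_prod) (auto simp: X_def)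
  have "F \<star> ext UNIV = I \<star> e ` UNIV" by (simp add: FG set_prod.assoc ext_image[OF R(1) fsubring_UNIV])
  then have "inv_mod S (F \<star> ext S)"
    using FG S I sub rings by (intro inv_mod_generated[of S F G]) (auto simp: inv_mod_def)
  moreover have "F \<star> ext S \<star> e ` R = I"
    using S rings R(1) chain_subset by (simp add: set_prod.assoc ext_image FG)
  ultimately show ?thesis using that S by blast
qed

lemma inv_mod_descend_eq:
  assumes S0: "S0 \<in> \<C>" and I: "inv_mod S0 I" and J: "inv_mod S0 J" and eq: "I \<star> e ` R = J \<star> e ` R"
  obtains S where "S \<in> \<C>" "S0 \<subseteq> S" "I \<star> e ` S = J \<star> e ` S"
proof -
  \<comment> \<open>Each inclusion is claimed for all larger members too, so that the members found
    for the two inclusions can be replaced by their union.\<close>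
  have half: "\<exists>S\<in>\<C>. S0 \<subseteq> S \<and> (\<forall>S'\<in>\<C>. S \<subseteq> S' \<longrightarrow> I \<star> e ` S' \<subseteq> J \<star> e ` S')"
    if I: "inv_mod S0 I" and J: "inv_mod S0 J" and eq: "I \<star> e ` R = J \<star> e ` R" for I J
  proof -
    have one: "1 \<in> e ` R" using R by (metis e_1 fsubringD(2) image_eqI)
    obtain F where F: "finite F" "I = F \<star> ext S0" "F \<subseteq> I"
      using inv_mod_generators[OF rings[OF S0] I] by metis
    have "F \<subseteq> J \<star> e ` R" using F(3) set_prod_superset[OF one, of I] eq by blast
    then obtain S where S: "S \<in> \<C>" "S0 \<subseteq> S" "F \<subseteq> J \<star> e ` S"
      using extend_chain F S0 by metis
    have "I \<star> e ` S' \<subseteq> J \<star> e ` S'" if S': "S' \<in> \<C>" "S \<subseteq> S'" for S'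
    proof -
      have sub: "S0 \<subseteq> S'" using S S' by blast
      have r: "fsubring S0" "fsubring S'" using rings S0 S' by auto
      have "I \<star> e ` S' = F \<star> ext S'" using r sub by (simp add: F set_prod.assoc ext_image)
      also have "F \<subseteq> J \<star> e ` S'" using S(3) set_prod_mono[of J J "e ` S" "e ` S'"] S' by blast
      then have "F \<star> ext S' \<subseteq> J \<star> e ` S' \<star> ext S'" by (simp add: set_prod_mono)
      also have "\<dots> = J \<star> e ` S'"
        using inv_mod_extend[OF r sub J] by (simp add: inv_mod_def)
      finally show ?thesis .
    qed
    then show ?thesis using S by blast
  qed
  obtain S1 where S1: "S1 \<in> \<C>" "S0 \<subseteq> S1" "\<forall>S'\<in>\<C>. S1 \<subseteq> S' \<longrightarrow> I \<star> e ` S' \<subseteq> J \<star> e ` S'"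
    using half[OF I J eq] by blast
  obtain S2 where S2: "S2 \<in> \<C>" "S0 \<subseteq> S2" "\<forall>S'\<in>\<C>. S2 \<subseteq> S' \<longrightarrow> J \<star> e ` S' \<subseteq> I \<star> e ` S'"
    using half[OF J I eq[symmetric]] by blast
  have "S1 \<union> S2 \<in> \<C>" using chain[OF S1(1) S2(1)] S1 S2 by (auto simp: sup.absorb1 sup.absorb2)
  moreover from this have "I \<star> e ` (S1 \<union> S2) = J \<star> e ` (S1 \<union> S2)"
    using S1(3)[rule_format, of "S1 \<union> S2"] S2(3)[rule_format, of "S1 \<union> S2"] by auto
  ultimately show ?thesis using that[of "S1 \<union> S2"] S1(2) by auto
qed

end

section \<open>Picard groups and polynomial rings\<close>

lemma singleton_set_prod:
  assumes "add_closed B"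
  shows "{x} \<star> B = {x * r | r. r \<in> B}"
proof
  have "add_closed {x * r | r. r \<in> B}"
    using assms unfolding add_closed_def
    by auto (metis mult_zero_right, metis distrib_left)
  then show "{x} \<star> B \<subseteq> {x * r | r. r \<in> B}" by (rule set_prod_subsetI) auto
  show "{x * r | r. r \<in> B} \<subseteq> {x} \<star> B" by (auto intro: set_prod_mult)
qed

lemma singleton_set_prod_singleton:
  assumes "add_closed B"
  shows "{x} \<star> ({y} \<star> B) = {x * y} \<star> B"
proof -
  have "add_closed ({y} \<star> B)" by simp
  then have "{x} \<star> ({y} \<star> B) = {x * r | r. r \<in> {y} \<star> B}" by (rule singleton_set_prod)
  also have "\<dots> = {x * y * r | r. r \<in> B}"
    by (auto simp: singleton_set_prod[OF assms] mult.assoc)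
  finally show ?thesis by (simp add: singleton_set_prod[OF assms])
qed

lemma one_set_prod: "add_closed B \<Longrightarrow> {1} \<star> B = (B :: 'a::field set)"
  by (simp add: singleton_set_prod)

lemma Prin_eq: "add_closed B \<Longrightarrow> Prin B = {{x} \<star> B | x. x \<noteq> 0}"
  unfolding Prin_def by (simp add: singleton_set_prod)

section \<open>Invertible fractional ideals as a group\<close>

context
  fixes B :: "'a::field set"
  assumes B: "fsubring B" "has_quotfield_univ B"
begin

lemma frac_ideal_module: "frac_ideal B I \<Longrightarrow> I \<star> B = I"
  by (subst set_prod_module_iff[OF B(1)]) (simp add: frac_ideal_def add_closed_def, metis mult.commute)

text \<open>An inverse provides the common denominator: for a nonzero \<open>j = b / c\<close> in
  \<open>J\<close> and \<open>x\<close> in \<open>I\<close>, the product \<open>x * j\<close> lies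
  in \<open>B\<close>, and so does \<open>b * x = c * (x * j)\<close>.\<close>

lemma module_frac_ideal:
  assumes I: "I \<star> B = I" "I \<star> J = B" and J: "J \<star> B = J"
  shows "frac_ideal B I"
proof -
  have nz: "M \<noteq> {0}" if "M \<star> N = B" for M N
  proof
    assume "M = {0}"
    then have "M \<star> N \<subseteq> {0}" by (intro set_prod_subsetI) (auto simp: add_closed_def)
    then show False using that B by (metis fsubringD(2) singletonD subsetD zero_neq_one)
  qed
  have J0: "0 \<in> J" by (metis J set_prod_0)
  have "J \<noteq> {0}" using nz[of J I] I by (simp add: set_prod_commute)
  then obtain j where j: "j \<in> J" "j \<noteq> 0" using J0 by blast
  obtain b c where bc: "b \<in> B" "c \<in> B" "c \<noteq> 0" "j = b / c"
    using B(2) unfolding has_quotfield_univ_def by blast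
  have "b * x \<in> B" if "x \<in> I" for x
  proof -
    have "x * j \<in> B" using set_prod_mult[OF that j(1)] I by simp
    then have "c * (x * j) \<in> B" using bc B fsubringD by blast
    then show ?thesis using bc by (simp add: mult.commute)
  qed
  moreover have "add_closed I" "\<forall>m\<in>I. \<forall>s\<in>B. m * s \<in> I"
    using I set_prod_module_iff[OF B(1)] by blast+
  moreover have "I \<noteq> {0}" using nz I by blast
  moreover have "b \<noteq> 0" using j bc by auto
  ultimately show ?thesis using bc unfolding frac_ideal_def add_closed_def
    by (metis mult.commute)
qed

text \<open>Invertibility forces a common denominator to exist, so Picard groups can be treated by
  equations between products alone.\<close>

lemma invertible_frac_iff: "invertible_frac B I \<longleftrightarrow> I \<star> B = I \<and> (\<exists>J. I \<star> J = B)"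
proof
  assume "invertible_frac B I"
  then show "I \<star> B = I \<and> (\<exists>J. I \<star> J = B)"
    using frac_ideal_module by (auto simp: invertible_frac_def)
next
  assume "I \<star> B = I \<and> (\<exists>J. I \<star> J = B)"
  then obtain J where J: "I \<star> B = I" "I \<star> J = B" by blast
  have BB: "B \<star> B = B" by (rule set_prod_idem[OF B(1)])
  have 1: "I \<star> (J \<star> B) = B" "J \<star> B \<star> B = J \<star> B"
    using J BB by (simp_all add: set_prod.assoc[symmetric]) (simp add: set_prod.assoc BB)
  then have "frac_ideal B I" "frac_ideal B (J \<star> B)"
    using J module_frac_ideal[of I "J \<star> B"] module_frac_ideal[of "J \<star> B" I]
    by (simp_all add: set_prod_commute)
  then show "invertible_frac B I" using 1 unfolding invertible_frac_def by blast
qed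

lemma invertible_frac_inverse:
  assumes "invertible_frac B I"
  obtains J where "invertible_frac B J" "I \<star> J = B"
  using assms unfolding invertible_frac_def by (metis set_prod_commute)

lemma invertible_frac_mult:
  assumes "invertible_frac B I" "invertible_frac B J"
  shows "invertible_frac B (I \<star> J)"
proof -
  obtain I' J' where *: "I \<star> B = I" "J \<star> B = J" "I \<star> I' = B" "J \<star> J' = B"
    using assms by (auto simp: invertible_frac_iff)
  have "I \<star> J \<star> (I' \<star> J') = (I \<star> I') \<star> (J \<star> J')" by (simp add: set_prod_ac)
  then have "I \<star> J \<star> (I' \<star> J') = B" by (simp add: * set_prod_idem B)
  moreover have "I \<star> J \<star> B = I \<star> J" by (simp add: set_prod.assoc *)
  ultimately show ?thesis unfolding invertible_frac_iff by blast
qed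

lemma invertible_frac_self: "invertible_frac B B"
  using set_prod_idem[OF B(1)] by (auto simp: invertible_frac_iff)

lemma invertible_frac_principal:
  assumes "x \<noteq> 0" shows "invertible_frac B ({x} \<star> B)"
proof -
  have ac: "add_closed B" by (rule fsubring_add_closed[OF B(1)])
  have BB: "B \<star> B = B" by (rule set_prod_idem[OF B(1)])
  have "{x} \<star> B \<star> ({inverse x} \<star> B) = {x} \<star> ({inverse x} \<star> (B \<star> B))"
    by (simp add: set_prod_ac)
  also have "\<dots> = B" using assms ac by (simp add: BB singleton_set_prod_singleton one_set_prod)
  finally show ?thesis by (auto simp: invertible_frac_iff set_prod.assoc BB)
qed

lemma comm_group_InvFrac: "comm_group (InvFrac B)"
proof (rule comm_groupI)
  fix I J assume "I \<in> carrier (InvFrac B)" "J \<in> carrier (InvFrac B)"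
  then show "I \<otimes>\<^bsub>InvFrac B\<^esub> J \<in> carrier (InvFrac B)" by (simp add: InvFrac_def invertible_frac_mult)
next
  fix I assume "I \<in> carrier (InvFrac B)"
  then show "\<one>\<^bsub>InvFrac B\<^esub> \<otimes>\<^bsub>InvFrac B\<^esub> I = I"
    by (simp add: InvFrac_def invertible_frac_iff set_prod_commute)
next
  fix I assume "I \<in> carrier (InvFrac B)"
  then have "invertible_frac B I" by (simp add: InvFrac_def)
  then obtain J where "invertible_frac B J" "I \<star> J = B" by (rule invertible_frac_inverse)
  then show "\<exists>J\<in>carrier (InvFrac B). J \<otimes>\<^bsub>InvFrac B\<^esub> I = \<one>\<^bsub>InvFrac B\<^esub>"
    by (auto simp: InvFrac_def set_prod_commute)
qed (simp_all add: InvFrac_def invertible_frac_self set_prod_ac)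

lemma subgroup_Prin: "subgroup (Prin B) (InvFrac B)"
proof -
  interpret comm_group "InvFrac B" by (rule comm_group_InvFrac)
  have ac: "add_closed B" by (rule fsubring_add_closed[OF B(1)])
  have mult: "{x} \<star> B \<star> ({y} \<star> B) = {x * y} \<star> B" for x y
  proof -
    have "{x} \<star> B \<star> ({y} \<star> B) = {x} \<star> ({y} \<star> (B \<star> B))" by (simp add: set_prod_ac)
    then show ?thesis by (simp add: ac set_prod_idem[OF B(1)] singleton_set_prod_singleton)
  qed
  show ?thesis
  proof (rule subgroupI)
    show "Prin B \<subseteq> carrier (InvFrac B)"
      using invertible_frac_principal by (auto simp: Prin_eq[OF ac] InvFrac_def)
    show "Prin B \<noteq> {}" by (auto simp: Prin_eq[OF ac] intro!: exI[of _ 1])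
    fix I J assume "I \<in> Prin B" "J \<in> Prin B"
    then show "I \<otimes>\<^bsub>InvFrac B\<^esub> J \<in> Prin B"
      by (auto simp: Prin_eq[OF ac] InvFrac_def mult)
  next
    fix I assume "I \<in> Prin B"
    then obtain x where x: "x \<noteq> 0" "I = {x} \<star> B" by (auto simp: Prin_eq[OF ac])
    have "inv\<^bsub>InvFrac B\<^esub> I = {inverse x} \<star> B"
    proof (rule inv_equality)
      show "{inverse x} \<star> B \<otimes>\<^bsub>InvFrac B\<^esub> I = \<one>\<^bsub>InvFrac B\<^esub>"
        using x by (simp add: InvFrac_def mult one_set_prod[OF ac])
    qed (use x in \<open>auto simp: InvFrac_def intro: invertible_frac_principal\<close>)
    then show "inv\<^bsub>InvFrac B\<^esub> I \<in> Prin B" using x by (auto simp: Prin_eq[OF ac])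
  qed
qed

end

text \<open>\<open>Pic_Int_rel D R\<close> has this shape, with \<open>N\<close> the principal
  ideals and \<open>M\<close> the image of the Picard group of \<open>R\<close>, a set of cosets.
  Through \<open>h\<close> one works with ideals instead of cosets of cosets.\<close>

lemma (in comm_group) double_quotient:
  assumes N: "subgroup N G" and M: "subgroup M (G Mod N)"
  defines "h \<equiv> \<lambda>x. M #>\<^bsub>G Mod N\<^esub> (N #> x)"
  shows "comm_group (G Mod N Mod M)" "h \<in> hom G (G Mod N Mod M)"
    "h ` carrier G = carrier (G Mod N Mod M)"
    "\<And>x. x \<in> carrier G \<Longrightarrow> h x = \<one>\<^bsub>G Mod N Mod M\<^esub> \<longleftrightarrow> N #> x \<in> M"
proof -
  interpret N: normal N G using N by (rule subgroup_imp_normal)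
  interpret Q: comm_group "G Mod N" using N by (rule abelian_FactGroup)
  interpret M: normal M "G Mod N" using M by (rule Q.subgroup_imp_normal)
  show "comm_group (G Mod N Mod M)" using M by (rule Q.abelian_FactGroup)
  show "h \<in> hom G (G Mod N Mod M)"
    using N.r_coset_hom_Mod M.r_coset_hom_Mod by (auto simp: h_def hom_def Pi_def)
  show "h ` carrier G = carrier (G Mod N Mod M)"
    by (simp add: h_def carrier_FactGroup image_image)
  fix x assume "x \<in> carrier G"
  then have "N #> x \<in> carrier (G Mod N)" by (simp add: carrier_FactGroup)
  then show "h x = \<one>\<^bsub>G Mod N Mod M\<^esub> \<longleftrightarrow> N #> x \<in> M"
    unfolding h_def using M by (metis Q.coset_join1 Q.coset_join2 one_FactGroup subgroup.subset)
qed

section \<open>The polynomial ring inside the field of rational functions\<close>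

lemma embP_add: "embP (p + q) = embP p + embP q"
  by (simp add: embP_def)

lemma embP_mult: "embP (p * q) = embP p * embP q"
  by (simp add: embP_def)

lemma embP_1 [simp]: "embP 1 = 1"
  by (simp add: embP_def One_fract_def)

lemma embP_0 [simp]: "embP 0 = 0"
  by (simp add: embP_def Zero_fract_def)

lemma embP_inject [simp]: "embP p = embP q \<longleftrightarrow> p = q"
  by (simp add: embP_def eq_fract)

lemma embK_eq: "embK a = embP [:a:]"
  by (simp add: embK_def embP_def)

lemma fract_eq_embP:
  obtains p q where "q \<noteq> 0" "x = embP p / embP q"
proof -
  obtain p q where "x = Fract p q" "q \<noteq> 0" by (cases x) auto
  then show ?thesis using that[of q p] by (simp add: embP_def)
qed

text \<open>This makes K[X] the extension of Int(D) to \<open>K\<close>, as recorded in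
  \<open>ext_UNIV\<close>.\<close>

lemma poly_denominator:
  fixes D :: "'k::field set"
  assumes D: "fsubring D" "has_quotfield_univ D"
  shows "\<exists>d\<in>D. d \<noteq> 0 \<and> [:d:] * p \<in> Int_poly D"
proof (induction p)
  case 0
  then show ?case using D by (intro bexI[of _ 1]) (auto simp: Int_poly_def fsubringD)
next
  case (pCons a p)
  then obtain d where d: "d \<in> D" "d \<noteq> 0" "[:d:] * p \<in> Int_poly D" by blast
  obtain u v where uv: "u \<in> D" "v \<in> D" "v \<noteq> 0" "a = u / v"
    using D(2) unfolding has_quotfield_univ_def by blast
  have "poly ([:d * v:] * pCons a p) x \<in> D" if "x \<in> D" for x
  proof -
    have "d * poly p x \<in> D" using d(3) that by (simp add: Int_poly_def)
    then have "d * u + v * (x * (d * poly p x)) \<in> D" using d uv that D by (simp add: fsubringD)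
    moreover have "poly ([:d * v:] * pCons a p) x = d * u + v * (x * (d * poly p x))"
    proof -
      have "u = a * v" using uv by simp
      then show ?thesis by (simp add: algebra_simps)
    qed
    ultimately show ?thesis by (simp only:)
  qed
  then show ?case using d uv D by (intro bexI[of _ "d * v"]) (auto simp: Int_poly_def fsubringD)
qed

lemma fsubring_Int_poly_image:
  assumes "fsubring D"
  shows "fsubring (embP ` Int_poly D)"
proof -
  have "embP p - embP q = embP (p - q)" for p q :: "'a poly"
    using embP_add[of "p - q" q] by simp
  moreover have "p + q \<in> Int_poly D" "p - q \<in> Int_poly D" "p * q \<in> Int_poly D"
    if "p \<in> Int_poly D" "q \<in> Int_poly D" for p q
    using that assms by (auto simp: Int_poly_def fsubringD)
  moreover have "0 \<in> Int_poly D" "1 \<in> Int_poly D" using assms by (auto simp: Int_poly_def fsubringD)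
  ultimately show ?thesis unfolding fsubring_def
    by (auto simp: embP_add[symmetric] embP_mult[symmetric]) (metis embP_0 embP_1 image_eqI)+
qed

text \<open>Division with remainder: \<open>g\<close> has least degree among the nonzero numerators,
  over the denominator \<open>d\<close>, of elements of \<open>M\<close>, and the remainder of a
  numerator modulo \<open>g\<close> is zero or again such a numerator.\<close>

lemma embP_ideal_principal:
  assumes M: "M \<star> range embP = M" "M \<noteq> {0}" and d: "d \<noteq> 0" "\<And>x. x \<in> M \<Longrightarrow> d * x \<in> range embP"
  obtains y where "y \<noteq> 0" "M = {y} \<star> range embP"
proof -
  have V: "fsubring (range (embP :: 'a poly \<Rightarrow> _))"
  proof -
    have "embP p - embP q = embP (p - q)" for p q :: "'a poly"
      using embP_add[of "p - q" q] by simp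
    then show ?thesis unfolding fsubring_def
      by (auto simp: embP_add[symmetric] embP_mult[symmetric]) (metis embP_0 embP_1 rangeI)+
  qed
  have closed: "add_closed M" and mod: "\<And>m p. m \<in> M \<Longrightarrow> m * embP p \<in> M"
    using M set_prod_module_iff[OF V] by blast+
  define P where "P = {p. p \<noteq> 0 \<and> embP p / d \<in> M}"
  have "0 \<in> M" using closed by (simp add: add_closed_def)
  then obtain m where m: "m \<in> M" "m \<noteq> 0" using M(2) by blast
  then obtain p where p: "d * m = embP p" using d by blast
  then have "p \<noteq> 0" using m d by auto
  moreover have "embP p / d = m" using d by (simp flip: p)
  ultimately have "p \<in> P" using m by (simp add: P_def)
  then obtain g where g: "g \<in> P" "\<And>q. q \<in> P \<Longrightarrow> degree g \<le> degree q"
    using ex_has_least_nat[of "\<lambda>p. p \<in> P" p degree] by blast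
  define y where "y = embP g / d"
  have "y \<noteq> 0" using g d embP_inject[of g 0] by (auto simp: y_def P_def simp del: embP_inject)
  moreover have "M = {y} \<star> range embP"
  proof
    show "{y} \<star> range embP \<subseteq> M"
      using g mod[of y] closed by (intro set_prod_subsetI) (auto simp: P_def simp flip: y_def)
    show "M \<subseteq> {y} \<star> range embP"
    proof
      fix x assume x: "x \<in> M"
      then obtain q where q: "d * x = embP q" using d by blast
      have "embP q = embP (q div g) * embP g + embP (q mod g)"
        by (simp flip: embP_mult embP_add)
      then have "x = y * embP (q div g) + embP (q mod g) / d"
        using d q by (simp add: y_def field_simps)
      moreover have "embP (q mod g) / d \<in> M"
      proof -
        have "embP (q mod g) = embP q + embP g * embP (- (q div g))"
          by (simp add: embP_mult[symmetric] embP_add[symmetric] minus_div_mult_eq_mod[symmetric])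
        then have "embP (q mod g) / d = x + y * embP (- (q div g))"
          using d q by (simp add: y_def field_simps)
        moreover have "y \<in> M" using g by (simp add: P_def y_def)
        ultimately show ?thesis using x mod closed by (simp add: add_closed_def)
      qed
      then have "q mod g = 0"
        using g degree_mod_less[of g q] by (force simp: P_def)
      ultimately have "x = y * embP (q div g)" by simp
      then show "x \<in> {y} \<star> range embP" by (auto intro: set_prod_mult)
    qed
  qed
  ultimately show ?thesis using that by blast
qed

text \<open>The units of K[X] are the nonzero constants. In \<open>cls_eq_one_iff\<close> this turns
  a principal factor from K(X) into one from \<open>K\<close>.\<close>

lemma embP_unit:
  fixes x :: "'k::field poly fract"
  assumes "{x} \<star> range embP = range embP"
  obtains k where "k \<noteq> 0" "x = embK k"
proof -
  have "x * embP 1 \<in> {x} \<star> range embP" by (intro set_prod_mult rangeI singletonI)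
  then obtain p where p: "x = embP p" using assms by auto
  have "add_closed (range (embP :: 'k poly \<Rightarrow> _))"
    by (subst assms[symmetric]) simp
  then have "range (embP :: 'k poly \<Rightarrow> _) = {x * r | r. r \<in> range embP}"
    using singleton_set_prod[of "range embP" x] assms by simp
  moreover have "(1 :: 'k poly fract) \<in> range embP"
    using rangeI[of embP 1] by (simp only: embP_1)
  ultimately obtain q where "1 = x * embP q" by blast
  then have "embP (p * q) = embP 1" by (simp add: p embP_mult)
  then have "p dvd 1" by (metis dvdI embP_inject)
  then obtain k where k: "p = [:k:]" "k dvd 1" by (auto simp: is_unit_poly_iff)
  then have "k \<noteq> 0" by auto
  then show ?thesis using that k p by (simp add: embK_eq)
qed

section \<open>Picard groups of the rings Int(D)R\<close>

locale int_poly_ring =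
  fixes D :: "'k::field set"
  assumes D: "fsubring D" "has_quotfield_univ D"
begin

lemma embP_const_image: "embP ` (\<lambda>t. [:t:]) ` R = embK ` R"
  by (simp add: image_image embK_eq)

sublocale P: scalar_extension D embK "embP ` Int_poly D"
proof
  show "embK (x + y) = embK x + embK y" for x y :: 'k by (simp add: embK_eq embP_add[symmetric])
  show "embK (x * y) = embK x * embK y" for x y :: 'k by (simp add: embK_eq embP_mult[symmetric])
  show "embK 1 = (1 :: 'k poly fract)" by (simp add: embK_eq one_pCons[symmetric])
  show "fsubring (embP ` Int_poly D)" by (rule fsubring_Int_poly_image[OF D(1)])
  show "embK ` D \<subseteq> embP ` Int_poly D" by (auto simp: embK_eq Int_poly_def)
qed (use D in auto)

sublocale S: scalar_extension D "\<lambda>x. x" D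
  by unfold_locales (use D in auto)

\<comment> \<open>Here these read \<open>0 = 0\<close> and \<open>1 = 1\<close> and make the simplifier loop.\<close>
declare S.e_0 [simp del] S.e_1 [simp del]

lemma ext_eq: "P.ext R = embP ` IntT D R"
  unfolding P.ext_def IntT_def
  by (simp add: image_set_prod[OF embP_add embP_mult] embP_const_image)

lemma S_ext_eq: "fsubring R \<Longrightarrow> D \<subseteq> R \<Longrightarrow> S.ext R = R"
  unfolding S.ext_def image_ident using D by (intro set_prod_subring(1) fsubringD(2))

lemma ext_UNIV: "P.ext UNIV = range embP"
proof
  show "P.ext UNIV \<subseteq> range embP" by (auto simp: ext_eq)
  show "range embP \<subseteq> P.ext UNIV"
  proof clarify
    fix p :: "'k poly"
    obtain d where d: "d \<in> D" "d \<noteq> 0" "[:d:] * p \<in> Int_poly D" using poly_denominator D by blast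
    have "embP ([:d:] * p) * embK (inverse d) \<in> P.ext UNIV"
      unfolding P.ext_def using d by (intro set_prod_mult imageI UNIV_I)
    moreover have "embP ([:d:] * p) * embK (inverse d) = embP p"
    proof -
      have "[:d:] * p * [:inverse d:] = p" using d by simp
      then show ?thesis unfolding embK_eq embP_mult[symmetric] by (simp only:)
    qed
    ultimately show "embP p \<in> P.ext UNIV" by simp
  qed
qed

lemma has_quotfield_ext:
  assumes "fsubring R" shows "has_quotfield_univ (P.ext R)"
  unfolding has_quotfield_univ_def
proof
  fix z :: "'k poly fract"
  obtain p q where z: "q \<noteq> 0" "z = embP p / embP q" by (rule fract_eq_embP)
  obtain d where d: "d \<in> D" "d \<noteq> 0" "[:d:] * p \<in> Int_poly D" using poly_denominator D by blast
  obtain c where c: "c \<in> D" "c \<noteq> 0" "[:c:] * q \<in> Int_poly D" using poly_denominator D by blast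
  have sub: "embP ` Int_poly D \<subseteq> P.ext R"
    unfolding P.ext_def by (rule set_prod_superset[OF fsubringD(2)[OF P.fsubring_image[OF assms]]])
  have "[:a:] * f \<in> Int_poly D" if "a \<in> D" "f \<in> Int_poly D" for a f
    using that fsubringD(5)[OF D(1)] by (simp add: Int_poly_def)
  then have "[:c:] * ([:d:] * p) \<in> Int_poly D" "[:d:] * ([:c:] * q) \<in> Int_poly D"
    using c d by blast+
  then have "embP ([:c:] * ([:d:] * p)) \<in> P.ext R" "embP ([:d:] * ([:c:] * q)) \<in> P.ext R"
    using sub by blast+
  moreover have "embP ([:d:] * ([:c:] * q)) \<noteq> embP 0"
    using c d z by (subst embP_inject) auto
  then have "embP ([:d:] * ([:c:] * q)) \<noteq> 0" by simp
  moreover have "embP [:c:] \<noteq> embP 0" "embP [:d:] \<noteq> embP 0" "embP q \<noteq> embP 0"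
    using c d z by (subst embP_inject, simp)+
  then have "z = embP ([:c:] * ([:d:] * p)) / embP ([:d:] * ([:c:] * q))"
    unfolding z embP_mult by (simp add: field_simps)
  ultimately show "\<exists>a\<in>P.ext R. \<exists>b\<in>P.ext R. b \<noteq> 0 \<and> z = a / b" by blast
qed

lemma has_quotfield_overring: "D \<subseteq> R \<Longrightarrow> has_quotfield_univ R"
  using D unfolding has_quotfield_univ_def by blast

text \<open>In the base instance the normalization is automatic: \<open>H \<star> J = R\<close>
  makes the span of \<open>H\<close> over \<open>K\<close> equal to \<open>K\<close>. So gluing and
  descent apply to all invertible ideals of the overrings.\<close>

lemma S_inv_mod_iff:
  assumes "fsubring R" "D \<subseteq> R"
  shows "S.inv_mod R H \<longleftrightarrow> invertible_frac R H"
proof -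
  have "H \<star> UNIV = UNIV" if "H \<star> J = R" for J
  proof
    have "UNIV = R \<star> UNIV"
      using set_prod_subring(1)[OF fsubring_UNIV fsubringD(2)[OF assms(1)] subset_UNIV] by simp
    also have "\<dots> = H \<star> (J \<star> UNIV)" by (simp add: that[symmetric] set_prod.assoc)
    also have "\<dots> \<subseteq> H \<star> UNIV" by (rule set_prod_mono) auto
    finally show "UNIV \<subseteq> H \<star> UNIV" .
  qed simp
  then show ?thesis
    using assms by (auto simp: S.inv_mod_def S_ext_eq fsubring_UNIV invertible_frac_iff has_quotfield_overring)
qed

lemma S_extend: "invertible_frac R H \<Longrightarrow> fsubring R \<Longrightarrow> fsubring R' \<Longrightarrow> D \<subseteq> R \<Longrightarrow> R \<subseteq> R' \<Longrightarrow> invertible_frac R' (H \<star> R')"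
  using S.inv_mod_extend[of R R' H] S_inv_mod_iff[of R H] S_inv_mod_iff[of R' "H \<star> R'"] by auto

text \<open>The coset formulas of the two quotients that make up \<open>Pic_Int_rel D R\<close>,
  composed; by \<open>ext_eq\<close>, \<open>P.ext R\<close> is the ring occurring there.\<close>

definition cls :: "'k set \<Rightarrow> 'k poly fract set \<Rightarrow> 'k poly fract set set set" where
  "cls R I = {pic_class (P.ext R) (embK ` H \<star> P.ext R) | H. invertible_frac R H}
     #>\<^bsub>Pic (P.ext R)\<^esub> pic_class (P.ext R) I"

context
  fixes R :: "'k set"
  assumes R: "fsubring R" "D \<subseteq> R"
begin

lemma ext_frac: "invertible_frac (P.ext R) I \<longleftrightarrow> I \<star> P.ext R = I \<and> (\<exists>J. I \<star> J = P.ext R)"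
  by (rule invertible_frac_iff[OF P.fsubring_ext[OF R(1)] has_quotfield_ext[OF R(1)]])

lemma base_frac: "invertible_frac R I \<longleftrightarrow> I \<star> R = I \<and> (\<exists>J. I \<star> J = R)"
  by (rule invertible_frac_iff[OF R(1) has_quotfield_overring[OF R(2)]])

lemma base_frac_extend:
  assumes "invertible_frac R H" shows "invertible_frac (P.ext R) (embK ` H \<star> P.ext R)"
proof -
  obtain J where J: "H \<star> J = R" using assms base_frac by blast
  have "embK ` H \<star> P.ext R \<star> (embK ` J) = embK ` (H \<star> J) \<star> P.ext R"
    by (simp add: P.e_image_set_prod set_prod_ac)
  also have "\<dots> = P.ext R"
    using P.ext_image_self[OF R(1)] by (simp add: J set_prod.commute)
  finally show ?thesis unfolding ext_frac by (auto simp: set_prod.assoc P.ext_idem R)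
qed

lemma inv_mod_imp_frac: "P.inv_mod R I \<Longrightarrow> invertible_frac (P.ext R) I"
  by (auto simp: ext_frac P.inv_mod_def)

text \<open>Extending ideals of \<open>R\<close> is a homomorphism into the quotient by the
  principal ideals, so its image is a subgroup and \<open>double_quotient\<close> applies. The last
  fact unfolds membership in that image.\<close>

lemma pic_facts:
  shows comm_group_Pic: "comm_group (Pic_Int_rel D R)"
    and cls_hom: "cls R \<in> hom (InvFrac (P.ext R)) (Pic_Int_rel D R)"
    and cls_image_InvFrac: "cls R ` {I. invertible_frac (P.ext R) I} = carrier (Pic_Int_rel D R)"
    and cls_one_iff: "\<And>I. invertible_frac (P.ext R) I \<Longrightarrow> cls R I = \<one>\<^bsub>Pic_Int_rel D R\<^esub> \<longleftrightarrow>
      (\<exists>H x. invertible_frac R H \<and> x \<noteq> 0 \<and> I = {x} \<star> (embK ` H \<star> P.ext R))"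
proof -
  define B where "B = P.ext R"
  define G where "G = InvFrac B"
  define N where "N = Prin B"
  define k where "k H = embK ` H \<star> B" for H
  define M where "M = {pic_class B (k H) | H. invertible_frac R H}"
  have B: "fsubring B" "has_quotfield_univ B"
    using R by (auto simp: B_def has_quotfield_ext intro: P.fsubring_ext)
  have RQ: "has_quotfield_univ R" by (rule has_quotfield_overring[OF R(2)])
  interpret G: comm_group G unfolding G_def by (rule comm_group_InvFrac[OF B])
  have N: "subgroup N G" unfolding N_def G_def by (rule subgroup_Prin[OF B])
  interpret N: normal N G using N by (rule G.subgroup_imp_normal)
  interpret H: comm_group "InvFrac R" by (rule comm_group_InvFrac[OF R(1) RQ])
  have carG: "carrier G = {I. invertible_frac B I}" by (simp add: G_def InvFrac_def)
  have k: "k \<in> hom (InvFrac R) G"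
  proof (rule homI)
    fix H assume "H \<in> carrier (InvFrac R)"
    then show "k H \<in> carrier G" using base_frac_extend by (simp add: carG k_def B_def InvFrac_def)
  next
    fix H H'
    have "k (H \<star> H') = embK ` H \<star> embK ` H' \<star> (B \<star> B)"
      by (simp add: k_def P.e_image_set_prod set_prod_idem[OF B(1)])
    also have "\<dots> = k H \<star> k H'" by (simp add: k_def set_prod_ac)
    finally show "k (H \<otimes>\<^bsub>InvFrac R\<^esub> H') = k H \<otimes>\<^bsub>G\<^esub> k H'" by (simp add: G_def InvFrac_def)
  qed
  then have "(\<lambda>H. N #>\<^bsub>G\<^esub> k H) \<in> hom (InvFrac R) (G Mod N)"
    using N.r_coset_hom_Mod by (auto simp: hom_def Pi_def)
  then interpret kh: group_hom "InvFrac R" "G Mod N" "\<lambda>H. N #>\<^bsub>G\<^esub> k H"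
    by (intro group_hom.intro group_hom_axioms.intro H.group_axioms N.factorgroup_is_group)
  have "M = (\<lambda>H. N #>\<^bsub>G\<^esub> k H) ` carrier (InvFrac R)"
    by (auto simp: M_def pic_class_def G_def N_def InvFrac_def)
  then have M: "subgroup M (G Mod N)" using kh.img_is_subgroup by simp
  have PicB: "Pic B = G Mod N" by (simp add: Pic_def G_def N_def)
  have rel: "Pic_Int_rel D R = G Mod N Mod M"
    by (simp add: Pic_Int_rel_def M_def k_def ext_eq[symmetric] PicB B_def[symmetric])
  have cl: "cls R = (\<lambda>I. M #>\<^bsub>G Mod N\<^esub> (N #>\<^bsub>G\<^esub> I))"
    by (rule ext) (simp add: cls_def M_def k_def PicB B_def[symmetric] pic_class_def[of B] G_def[symmetric] N_def[symmetric])
  note dq = G.double_quotient[OF N M, folded cl rel]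
  show "comm_group (Pic_Int_rel D R)" by (rule dq(1))
  show "cls R \<in> hom (InvFrac (P.ext R)) (Pic_Int_rel D R)" using dq(2) by (simp add: G_def B_def)
  show "cls R ` {I. invertible_frac (P.ext R) I} = carrier (Pic_Int_rel D R)"
    using dq(3) by (simp add: carG B_def)
  fix I assume I: "invertible_frac (P.ext R) I"
  then have IG: "I \<in> carrier G" by (simp add: carG B_def)
  have "cls R I = \<one>\<^bsub>Pic_Int_rel D R\<^esub> \<longleftrightarrow> N #>\<^bsub>G\<^esub> I \<in> M"
    using dq(4)[OF IG] by (simp add: cl)
  also have "\<dots> \<longleftrightarrow> (\<exists>H. invertible_frac R H \<and> N #>\<^bsub>G\<^esub> I = N #>\<^bsub>G\<^esub> k H)"
    by (auto simp: M_def pic_class_def G_def N_def)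
  also have "\<dots> \<longleftrightarrow> (\<exists>H. invertible_frac R H \<and> I \<in> N #>\<^bsub>G\<^esub> k H)"
  proof -
    have "N #>\<^bsub>G\<^esub> I = N #>\<^bsub>G\<^esub> k H \<longleftrightarrow> I \<in> N #>\<^bsub>G\<^esub> k H" if "invertible_frac R H" for H
    proof -
      have "k H \<in> carrier G" using base_frac_extend[OF that] by (simp add: carG k_def B_def)
      then show ?thesis using G.repr_independence[OF _ _ N] G.rcos_self[OF IG N] by metis
    qed
    then show ?thesis by blast
  qed
  also have "\<dots> \<longleftrightarrow> (\<exists>H x. invertible_frac R H \<and> x \<noteq> 0 \<and> I = {x} \<star> k H)"
  proof -
    have "{x} \<star> B \<star> k H = {x} \<star> k H" for x H
    proof -
      have "{x} \<star> B \<star> k H = {x} \<star> (embK ` H \<star> (B \<star> B))" by (simp add: k_def set_prod_ac)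
      then show ?thesis by (simp add: k_def set_prod_idem[OF B(1)])
    qed
    then have "I \<in> N #>\<^bsub>G\<^esub> k H \<longleftrightarrow> (\<exists>x. x \<noteq> 0 \<and> I = {x} \<star> k H)" for H
      by (auto simp: r_coset_def N_def Prin_eq[OF fsubring_add_closed[OF B(1)]] G_def InvFrac_def)
    then show ?thesis by blast
  qed
  finally show "cls R I = \<one>\<^bsub>Pic_Int_rel D R\<^esub> \<longleftrightarrow>
      (\<exists>H x. invertible_frac R H \<and> x \<noteq> 0 \<and> I = {x} \<star> (embK ` H \<star> P.ext R))"
    by (simp add: k_def B_def)
qed

lemma cls_closed: "P.inv_mod R I \<Longrightarrow> cls R I \<in> carrier (Pic_Int_rel D R)"
  using cls_hom inv_mod_imp_frac by (auto simp: hom_def InvFrac_def)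

lemma cls_mult: "P.inv_mod R I \<Longrightarrow> P.inv_mod R J \<Longrightarrow> cls R (I \<star> J) = cls R I \<otimes>\<^bsub>Pic_Int_rel D R\<^esub> cls R J"
  using cls_hom inv_mod_imp_frac by (auto simp: hom_def InvFrac_def)

text \<open>The extension of \<open>I\<close> to \<open>K\<close> is a K[X]-module with a common
  denominator, hence generated by a single \<open>y\<close>, and \<open>I\<close> is divided by
  \<open>y\<close>. So every class has a normalized representative.\<close>

lemma inv_mod_scale:
  assumes I: "invertible_frac (P.ext R) I"
  obtains x where "x \<noteq> 0" "P.inv_mod R ({x} \<star> I)"
proof -
  define M where "M = I \<star> embK ` UNIV"
  have IB: "I \<star> P.ext R = I" and fI: "frac_ideal (P.ext R) I"
    using I ext_frac by (auto simp: invertible_frac_def)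
  have "M \<star> P.ext UNIV = I \<star> (P.ext R \<star> embK ` UNIV) \<star> P.ext UNIV"
    by (simp add: M_def IB set_prod.assoc[symmetric])
  also have "\<dots> = I \<star> (P.ext R \<star> embK ` UNIV)"
    by (simp add: P.ext_image R fsubring_UNIV set_prod.assoc P.ext_idem)
  also have "\<dots> = M" by (simp add: M_def IB set_prod.assoc[symmetric])
  finally have MV: "M \<star> range embP = M" by (simp add: ext_UNIV)
  have one: "(1 :: 'k poly fract) \<in> embK ` UNIV" by (rule range_eqI[of _ _ 1]) (simp add: P.e_1)
  then have IM: "I \<subseteq> M" unfolding M_def by (rule set_prod_superset)
  then have "M \<noteq> {0}" using fI unfolding frac_ideal_def by blast
  obtain d where d: "d \<noteq> 0" "d \<in> P.ext R" "\<And>x. x \<in> I \<Longrightarrow> d * x \<in> P.ext R"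
    using fI unfolding frac_ideal_def by blast
  have "d * x \<in> range embP" if "x \<in> M" for x
  proof -
    have "d * x \<in> P.ext R \<star> embK ` UNIV" using that unfolding M_def
      by (induction rule: set_prod_induct)
         (auto simp: distrib_left mult.assoc[symmetric] d intro!: set_prod_cons)
    then show ?thesis using P.ext_image[OF R(1) fsubring_UNIV] ext_UNIV by simp
  qed
  then obtain y where y: "y \<noteq> 0" "M = {y} \<star> range embP"
    using embP_ideal_principal[OF MV \<open>M \<noteq> {0}\<close> d(1)] by blast
  have acV: "add_closed (range (embP :: 'k poly \<Rightarrow> _))"
    using P.fsubring_ext[OF fsubring_UNIV] by (simp add: ext_UNIV fsubring_add_closed)
  have "{inverse y} \<star> I \<star> embK ` UNIV = {inverse y} \<star> M" by (simp add: M_def set_prod.assoc)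
  also have "\<dots> = range embP"
    using y acV by (simp add: singleton_set_prod_singleton one_set_prod)
  finally have "{inverse y} \<star> I \<star> embK ` UNIV = P.ext UNIV" by (simp add: ext_UNIV)
  moreover have "\<exists>J. {inverse y} \<star> I \<star> J = P.ext R"
  proof -
    obtain J where J: "I \<star> J = P.ext R" using I ext_frac by blast
    have acB: "add_closed (P.ext R)" using P.fsubring_ext[OF R(1)] by (rule fsubring_add_closed)
    have "{inverse y} \<star> I \<star> ({y} \<star> J) = {inverse y} \<star> ({y} \<star> (I \<star> J))" by (simp add: set_prod_ac)
    also have "\<dots> = P.ext R" using y acB by (simp add: J singleton_set_prod_singleton one_set_prod)
    finally show ?thesis by blast
  qed
  ultimately have "P.inv_mod R ({inverse y} \<star> I)" by (simp add: P.inv_mod_def set_prod.assoc IB)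
  then show ?thesis using that y by (metis nonzero_imp_inverse_nonzero)
qed

lemma cls_surj: "cls R ` {I. P.inv_mod R I} = carrier (Pic_Int_rel D R)"
proof
  show "cls R ` {I. P.inv_mod R I} \<subseteq> carrier (Pic_Int_rel D R)" using cls_closed by blast
  interpret Q: comm_group "Pic_Int_rel D R" by (rule comm_group_Pic)
  show "carrier (Pic_Int_rel D R) \<subseteq> cls R ` {I. P.inv_mod R I}"
  proof
    fix c assume "c \<in> carrier (Pic_Int_rel D R)"
    then obtain I where I: "invertible_frac (P.ext R) I" "c = cls R I" using cls_image_InvFrac by blast
    \<comment> \<open>Scaling multiplies \<open>I\<close> by a principal ideal, whose class is
      trivial.\<close>
    obtain x where x: "x \<noteq> 0" "P.inv_mod R ({x} \<star> I)" using inv_mod_scale[OF I(1)] .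
    have ac: "add_closed (P.ext R)" using P.fsubring_ext[OF R(1)] by (rule fsubring_add_closed)
    have pr: "invertible_frac (P.ext R) ({x} \<star> P.ext R)"
      using invertible_frac_principal[OF P.fsubring_ext[OF R(1)] has_quotfield_ext[OF R(1)] x(1)] .
    have "embK ` R \<star> P.ext R = P.ext R"
      using P.ext_image_self[OF R(1)] by (simp add: set_prod.commute)
    moreover have "invertible_frac R R"
      by (rule invertible_frac_self[OF R(1) has_quotfield_overring[OF R(2)]])
    ultimately have "cls R ({x} \<star> P.ext R) = \<one>\<^bsub>Pic_Int_rel D R\<^esub>"
      using cls_one_iff[OF pr] x by metis
    moreover have "{x} \<star> P.ext R \<star> I = {x} \<star> I"
      using I(1) ext_frac by (simp add: set_prod.assoc set_prod.commute[of "P.ext R" I])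
    then have "cls R ({x} \<star> I) = cls R ({x} \<star> P.ext R) \<otimes>\<^bsub>Pic_Int_rel D R\<^esub> cls R I"
      using hom_mult[OF cls_hom, of "{x} \<star> P.ext R" I] pr I(1) by (simp add: InvFrac_def)
    moreover have "cls R I \<in> carrier (Pic_Int_rel D R)" using I \<open>c \<in> _\<close> by simp
    ultimately have "cls R ({x} \<star> I) = c" using I by simp
    then show "c \<in> cls R ` {I. P.inv_mod R I}" using x by blast
  qed
qed

lemma cls_eq_one_iff:
  assumes I: "P.inv_mod R I"
  shows "cls R I = \<one>\<^bsub>Pic_Int_rel D R\<^esub> \<longleftrightarrow> (\<exists>H. invertible_frac R H \<and> I = embK ` H \<star> P.ext R)"
proof
  assume "cls R I = \<one>\<^bsub>Pic_Int_rel D R\<^esub>"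
  then obtain H x where H: "invertible_frac R H" "x \<noteq> 0" "I = {x} \<star> (embK ` H \<star> P.ext R)"
    using cls_one_iff[OF inv_mod_imp_frac[OF I]] by blast
  have SH: "S.inv_mod R H" using S_inv_mod_iff[OF R] H by simp
  then have HK: "H \<star> UNIV = UNIV" using S_ext_eq[OF fsubring_UNIV] by (simp add: S.inv_mod_def)
  have "P.ext UNIV = I \<star> embK ` UNIV" using I by (simp add: P.inv_mod_def)
  also have "\<dots> = {x} \<star> (P.ext R \<star> embK ` (H \<star> UNIV))"
    by (simp add: H P.e_image_set_prod set_prod_ac)
  also have "\<dots> = {x} \<star> P.ext UNIV" by (simp add: HK P.ext_image R fsubring_UNIV)
  finally obtain k where k: "k \<noteq> 0" "x = embK k" using embP_unit[of x] by (auto simp: ext_UNIV)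
  have "invertible_frac R ({k} \<star> R \<star> H)"
    using invertible_frac_mult invertible_frac_principal R has_quotfield_overring k H by metis
  moreover have "{k} \<star> R \<star> H = {k} \<star> H"
    using H(1) base_frac by (simp add: set_prod.assoc set_prod.commute[of R H])
  moreover have "I = embK ` ({k} \<star> H) \<star> P.ext R"
    by (simp add: H(3) k P.e_image_set_prod set_prod.assoc)
  ultimately show "\<exists>H. invertible_frac R H \<and> I = embK ` H \<star> P.ext R" by metis
next
  assume "\<exists>H. invertible_frac R H \<and> I = embK ` H \<star> P.ext R"
  then obtain H where H: "invertible_frac R H" "I = embK ` H \<star> P.ext R" by blast
  have "add_closed (embK ` H \<star> P.ext R)" by simp
  then have "I = {1} \<star> (embK ` H \<star> P.ext R)" by (simp add: H one_set_prod)
  then show "cls R I = \<one>\<^bsub>Pic_Int_rel D R\<^esub>"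
    using cls_one_iff[OF inv_mod_imp_frac[OF I]] H(1) zero_neq_one by metis
qed

lemma cls_ext: "cls R (P.ext R) = \<one>\<^bsub>Pic_Int_rel D R\<^esub>"
proof -
  have "invertible_frac R R" by (rule invertible_frac_self[OF R(1) has_quotfield_overring[OF R(2)]])
  then show ?thesis using cls_eq_one_iff[OF P.inv_mod_ext[OF R(1)]] P.ext_image_self[OF R(1)]
    by (metis set_prod.commute)
qed

lemma inv_mod_base_extend:
  assumes "invertible_frac R H" shows "P.inv_mod R (embK ` H \<star> P.ext R)"
proof -
  have "S.inv_mod R H" using S_inv_mod_iff[OF R] assms by simp
  then have HK: "H \<star> UNIV = UNIV" using S_ext_eq[OF fsubring_UNIV] by (simp add: S.inv_mod_def)
  have "embK ` H \<star> P.ext R \<star> embK ` UNIV = P.ext R \<star> embK ` (H \<star> UNIV)"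
    by (simp add: P.e_image_set_prod set_prod_ac)
  then have "embK ` H \<star> P.ext R \<star> embK ` UNIV = P.ext UNIV"
    by (simp add: HK P.ext_image R fsubring_UNIV)
  then show ?thesis using base_frac_extend[OF assms] by (simp add: P.inv_mod_def ext_frac)
qed

text \<open>Multiplication by the inverse of \<open>J\<close> reduces this to trivial classes. No
  principal factor from K(X) is left in the criterion.\<close>

lemma cls_eq_iff:
  assumes I: "P.inv_mod R I" and J: "P.inv_mod R J"
  shows "cls R I = cls R J \<longleftrightarrow> (\<exists>H. invertible_frac R H \<and> I = J \<star> embK ` H)"
proof -
  interpret Q: comm_group "Pic_Int_rel D R" by (rule comm_group_Pic)
  obtain J' where J': "P.inv_mod R J'" "J \<star> J' = P.ext R" using P.inv_mod_inverse[OF R(1) J] .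
  have IJ': "P.inv_mod R (I \<star> J')" using P.inv_mod_mult R I J' by blast
  have one: "cls R J \<otimes>\<^bsub>Pic_Int_rel D R\<^esub> cls R J' = \<one>\<^bsub>Pic_Int_rel D R\<^esub>"
    using cls_mult[OF J J'(1)] J'(2) cls_ext by simp
  have car: "cls R I \<in> carrier (Pic_Int_rel D R)" "cls R J \<in> carrier (Pic_Int_rel D R)"
    "cls R J' \<in> carrier (Pic_Int_rel D R)" using cls_closed I J J' by auto
  have mods: "I \<star> P.ext R = I" "J \<star> P.ext R = J" using I J by (auto simp: P.inv_mod_def)
  have "cls R I = cls R J \<longleftrightarrow> cls R I \<otimes>\<^bsub>Pic_Int_rel D R\<^esub> cls R J' = \<one>\<^bsub>Pic_Int_rel D R\<^esub>"
    using car one by (metis Q.right_cancel)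
  also have "\<dots> \<longleftrightarrow> (\<exists>H. invertible_frac R H \<and> I \<star> J' = embK ` H \<star> P.ext R)"
    using cls_mult[OF I J'(1)] cls_eq_one_iff[OF IJ'] by simp
  also have "\<dots> \<longleftrightarrow> (\<exists>H. invertible_frac R H \<and> I = J \<star> embK ` H)"
  proof -
    have "I \<star> J' = embK ` H \<star> P.ext R \<longleftrightarrow> I = J \<star> embK ` H" for H
    proof
      assume *: "I \<star> J' = embK ` H \<star> P.ext R"
      have "I = I \<star> (J \<star> J')" by (simp add: J' mods)
      also have "\<dots> = J \<star> (I \<star> J')" by (simp add: set_prod_ac)
      also have "\<dots> = J \<star> P.ext R \<star> embK ` H" by (simp add: * set_prod_ac)
      finally show "I = J \<star> embK ` H" by (simp add: mods)
    next
      assume "I = J \<star> embK ` H"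
      then have "I \<star> J' = embK ` H \<star> (J \<star> J')" by (simp add: set_prod_ac)
      then show "I \<star> J' = embK ` H \<star> P.ext R" by (simp add: J')
    qed
    then show ?thesis by blast
  qed
  finally show ?thesis .
qed

end

end

section \<open>Splitting well-ordered filtrations\<close>

lemma free_Abelian_group_hom_eqI:
  assumes "group H" "u \<in> hom (free_Abelian_group B) H" "v \<in> hom (free_Abelian_group B) H"
    and "\<And>b. b \<in> B \<Longrightarrow> u (frag_of b) = v (frag_of b)" and x: "x \<in> carrier (free_Abelian_group B)"
  shows "u x = v x"
proof -
  let ?F = "free_Abelian_group B"
  interpret u: group_hom ?F H u using assms by (intro group_hom.intro group_hom_axioms.intro) auto
  interpret v: group_hom ?F H v using assms by (intro group_hom.intro group_hom_axioms.intro) auto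
  have "Poly_Mapping.keys x \<subseteq> B" using x by simp
  then show ?thesis
  proof (rule free_Abelian_group_induct[where P = "\<lambda>x. u x = v x"])
    show "u 0 = v 0" using u.hom_one v.hom_one by simp
    fix x y assume xy: "Poly_Mapping.keys x \<subseteq> B" "Poly_Mapping.keys y \<subseteq> B" "u x = v x" "u y = v y"
    have "x - y = x \<otimes>\<^bsub>?F\<^esub> inv\<^bsub>?F\<^esub> y" using xy by simp
    moreover have "x \<in> carrier ?F" "y \<in> carrier ?F" using xy by simp_all
    ultimately show "u (x - y) = v (x - y)"
      using xy(3,4) u.hom_mult u.hom_inv v.hom_mult v.hom_inv by (metis u.G.inv_closed)
  qed (use assms in auto)
qed

text \<open>Free abelian groups are projective: preimages under \<open>g\<close> are chosen on the
  basis, which \<open>j\<close> transports to \<open>P\<close>.\<close>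

lemma free_abelian_lift:
  fixes P :: "('p, 'm) monoid_scheme"
  assumes P: "group P" "free_abelian P" and G: "comm_group G" and H: "group H"
    and g: "g \<in> hom G H" "g ` carrier G = carrier H" and e: "e \<in> hom P H"
  obtains s where "s \<in> hom P G" "\<And>p. p \<in> carrier P \<Longrightarrow> g (s p) = e p"
proof -
  obtain B :: "'p set" and i where i: "i \<in> iso P (free_Abelian_group B)"
    using P(2) unfolding free_abelian_def is_iso_def by blast
  let ?F = "free_Abelian_group B"
  define j where "j = inv_into (carrier P) i"
  have j: "j \<in> hom ?F P" "\<And>p. p \<in> carrier P \<Longrightarrow> j (i p) = p"
    using group.iso_set_sym[OF P(1) i] i by (auto simp: j_def iso_def bij_betw_def inv_into_f_f)
  have ihom: "i \<in> hom P ?F" using i by (simp add: iso_def)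
  have ej: "(\<lambda>x. e (j x)) \<in> hom ?F H" using hom_compose[OF j(1) e] by (auto simp: hom_def Pi_def)
  have "\<exists>c. c \<in> carrier G \<and> g c = e (j (frag_of b))" if "b \<in> B" for b
  proof -
    have "e (j (frag_of b)) \<in> carrier H" using ej that by (auto simp: hom_def Pi_def)
    then show ?thesis using g(2) by (metis imageE)
  qed
  then obtain c where c: "\<And>b. b \<in> B \<Longrightarrow> c b \<in> carrier G \<and> g (c b) = e (j (frag_of b))" by metis
  obtain h where h: "h \<in> hom ?F G" "\<And>b. b \<in> B \<Longrightarrow> h (frag_of b) = c b"
    using comm_group.free_Abelian_group_universal[OF G, of c B] c by blast
  have gh: "(\<lambda>x. g (h x)) \<in> hom ?F H" using h(1) g(1) by (auto simp: hom_def Pi_def)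
  have eq: "g (h x) = e (j x)" if "x \<in> carrier ?F" for x
    by (rule free_Abelian_group_hom_eqI[OF H gh ej _ that]) (simp add: h c)
  show ?thesis
  proof
    show "(\<lambda>p. h (i p)) \<in> hom P G" using ihom h(1) by (auto simp: hom_def Pi_def)
    show "g (h (i p)) = e p" if "p \<in> carrier P" for p
      using eq[of "i p"] j(2)[OF that] ihom that by (auto simp: hom_def Pi_def)
  qed
qed

lemma (in comm_group) finprod_in_subgroup:
  assumes K: "subgroup K G" and "finite F" "\<And>i. i \<in> F \<Longrightarrow> k i \<in> K"
  shows "finprod G k F \<in> K"
  using assms(2,3)
proof (induction F)
  case (insert i F)
  then have "k \<in> F \<rightarrow> carrier G" "k i \<in> carrier G" using subgroup.subset[OF K] by auto
  then show ?case using insert by (simp add: subgroup.m_closed[OF K])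
qed (simp add: subgroup.one_closed[OF K])

lemma finite_linear_max:
  assumes "finite F" "F \<noteq> {}" "F \<subseteq> \<Psi>" "trans r" "total_on \<Psi> r"
  obtains m where "m \<in> F" "\<And>x. x \<in> F \<Longrightarrow> x \<noteq> m \<Longrightarrow> (x, m) \<in> r"
proof -
  have "\<exists>m\<in>F. \<forall>x\<in>F. x \<noteq> m \<longrightarrow> (x, m) \<in> r"
    using assms(1,2,3)
  proof (induction F rule: finite_ne_induct)
    case (insert a F)
    then obtain m where m: "m \<in> F" "\<forall>x\<in>F. x \<noteq> m \<longrightarrow> (x, m) \<in> r" by auto
    have "a \<in> \<Psi>" "m \<in> \<Psi>" "a \<noteq> m" using insert.hyps insert.prems m(1) by auto
    then have "(a, m) \<in> r \<or> (m, a) \<in> r" using assms(5) by (auto simp: total_on_def)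
    then show ?case
    proof
      assume "(m, a) \<in> r"
      then have "\<forall>x\<in>insert a F. x \<noteq> a \<longrightarrow> (x, a) \<in> r"
        using m(2) transD[OF assms(4) _ \<open>(m, a) \<in> r\<close>] by auto
      then show ?thesis by blast
    qed (use m in blast)
  qed simp
  then show ?thesis using that by blast
qed

text \<open>The subgroups \<open>{c. g S c \<in> e S ` carrier (P S)}\<close> form a well-ordered filtration of
  the kernel of \<open>gf\<close> with free factors \<open>P S\<close>; a direct sum decomposition is obtained
  by lifting each factor.\<close>

lemma well_ordered_splitting:
  assumes G: "comm_group G" and H: "group H"
    and P: "\<And>S. S \<in> \<Psi> \<Longrightarrow> group (P S) \<and> free_abelian (P S)" and Q: "\<And>S. S \<in> \<Psi> \<Longrightarrow> group (Q S)"
    and g: "\<And>S. S \<in> \<Psi> \<Longrightarrow> g S \<in> hom G (Q S) \<and> g S ` carrier G = carrier (Q S)"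
    and e: "\<And>S. S \<in> \<Psi> \<Longrightarrow> e S \<in> hom (P S) (Q S)"
    and e_inj: "\<And>S p. S \<in> \<Psi> \<Longrightarrow> p \<in> carrier (P S) \<Longrightarrow> e S p = \<one>\<^bsub>Q S\<^esub> \<Longrightarrow> p = \<one>\<^bsub>P S\<^esub>"
    and gf: "gf \<in> hom G H"
    and r: "wf r" "trans r" "total_on \<Psi> r"
    and die: "\<And>S S' c. S \<in> \<Psi> \<Longrightarrow> S' \<in> \<Psi> \<Longrightarrow> (S', S) \<in> r \<Longrightarrow> c \<in> carrier G \<Longrightarrow>
      g S' c \<in> e S' ` carrier (P S') \<Longrightarrow> g S c = \<one>\<^bsub>Q S\<^esub>"
    and die_f: "\<And>S c. S \<in> \<Psi> \<Longrightarrow> c \<in> carrier G \<Longrightarrow> g S c \<in> e S ` carrier (P S) \<Longrightarrow> gf c = \<one>\<^bsub>H\<^esub>"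
    and gen: "\<And>S c. S \<in> \<Psi> \<Longrightarrow> c \<in> carrier G \<Longrightarrow> g S c = \<one>\<^bsub>Q S\<^esub> \<Longrightarrow> c \<noteq> \<one>\<^bsub>G\<^esub> \<Longrightarrow>
      \<exists>S'\<in>\<Psi>. (S', S) \<in> r \<and> g S' c \<in> e S' ` carrier (P S')"
    and gen_f: "\<And>c. c \<in> carrier G \<Longrightarrow> gf c = \<one>\<^bsub>H\<^esub> \<Longrightarrow> c \<noteq> \<one>\<^bsub>G\<^esub> \<Longrightarrow>
      \<exists>S\<in>\<Psi>. g S c \<in> e S ` carrier (P S)"
  obtains f where "f \<in> hom (sum_group \<Psi> P) G" "inj_on f (carrier (sum_group \<Psi> P))"
    "kernel G H gf = f ` carrier (sum_group \<Psi> P)"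
proof -
  interpret G: comm_group G by fact
  have "\<exists>s. s \<in> hom (P S) G \<and> (\<forall>p\<in>carrier (P S). g S (s p) = e S p)" if "S \<in> \<Psi>" for S
    using free_abelian_lift[of "P S" G "Q S" "g S" "e S"] P Q g e G that by (metis)
  then obtain s where s: "\<And>S. S \<in> \<Psi> \<Longrightarrow> s S \<in> hom (P S) G"
    and gs: "\<And>S p. S \<in> \<Psi> \<Longrightarrow> p \<in> carrier (P S) \<Longrightarrow> g S (s S p) = e S p" by metis
  define f where "f x = gfinprod G (\<lambda>S. s S (x S)) \<Psi>" for x
  have Pg: "\<And>S. S \<in> \<Psi> \<Longrightarrow> group (P S)" using P by blast
  have f: "f \<in> hom (sum_group \<Psi> P) G"
    unfolding f_def using G.hom_group_sum[of \<Psi> s P] s Pg by blast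
  interpret f: group_hom "sum_group \<Psi> P" G f
    using f Pg by (intro group_hom.intro group_hom_axioms.intro sum_group) auto
  interpret gf: group_hom G H gf
    using gf H by (intro group_hom.intro group_hom_axioms.intro) auto
  have gh: "group_hom G (Q S) (g S)" if "S \<in> \<Psi>" for S
    using g Q that by (intro group_hom.intro group_hom_axioms.intro) auto
  have s_closed: "s S p \<in> carrier G" if "S \<in> \<Psi>" "p \<in> carrier (P S)" for S p
    using s that by (auto simp: hom_def Pi_def)
  have s_one: "s S \<one>\<^bsub>P S\<^esub> = \<one>\<^bsub>G\<^esub>" if "S \<in> \<Psi>" for S
    using hom_one[OF s[OF that]] Pg[OF that] by simp
  have f_eq: "f x = finprod G (\<lambda>S. s S (x S)) F"
    if "finite F" "F \<subseteq> \<Psi>" "\<And>S. S \<in> \<Psi> \<Longrightarrow> x S \<in> carrier (P S)"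
       "\<And>S. S \<in> \<Psi> - F \<Longrightarrow> x S = \<one>\<^bsub>P S\<^esub>" for F x
  proof -
    have cl: "(\<lambda>S. s S (x S)) \<in> \<Psi> \<rightarrow> carrier G" using that s_closed by blast
    have "f x = gfinprod G (\<lambda>S. s S (x S)) F"
      unfolding f_def
      by (rule G.gfinprod_mono_neutral_cong_right[OF that(2) _ refl cl]) (use that(4) s_one in auto)
    then show ?thesis using that(1,2) cl by (subst (asm) G.gfinprod_eq_finprod) auto
  qed
  have sum_car: "x \<in> carrier (sum_group \<Psi> P) \<longleftrightarrow>
      x \<in> (\<Pi>\<^sub>E S\<in>\<Psi>. carrier (P S)) \<and> finite {S \<in> \<Psi>. x S \<noteq> \<one>\<^bsub>P S\<^esub>}" for x
    using carrier_sum_group[of \<Psi> P] Pg by simp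
  have "x = \<one>\<^bsub>sum_group \<Psi> P\<^esub>" if x: "x \<in> carrier (sum_group \<Psi> P)" and fx: "f x = \<one>\<^bsub>G\<^esub>" for x
  proof (rule ccontr)
    assume nx: "x \<noteq> \<one>\<^bsub>sum_group \<Psi> P\<^esub>"
    define F where "F = {S \<in> \<Psi>. x S \<noteq> \<one>\<^bsub>P S\<^esub>}"
    have fin: "finite F" and xc: "\<And>S. S \<in> \<Psi> \<Longrightarrow> x S \<in> carrier (P S)"
      using x sum_car by (auto simp: F_def)
    have "F \<noteq> {}"
    proof
      assume "F = {}"
      then have "x = (\<lambda>S\<in>\<Psi>. \<one>\<^bsub>P S\<^esub>)" using x sum_car by (auto simp: F_def PiE_def extensional_def)
      then show False using nx by simp
    qed
    \<comment> \<open>The largest index of the support decides: \<open>g m\<close> kills the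
      summands at smaller indices, so that \<open>g m (f x) = e m (x m)\<close>.\<close>
    then obtain m where m: "m \<in> F" "\<And>S. S \<in> F \<Longrightarrow> S \<noteq> m \<Longrightarrow> (S, m) \<in> r"
      using finite_linear_max[OF fin, of \<Psi> r] r by (auto simp: F_def)
    then have mP: "m \<in> \<Psi>" by (simp add: F_def)
    interpret gm: group_hom G "Q m" "g m" using gh mP .
    let ?k = "\<lambda>S. s S (x S)"
    have cl: "?k \<in> F \<rightarrow> carrier G" using s_closed xc by (auto simp: F_def)
    have "f x = finprod G ?k F" using fin xc by (intro f_eq) (auto simp: F_def)
    also have "\<dots> = ?k m \<otimes>\<^bsub>G\<^esub> finprod G ?k (F - {m})"
      using m(1) fin cl by (subst insert_Diff[OF m(1), symmetric], subst G.finprod_insert) auto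
    finally have fx': "f x = ?k m \<otimes>\<^bsub>G\<^esub> finprod G ?k (F - {m})" .
    have "finprod G ?k (F - {m}) \<in> kernel G (Q m) (g m)"
    proof (rule G.finprod_in_subgroup[OF gm.subgroup_kernel])
      fix S assume S: "S \<in> F - {m}"
      then have "S \<in> \<Psi>" by (simp add: F_def)
      then have "g m (?k S) = \<one>\<^bsub>Q m\<^esub>"
        using die[OF mP, of S "?k S"] m(2)[of S] S gs xc s_closed by blast
      then show "?k S \<in> kernel G (Q m) (g m)" using \<open>S \<in> \<Psi>\<close> s_closed xc by (simp add: kernel_def)
    qed (use fin in simp)
    then have "g m (f x) = g m (?k m)"
      using fx' s_closed[OF mP xc[OF mP]] by (simp add: kernel_def)
    then have "e m (x m) = \<one>\<^bsub>Q m\<^esub>" using fx gs[OF mP xc[OF mP]] by simp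
    then have "x m = \<one>\<^bsub>P m\<^esub>" using e_inj mP xc by blast
    then show False using m(1) by (simp add: F_def)
  qed
  then have inj: "inj_on f (carrier (sum_group \<Psi> P))"
    by (subst f.inj_on_one_iff) auto
  have im: "s S p \<in> f ` carrier (sum_group \<Psi> P)" if S: "S \<in> \<Psi>" and p: "p \<in> carrier (P S)" for S p
  proof -
    define x where "x = (\<lambda>T\<in>\<Psi>. if T = S then p else \<one>\<^bsub>P T\<^esub>)"
    have xc: "x T \<in> carrier (P T)" if "T \<in> \<Psi>" for T
      using that p Pg by (simp add: x_def group.is_monoid monoid.one_closed)
    have "{T \<in> \<Psi>. x T \<noteq> \<one>\<^bsub>P T\<^esub>} \<subseteq> {S}" by (auto simp: x_def split: if_splits)
    then have "x \<in> carrier (sum_group \<Psi> P)"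
      unfolding sum_car using xc by (auto simp: x_def finite_subset)
    moreover have "f x = finprod G (\<lambda>S. s S (x S)) {S}"
      using S xc by (intro f_eq) (auto simp: x_def)
    then have "f x = s S p" using S p s_closed by (simp add: x_def)
    ultimately show ?thesis by (metis imageI)
  qed
  have sub: "subgroup (f ` carrier (sum_group \<Psi> P)) G" by (rule f.img_is_subgroup)
  have gen': "c \<in> f ` carrier (sum_group \<Psi> P)"
    if "S \<in> \<Psi>" "c \<in> carrier G" "g S c \<in> e S ` carrier (P S)" for S c
    using r(1) that
  proof (induction S arbitrary: c rule: wf_induct_rule)
    case (less S)
    then obtain p where p: "p \<in> carrier (P S)" "g S c = e S p" by blast
    interpret gS: group_hom G "Q S" "g S" using gh less by blast
    \<comment> \<open>After division by the lift of its component at \<open>S\<close>, the element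
      is killed by \<open>g S\<close>; so it is 1 or already accounted for at a smaller
      index.\<close>
    define c' where "c' = c \<otimes>\<^bsub>G\<^esub> inv\<^bsub>G\<^esub> s S p"
    have sp: "s S p \<in> carrier G" using s_closed less p by blast
    have c': "c' \<in> carrier G" using less sp by (simp add: c'_def)
    have "g S c' = g S c \<otimes>\<^bsub>Q S\<^esub> inv\<^bsub>Q S\<^esub> g S c"
      using less sp p gs by (simp add: c'_def)
    then have "g S c' = \<one>\<^bsub>Q S\<^esub>" using less by simp
    then have "c' \<in> f ` carrier (sum_group \<Psi> P)"
      using gen[of S c'] c' less subgroup.one_closed[OF sub] by metis
    moreover have "c = c' \<otimes>\<^bsub>G\<^esub> s S p" using less sp by (simp add: c'_def G.m_assoc)
    ultimately show ?case using im[of S p] less p subgroup.m_closed[OF sub] by metis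
  qed
  have "kernel G H gf = f ` carrier (sum_group \<Psi> P)"
  proof
    show "kernel G H gf \<subseteq> f ` carrier (sum_group \<Psi> P)"
      using gen_f gen' subgroup.one_closed[OF sub] unfolding kernel_def by blast
    show "f ` carrier (sum_group \<Psi> P) \<subseteq> kernel G H gf"
    proof clarify
      fix x assume x: "x \<in> carrier (sum_group \<Psi> P)"
      define F where "F = {S \<in> \<Psi>. x S \<noteq> \<one>\<^bsub>P S\<^esub>}"
      have fin: "finite F" and xc: "\<And>S. S \<in> \<Psi> \<Longrightarrow> x S \<in> carrier (P S)"
        using x sum_car by (auto simp: F_def)
      have "f x = finprod G (\<lambda>S. s S (x S)) F" using fin xc by (intro f_eq) (auto simp: F_def)
      moreover have "finprod G (\<lambda>S. s S (x S)) F \<in> kernel G H gf"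
      proof (rule G.finprod_in_subgroup[OF gf.subgroup_kernel fin])
        fix S assume "S \<in> F"
        then have "S \<in> \<Psi>" by (simp add: F_def)
        then show "s S (x S) \<in> kernel G H gf"
          using die_f[of S "s S (x S)"] gs xc s_closed by (simp add: kernel_def)
      qed
      ultimately show "f x \<in> kernel G H gf" by simp
    qed
  qed
  then show ?thesis using that f inj by blast
qed

text \<open>Maps between Picard quotients are defined on normalized representatives. Only a closed
  operation \<open>m\<close> on \<open>U\<close> is required, so these need not be made into a group
  first.\<close>

lemma hom_factor:
  assumes surj: "h ` U = carrier P"
    and closed: "\<And>x y. x \<in> U \<Longrightarrow> y \<in> U \<Longrightarrow> m x y \<in> U"
    and h: "\<And>x y. x \<in> U \<Longrightarrow> y \<in> U \<Longrightarrow> h (m x y) = h x \<otimes>\<^bsub>P\<^esub> h y"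
    and k: "\<And>x y. x \<in> U \<Longrightarrow> y \<in> U \<Longrightarrow> k (m x y) = k x \<otimes>\<^bsub>Q\<^esub> k y" "\<And>x. x \<in> U \<Longrightarrow> k x \<in> carrier Q"
    and eq: "\<And>x y. x \<in> U \<Longrightarrow> y \<in> U \<Longrightarrow> h x = h y \<Longrightarrow> k x = k y"
  obtains \<phi> where "\<phi> \<in> hom P Q" "\<And>x. x \<in> U \<Longrightarrow> \<phi> (h x) = k x"
proof -
  define \<phi> where "\<phi> p = k (inv_into U h p)" for p
  have \<phi>: "\<phi> (h x) = k x" if "x \<in> U" for x
    using eq[of "inv_into U h (h x)" x] that
    by (simp add: \<phi>_def f_inv_into_f inv_into_into)
  have "\<phi> \<in> hom P Q"
  proof (rule homI)
    fix p assume "p \<in> carrier P"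
    then show "\<phi> p \<in> carrier Q" using \<phi> k surj by force
  next
    fix p q assume "p \<in> carrier P" "q \<in> carrier P"
    then obtain x y where "x \<in> U" "y \<in> U" "p = h x" "q = h y" using surj by blast
    then show "\<phi> (p \<otimes>\<^bsub>P\<^esub> q) = \<phi> p \<otimes>\<^bsub>Q\<^esub> \<phi> q"
      by (simp add: \<phi> k closed flip: h)
  qed
  then show ?thesis using that \<phi> by blast
qed

section \<open>Well-ordered families of overrings\<close>

text \<open>What is kept of the derived sequence: an order in which the members of
  \<open>\<Psi>\<close> are removed, such that each \<open>S\<close>, at its turn, has sum
  \<open>K\<close> with the intersection of the members that remain.\<close>

locale well_ordered_family = int_poly_ring +
  fixes \<Theta> \<Psi> :: "'a set set" and r :: "('a set \<times> 'a set) set"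
  assumes rings: "\<And>S. S \<in> \<Theta> \<Longrightarrow> fsubring S" and Inter_\<Theta>: "\<Inter>\<Theta> = D"
    and compact: "compactin (zariski D) \<Theta>" and \<Psi>: "\<Psi> \<subseteq> \<Theta>"
    and r: "wf r" "trans r" "total_on \<Psi> r"
    and complement: "\<And>S z. S \<in> \<Psi> \<Longrightarrow> \<exists>a\<in>S. \<exists>b\<in>\<Inter>(\<Theta> - {T \<in> \<Psi>. T = S \<or> (T, S) \<in> r}). z = a + b"
begin

text \<open>For the derived sequence, \<open>meet (below S)\<close> and \<open>meet (upto S)\<close> interpolate between the
  consecutive rings \<open>T\<^sub>\<gamma>\<close>, removing one overring at a time.\<close>

definition below where "below S = {T \<in> \<Psi>. (T, S) \<in> r}"
definition upto where "upto S = {T \<in> \<Psi>. T = S \<or> (T, S) \<in> r}"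
definition meet where "meet W = \<Inter>(\<Theta> - W)"
definition initial where "initial W \<longleftrightarrow> W \<subseteq> \<Psi> \<and> (\<forall>S\<in>W. below S \<subseteq> W)"

lemma initial_below: "initial (below S)"
  using r(2) by (auto simp: initial_def below_def dest: transD)

lemma initial_\<Psi>: "initial \<Psi>"
  by (auto simp: initial_def below_def)

lemma initial_upto_subset: "initial W \<Longrightarrow> S \<in> W \<Longrightarrow> upto S \<subseteq> W"
  by (auto simp: initial_def upto_def below_def)

lemma fsubring_meet: "fsubring (meet W)"
  unfolding meet_def by (intro fsubring_Inter) (use rings in auto)

lemma meet_mono: "W \<subseteq> W' \<Longrightarrow> meet W \<subseteq> meet W'"
  unfolding meet_def by blast

lemma D_subset_meet: "D \<subseteq> meet W"
  using Inter_\<Theta> unfolding meet_def by blast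

lemma \<Psi>_ring: "S \<in> \<Psi> \<Longrightarrow> fsubring S \<and> D \<subseteq> S"
  using rings Inter_\<Theta> \<Psi> by blast

text \<open>As \<open>r\<close> is irreflexive, \<open>below S\<close> is \<open>upto S\<close>
  without \<open>S\<close>, so \<open>meet (below S)\<close> is the intersection of \<open>S\<close>
  with \<open>meet (upto S)\<close>.\<close>

lemma matlis: assumes "S \<in> \<Psi>" shows "matlis_pair (meet (below S)) S (meet (upto S))"
proof -
  have "(S, S) \<notin> r" using r(1) by (metis wf_not_refl)
  then have "\<Theta> - below S = insert S (\<Theta> - upto S)"
    using assms \<Psi> by (auto simp: below_def upto_def)
  then show ?thesis
    using complement[OF assms] fsubring_meet \<Psi>_ring[OF assms]
    unfolding matlis_pair_def by (auto simp: meet_def upto_def)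
qed

text \<open>If \<open>x = a + b\<close> with \<open>a \<in> S\<close> and \<open>b \<in> meet (upto S)\<close>, then each member of the family outside
  \<open>upto S\<close> that contains \<open>a\<close> contains \<open>x\<close>; so a finite subcover by the sets \<open>{T. a \<in> T}\<close> bounds
  the set of members that omit \<open>x\<close>.\<close>

lemma meet_initial_cases:
  assumes W: "initial W" and x: "x \<in> meet W"
  shows "x \<in> D \<or> (\<exists>S\<in>W. x \<in> meet (upto S))"
proof -
  have W\<Psi>: "W \<subseteq> \<Psi>" using W by (simp add: initial_def)
  have "\<exists>a b. a \<in> S \<and> b \<in> meet (upto S) \<and> x = a + b" if "S \<in> W" for S
    using complement[of S x] that W\<Psi> unfolding meet_def upto_def by blast
  then obtain a b where ab: "\<And>S. S \<in> W \<Longrightarrow> a S \<in> S \<and> b S \<in> meet (upto S) \<and> x = a S + b S"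
    by metis
  define U where "U y = {T. overring D T \<and> set [y] \<subseteq> T}" for y
  have U: "T \<in> U y \<longleftrightarrow> y \<in> T" if "T \<in> \<Theta>" for T y
    using that rings Inter_\<Theta> by (auto simp: U_def overring_def)
  have op: "openin (zariski D) (U y)" for y
    unfolding zariski_def U_def by (rule topology_generated_by_Basis) blast
  have "\<Theta> \<subseteq> \<Union>(insert (U x) ((\<lambda>S. U (a S)) ` W))"
  proof
    fix T assume T: "T \<in> \<Theta>"
    show "T \<in> \<Union>(insert (U x) ((\<lambda>S. U (a S)) ` W))"
    proof (cases "T \<in> W")
      case True then show ?thesis using U[OF T] ab by blast
    next
      case False then show ?thesis using U[OF T] x T by (auto simp: meet_def)
    qed
  qed
  then obtain \<F> where F: "finite \<F>" "\<F> \<subseteq> insert (U x) ((\<lambda>S. U (a S)) ` W)" "\<Theta> \<subseteq> \<Union>\<F>"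
    using compact[unfolded compactin_def, THEN conjunct2, rule_format, of "insert (U x) ((\<lambda>S. U (a S)) ` W)"] op
    by auto
  have "finite (\<F> - {U x})" "\<F> - {U x} \<subseteq> (\<lambda>S. U (a S)) ` W" using F by auto
  then obtain W0 where W0: "W0 \<subseteq> W" "finite W0" "\<F> - {U x} = (\<lambda>S. U (a S)) ` W0"
    by (metis finite_subset_image)
  have cov: "x \<in> T \<or> (\<exists>S\<in>W0. a S \<in> T)" if T: "T \<in> \<Theta>" for T
  proof -
    obtain V where "V \<in> \<F>" "T \<in> V" using F(3) T by blast
    then show ?thesis using W0(3) U[OF T] by (cases "V = U x") blast+
  qed
  show ?thesis
  proof (cases "W0 = {}")
    case True then show ?thesis using cov Inter_\<Theta> by blast
  next
    case False
    then obtain m where m: "m \<in> W0" "\<And>S. S \<in> W0 \<Longrightarrow> S \<noteq> m \<Longrightarrow> (S, m) \<in> r"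
      using finite_linear_max[OF W0(2), of \<Psi> r] W0 W\<Psi> r by (metis subset_trans)
    have "x \<in> T" if T: "T \<in> \<Theta>" "T \<notin> upto m" for T
    proof (rule ccontr)
      assume "x \<notin> T"
      then obtain S where S: "S \<in> W0" "a S \<in> T" using cov T by blast
      have "T \<notin> upto S"
        using T(2) m(2)[OF S(1)] transD[OF r(2), of T S m] by (auto simp: upto_def)
      moreover have "b S \<in> meet (upto S)" using ab S W0 by blast
      ultimately have "b S \<in> T" using T by (simp add: meet_def)
      then have "a S + b S \<in> T" using S(2) by (intro fsubringD(3)[OF rings[OF T(1)]])
      then have "x \<in> T" using ab[OF subsetD[OF W0(1) S(1)]] by simp
      then show False using \<open>x \<notin> T\<close> by blast
    qed
    then have "x \<in> meet (upto m)" by (simp add: meet_def)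
    then show ?thesis using m(1) W0(1) by blast
  qed
qed

text \<open>\<open>D\<close> is inserted because \<open>W\<close> may be empty, and then
  \<open>meet W\<close> is \<open>D\<close>. The embedding and \<open>A\<close> stay arbitrary,
  since modules over Int(D)R and ideals of the overrings both descend along this chain.\<close>

lemma ring_chain_initial:
  assumes W: "initial W" and e: "scalar_extension D e A"
  shows "ring_chain D e A (insert D ((\<lambda>S. meet (upto S)) ` W)) (meet W)"
proof (intro ring_chain.intro ring_chain_axioms.intro e)
  have W\<Psi>: "W \<subseteq> \<Psi>" using W by (simp add: initial_def)
  have cmp: "upto S \<subseteq> upto T \<or> upto T \<subseteq> upto S" if "S \<in> W" "T \<in> W" for S T
  proof -
    have "S = T \<or> (S, T) \<in> r \<or> (T, S) \<in> r" using r(3) that W\<Psi> by (auto simp: total_on_def)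
    then show ?thesis using transD[OF r(2)] by (auto simp: upto_def)
  qed
  fix R S assume "R \<in> insert D ((\<lambda>S. meet (upto S)) ` W)" "S \<in> insert D ((\<lambda>S. meet (upto S)) ` W)"
  then consider "R = D \<or> S = D" | U V where "U \<in> W" "V \<in> W" "R = meet (upto U)" "S = meet (upto V)"
    by blast
  then show "R \<subseteq> S \<or> S \<subseteq> R"
  proof cases
    case 1
    then show ?thesis using D_subset_meet \<open>R \<in> _\<close> \<open>S \<in> _\<close> by auto
  next
    case (2 U V)
    then show ?thesis using cmp[of U V] meet_mono by metis
  qed
next
  fix R assume "R \<in> insert D ((\<lambda>S. meet (upto S)) ` W)"
  then show "fsubring R" using D fsubring_meet by auto
next
  show "meet W = \<Union>(insert D ((\<lambda>S. meet (upto S)) ` W))"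
  proof
    show "meet W \<subseteq> \<Union>(insert D ((\<lambda>S. meet (upto S)) ` W))"
      using meet_initial_cases[OF W] by auto
    show "\<Union>(insert D ((\<lambda>S. meet (upto S)) ` W)) \<subseteq> meet W"
      using D_subset_meet meet_mono[OF initial_upto_subset[OF W]] by auto
  qed
qed (auto intro: fsubring_meet)

text \<open>The limit step of surjectivity: \<open>I\<close> already comes from \<open>D\<close> or
  from some \<open>meet (upto S)\<close>, where \<open>IH\<close> lifts it.\<close>

lemma lift_initial:
  assumes W: "initial W" and I: "P.inv_mod (meet W) I"
    and IH: "\<And>S I. S \<in> W \<Longrightarrow> P.inv_mod (meet (upto S)) I \<Longrightarrow> \<exists>J. P.inv_mod D J \<and> J \<star> embK ` meet (upto S) = I"
  shows "\<exists>J. P.inv_mod D J \<and> J \<star> embK ` meet W = I"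
proof -
  interpret C: ring_chain D embK "embP ` Int_poly D" "insert D ((\<lambda>S. meet (upto S)) ` W)" "meet W"
    by (rule ring_chain_initial[OF W P.scalar_extension_axioms])
  obtain R J where R: "R \<in> insert D ((\<lambda>S. meet (upto S)) ` W)" "P.inv_mod R J" "J \<star> embK ` meet W = I"
    using C.inv_mod_descend[OF I] .
  show ?thesis
  proof (cases "R = D")
    case True then show ?thesis using R by blast
  next
    case False
    then obtain S where S: "S \<in> W" "R = meet (upto S)" using R by blast
    then obtain J' where "P.inv_mod D J'" "J' \<star> embK ` R = J" using IH R by blast
    moreover from this have "J' \<star> embK ` meet W = I"
      using R P.extend_extend[of R "meet W" J'] C.rings[OF R(1)] C.chain_subset[OF R(1)] fsubring_meet by simp
    ultimately show ?thesis by blast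
  qed
qed

text \<open>The successor step: \<open>I\<close> is glued with the trivial module
  \<open>P.ext S\<close> to a module over \<open>meet (below S)\<close>, to which the limit step
  applies.\<close>

lemma lift_upto:
  assumes "S \<in> \<Psi>" "P.inv_mod (meet (upto S)) I"
  shows "\<exists>J. P.inv_mod D J \<and> J \<star> embK ` meet (upto S) = I"
  using r(1) assms
proof (induction S arbitrary: I rule: wf_induct_rule)
  case (less S)
  note m = matlis[OF less.prems(1)]
  have q: "has_quotfield_univ (meet (below S))" by (rule has_quotfield_overring[OF D_subset_meet])
  have "P.inv_mod S (P.ext S)" using P.inv_mod_ext \<Psi>_ring less.prems by blast
  note I1 = P.inv_mod_Int[OF m q this less.prems(2)]
  obtain J where J: "P.inv_mod D J" "J \<star> embK ` meet (below S) = P.ext S \<inter> I"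
    using lift_initial[OF initial_below I1(1)] less.IH by (auto simp: below_def)
  have "meet (below S) \<subseteq> meet (upto S)" by (rule meet_mono) (auto simp: below_def upto_def)
  then have "J \<star> embK ` meet (upto S) = I"
    using P.extend_extend[of "meet (below S)" "meet (upto S)" J] J I1(3) fsubring_meet by simp
  then show ?case using J by blast
qed

lemma lift_meet:
  assumes W: "initial W" and I: "P.inv_mod (meet W) I"
  shows "\<exists>J. P.inv_mod D J \<and> J \<star> embK ` meet W = I"
proof (rule lift_initial[OF W I])
  fix S I assume "S \<in> W" "P.inv_mod (meet (upto S)) I"
  then show "\<exists>J. P.inv_mod D J \<and> J \<star> embK ` meet (upto S) = I"
    using lift_upto W by (auto simp: initial_def)
qed

section \<open>Trivial classes and the kernel of base change\<close>

definition extended where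
  "extended R I \<longleftrightarrow> (\<exists>H. invertible_frac R H \<and> I = embK ` H \<star> P.ext R)"

lemma extended_extend:
  assumes R: "fsubring R" "fsubring R'" "D \<subseteq> R" "R \<subseteq> R'" and I: "extended R I"
  shows "extended R' (I \<star> embK ` R')"
proof -
  obtain H where H: "invertible_frac R H" "I = embK ` H \<star> P.ext R" using I by (auto simp: extended_def)
  have "I \<star> embK ` R' = embK ` H \<star> (P.ext R \<star> (embK ` R' \<star> embK ` R'))"
    using R by (simp add: H set_prod.assoc P.image_prod_image)
  also have "\<dots> = (embK ` H \<star> embK ` R') \<star> (P.ext R \<star> embK ` R')" by (simp add: set_prod_ac)
  also have "\<dots> = embK ` (H \<star> R') \<star> P.ext R'" using R by (simp add: P.e_image_set_prod P.ext_image)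
  finally show ?thesis using S_extend[OF H(1)] R by (auto simp: extended_def)
qed

text \<open>Two descents are needed: the ideal \<open>H\<close> comes from an ideal \<open>J\<close>
  over some \<open>R\<close>, by the base instance of the chain, and the equation between the
  modules extended from \<open>I\<close> and \<open>J\<close> then holds over some larger
  \<open>R'\<close>.\<close>

lemma extended_descend:
  assumes W: "initial W" and I: "P.inv_mod D I" and ext: "extended (meet W) (I \<star> embK ` meet W)"
  shows "extended D I \<or> (\<exists>S\<in>W. extended (meet (upto S)) (I \<star> embK ` meet (upto S)))"
proof -
  let ?C = "insert D ((\<lambda>S. meet (upto S)) ` W)"
  interpret C: ring_chain D embK "embP ` Int_poly D" ?C "meet W"
    by (rule ring_chain_initial[OF W P.scalar_extension_axioms])
  interpret CS: ring_chain D "\<lambda>x. x" D ?C "meet W"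
    by (rule ring_chain_initial[OF W S.scalar_extension_axioms])
  obtain H where H: "invertible_frac (meet W) H" "I \<star> embK ` meet W = embK ` H \<star> P.ext (meet W)"
    using ext by (auto simp: extended_def)
  then have "S.inv_mod (meet W) H" using S_inv_mod_iff fsubring_meet D_subset_meet by blast
  then obtain R J where R: "R \<in> ?C" and J: "S.inv_mod R J" "J \<star> meet W = H"
    using CS.inv_mod_descend by (metis image_ident)
  have Rr: "fsubring R" "D \<subseteq> R" "R \<subseteq> meet W" using C.rings[OF R] R D_subset_meet C.chain_subset[OF R] by auto
  have Jf: "invertible_frac R J" using J Rr S_inv_mod_iff by blast
  have IR: "P.inv_mod R (I \<star> embK ` R)" using P.inv_mod_extend D I Rr by blast
  have JR: "P.inv_mod R (embK ` J \<star> P.ext R)" using inv_mod_base_extend Rr Jf by blast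
  have "I \<star> embK ` R \<star> embK ` meet W = embK ` (J \<star> meet W) \<star> P.ext (meet W)"
    using H J P.extend_extend[OF Rr(1) fsubring_meet Rr(3)] by simp
  also have "\<dots> = embK ` J \<star> (P.ext R \<star> embK ` meet W \<star> embK ` meet W)"
    using P.ext_image[OF Rr(1) fsubring_meet Rr(3)]
    by (simp add: P.e_image_set_prod set_prod_ac)
  also have "\<dots> = embK ` J \<star> P.ext R \<star> embK ` meet W"
    using fsubring_meet by (simp add: set_prod.assoc P.image_prod_image)
  finally obtain R' where R': "R' \<in> ?C" "R \<subseteq> R'" "I \<star> embK ` R \<star> embK ` R' = embK ` J \<star> P.ext R \<star> embK ` R'"
    using C.inv_mod_descend_eq[OF R IR JR] by blast
  have "extended R (embK ` J \<star> P.ext R)" using Jf by (auto simp: extended_def)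
  then have "extended R' (embK ` J \<star> P.ext R \<star> embK ` R')"
    using extended_extend Rr C.rings[OF R'(1)] R'(2) by blast
  then have *: "extended R' (I \<star> embK ` R')"
    using R'(3) P.extend_extend[OF Rr(1) C.rings[OF R'(1)] R'(2)] by simp
  show ?thesis
  proof (cases "R' = D")
    case True
    then show ?thesis using * P.inv_mod_image[OF D(1) I] by simp
  next
    case False
    then show ?thesis using * R'(1) by blast
  qed
qed

lemma cls_one_extended:
  "fsubring R \<Longrightarrow> D \<subseteq> R \<Longrightarrow> P.inv_mod R I \<Longrightarrow> cls R I = \<one>\<^bsub>Pic_Int_rel D R\<^esub> \<longleftrightarrow> extended R I"
  unfolding extended_def by (rule cls_eq_one_iff)

lemma extend_hom:
  assumes R: "fsubring R" "D \<subseteq> R"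
  obtains \<phi> where "\<phi> \<in> hom (Pic_Int_rel D D) (Pic_Int_rel D R)"
    "\<And>I. P.inv_mod D I \<Longrightarrow> \<phi> (cls D I) = cls R (I \<star> embK ` R)"
proof (rule hom_factor[where h = "cls D" and U = "{I. P.inv_mod D I}" and m = set_prod
      and k = "\<lambda>I. cls R (I \<star> embK ` R)" and P = "Pic_Int_rel D D" and Q = "Pic_Int_rel D R"])
  note goal = that
  have ext: "P.inv_mod R (I \<star> embK ` R)" if "P.inv_mod D I" for I
    using P.inv_mod_extend D R that by blast
  show thesis if "\<phi> \<in> hom (Pic_Int_rel D D) (Pic_Int_rel D R)"
    "\<And>I. I \<in> {I. P.inv_mod D I} \<Longrightarrow> \<phi> (cls D I) = cls R (I \<star> embK ` R)" for \<phi>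
    by (rule goal[OF that(1)]) (simp add: that(2))
  show "cls R (I \<star> embK ` R) \<in> carrier (Pic_Int_rel D R)" if "I \<in> {I. P.inv_mod D I}" for I
    using cls_closed[OF R ext] that by simp
  show "cls D ` {I. P.inv_mod D I} = carrier (Pic_Int_rel D D)"
    by (rule cls_surj[OF D(1) order_refl])
  fix I J assume "I \<in> {I. P.inv_mod D I}" "J \<in> {I. P.inv_mod D I}"
  then have IJ: "P.inv_mod D I" "P.inv_mod D J" by auto
  show "I \<star> J \<in> {I. P.inv_mod D I}" using P.inv_mod_mult D IJ by blast
  show "cls D (I \<star> J) = cls D I \<otimes>\<^bsub>Pic_Int_rel D D\<^esub> cls D J"
    by (rule cls_mult[OF D(1) order_refl IJ])
  show "cls R (I \<star> J \<star> embK ` R) = cls R (I \<star> embK ` R) \<otimes>\<^bsub>Pic_Int_rel D R\<^esub> cls R (J \<star> embK ` R)"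
    unfolding P.extend_mult[OF R(1)] by (rule cls_mult[OF R ext[OF IJ(1)] ext[OF IJ(2)]])
  assume "cls D I = cls D J"
  then obtain H where H: "invertible_frac D H" "I = J \<star> embK ` H"
    using cls_eq_iff[OF D(1) order_refl IJ] by blast
  have "I \<star> embK ` R = (J \<star> embK ` R) \<star> embK ` (H \<star> R)"
    by (simp add: H P.extend_mult[OF R(1)] P.e_image_set_prod)
  moreover have "invertible_frac R (H \<star> R)" using S_extend H D R by blast
  ultimately show "cls R (I \<star> embK ` R) = cls R (J \<star> embK ` R)"
    using cls_eq_iff[OF R ext[OF IJ(1)] ext[OF IJ(2)]] by blast
qed

text \<open>Gluing with the trivial module over \<open>T\<close> produces the classes over
  \<open>R\<close> that become trivial over \<open>T\<close>. For well-definedness the ideal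
  \<open>H\<close> of \<open>S\<close> that relates two representatives is glued with
  \<open>T\<close>, giving an ideal of \<open>R\<close>.\<close>

lemma factor_hom:
  assumes S: "S \<in> \<Psi>"
  defines "R \<equiv> meet (below S)" and "T \<equiv> meet (upto S)"
  obtains \<psi> where "\<psi> \<in> hom (Pic_Int_rel D S) (Pic_Int_rel D R)"
    "\<And>I. P.inv_mod S I \<Longrightarrow> \<psi> (cls S I) = cls R (I \<inter> P.ext T)"
proof -
  note m = matlis[OF S, folded R_def T_def]
  have Sr: "fsubring S" "D \<subseteq> S" using \<Psi>_ring S by auto
  have Tr: "fsubring T" "D \<subseteq> T" and Rr: "fsubring R" "D \<subseteq> R"
    using fsubring_meet D_subset_meet by (auto simp: R_def T_def)
  have q: "has_quotfield_univ R" by (rule has_quotfield_overring[OF Rr(2)])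
  note Int = P.inv_mod_Int[OF m q _ P.inv_mod_ext[OF Tr(1)]]
  have mod: "M \<star> embK ` R = M" if "P.inv_mod R M" for M using P.inv_mod_image Rr that by blast
  note goal = that
  show ?thesis
  proof (rule hom_factor[where h = "cls S" and U = "{I. P.inv_mod S I}" and m = set_prod
      and k = "\<lambda>I. cls R (I \<inter> P.ext T)" and P = "Pic_Int_rel D S" and Q = "Pic_Int_rel D R"])
    show thesis if "\<psi> \<in> hom (Pic_Int_rel D S) (Pic_Int_rel D R)"
      "\<And>I. I \<in> {I. P.inv_mod S I} \<Longrightarrow> \<psi> (cls S I) = cls R (I \<inter> P.ext T)" for \<psi>
      by (rule goal[OF that(1)]) (simp add: that(2))
    show "cls R (I \<inter> P.ext T) \<in> carrier (Pic_Int_rel D R)" if "I \<in> {I. P.inv_mod S I}" for I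
      using cls_closed[OF Rr Int(1)] that by simp
    show "cls S ` {I. P.inv_mod S I} = carrier (Pic_Int_rel D S)"
      by (rule cls_surj[OF Sr])
    fix I J assume "I \<in> {I. P.inv_mod S I}" "J \<in> {I. P.inv_mod S I}"
    then have IJ: "P.inv_mod S I" "P.inv_mod S J" by auto
    have IJm: "P.inv_mod S (I \<star> J)" using P.inv_mod_mult Sr IJ by blast
    then show "I \<star> J \<in> {I. P.inv_mod S I}" by simp
    show "cls S (I \<star> J) = cls S I \<otimes>\<^bsub>Pic_Int_rel D S\<^esub> cls S J"
      by (rule cls_mult[OF Sr IJ])
    have "I \<star> J \<inter> P.ext T = (I \<inter> P.ext T) \<star> (J \<inter> P.ext T)"
    proof (rule P.matlis_module_eqI[OF m q])
      show "(I \<inter> P.ext T) \<star> (J \<inter> P.ext T) \<star> embK ` R = (I \<inter> P.ext T) \<star> (J \<inter> P.ext T)"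
        using mod[OF Int(1)[OF IJ(2)]] by (simp add: set_prod.assoc)
    qed (use Int[OF IJ(1)] Int[OF IJ(2)] Int[OF IJm] mod Sr Tr in
        \<open>simp_all add: P.extend_mult P.ext_idem\<close>)
    then show "cls R (I \<star> J \<inter> P.ext T) = cls R (I \<inter> P.ext T) \<otimes>\<^bsub>Pic_Int_rel D R\<^esub> cls R (J \<inter> P.ext T)"
      using cls_mult[OF Rr Int(1)[OF IJ(1)] Int(1)[OF IJ(2)]] by simp
    assume "cls S I = cls S J"
    then obtain H where H: "invertible_frac S H" "I = J \<star> embK ` H"
      using cls_eq_iff[OF Sr IJ] by blast
    then have "S.inv_mod S H" using S_inv_mod_iff Sr by blast
    note HT = S.inv_mod_Int[OF m q this S.inv_mod_ext[OF Tr(1)], unfolded S_ext_eq[OF Tr] image_ident]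
    have HR: "invertible_frac R (H \<inter> T)" using HT(1) S_inv_mod_iff Rr by blast
    have "I \<inter> P.ext T = (J \<inter> P.ext T) \<star> embK ` (H \<inter> T)"
    proof (rule P.matlis_module_eqI[OF m q])
      show "(J \<inter> P.ext T) \<star> embK ` (H \<inter> T) \<star> embK ` R = (J \<inter> P.ext T) \<star> embK ` (H \<inter> T)"
        by (rule set_prod_absorb[OF mod[OF Int(1)[OF IJ(2)]]])
      show "(I \<inter> P.ext T) \<star> embK ` S = (J \<inter> P.ext T) \<star> embK ` (H \<inter> T) \<star> embK ` S"
        using Int(2)[OF IJ(1)] Int(2)[OF IJ(2)] HT(2)
        by (simp add: P.extend_mult[OF Sr(1)] P.e_image_set_prod[symmetric] H(2))
      show "(I \<inter> P.ext T) \<star> embK ` T = (J \<inter> P.ext T) \<star> embK ` (H \<inter> T) \<star> embK ` T"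
        using Int(3)[OF IJ(1)] Int(3)[OF IJ(2)] HT(3) P.ext_image_self[OF Tr(1)]
        by (simp add: P.extend_mult[OF Tr(1)] P.e_image_set_prod[symmetric])
    qed (use mod[OF Int(1)[OF IJ(1)]] in simp)
    then show "cls R (I \<inter> P.ext T) = cls R (J \<inter> P.ext T)"
      using cls_eq_iff[OF Rr Int(1)[OF IJ(1)] Int(1)[OF IJ(2)]] HR by blast
  qed
qed

lemma exact_sequence:
  assumes Pic: "\<And>T. T \<in> \<Psi> \<Longrightarrow> P T = Pic_Int_rel D T" and free: "\<And>T. T \<in> \<Psi> \<Longrightarrow> free_abelian (P T)"
  shows "\<exists>f g. f \<in> hom (sum_group \<Psi> P) (Pic_Int_rel D D) \<and>
    g \<in> hom (Pic_Int_rel D D) (Pic_Int_rel D (meet \<Psi>)) \<and>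
    inj_on f (carrier (sum_group \<Psi> P)) \<and>
    g ` carrier (Pic_Int_rel D D) = carrier (Pic_Int_rel D (meet \<Psi>)) \<and>
    kernel (Pic_Int_rel D D) (Pic_Int_rel D (meet \<Psi>)) g = f ` carrier (sum_group \<Psi> P)"
proof -
  let ?G = "Pic_Int_rel D D"
  note mr = fsubring_meet D_subset_meet
  have "\<exists>\<phi>. \<phi> \<in> hom ?G (Pic_Int_rel D (meet W)) \<and>
    (\<forall>I. P.inv_mod D I \<longrightarrow> \<phi> (cls D I) = cls (meet W) (I \<star> embK ` meet W))" for W
    using extend_hom[OF mr] by metis
  then obtain \<phi> where \<phi>: "\<And>W. \<phi> W \<in> hom ?G (Pic_Int_rel D (meet W))"
    and \<phi>cls: "\<And>W I. P.inv_mod D I \<Longrightarrow> \<phi> W (cls D I) = cls (meet W) (I \<star> embK ` meet W)" by metis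
  have "\<exists>\<psi>. \<psi> \<in> hom (Pic_Int_rel D S) (Pic_Int_rel D (meet (below S))) \<and>
    (\<forall>I. P.inv_mod S I \<longrightarrow> \<psi> (cls S I) = cls (meet (below S)) (I \<inter> P.ext (meet (upto S))))"
    if "S \<in> \<Psi>" for S
    using factor_hom[OF that] by metis
  then obtain \<psi> where \<psi>: "\<And>S. S \<in> \<Psi> \<Longrightarrow> \<psi> S \<in> hom (Pic_Int_rel D S) (Pic_Int_rel D (meet (below S)))"
    and \<psi>cls: "\<And>S I. S \<in> \<Psi> \<Longrightarrow> P.inv_mod S I \<Longrightarrow>
      \<psi> S (cls S I) = cls (meet (below S)) (I \<inter> P.ext (meet (upto S)))" by metis
  have surj: "\<phi> W ` carrier ?G = carrier (Pic_Int_rel D (meet W))" if W: "initial W" for W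
  proof
    show "\<phi> W ` carrier ?G \<subseteq> carrier (Pic_Int_rel D (meet W))" using \<phi> by (auto simp: hom_def)
    show "carrier (Pic_Int_rel D (meet W)) \<subseteq> \<phi> W ` carrier ?G"
    proof
      fix c assume "c \<in> carrier (Pic_Int_rel D (meet W))"
      then obtain I where I: "P.inv_mod (meet W) I" "c = cls (meet W) I"
        using cls_surj[OF mr, of W] by blast
      obtain J where "P.inv_mod D J" "J \<star> embK ` meet W = I" using lift_meet[OF W I(1)] by blast
      then show "c \<in> \<phi> W ` carrier ?G"
        using I \<phi>cls cls_closed[OF D(1) order_refl] by (metis imageI)
    qed
  qed
  have repr: "\<exists>I. P.inv_mod D I \<and> c = cls D I" if "c \<in> carrier ?G" for c
    using that cls_surj[OF D(1) order_refl] by blast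
  have ext: "P.inv_mod (meet W) (I \<star> embK ` meet W)" if "P.inv_mod D I" for I W
    using P.inv_mod_extend[OF D(1) mr that] .
  have \<phi>one: "\<phi> W (cls D I) = \<one>\<^bsub>Pic_Int_rel D (meet W)\<^esub> \<longleftrightarrow> extended (meet W) (I \<star> embK ` meet W)"
    if "P.inv_mod D I" for I W
    using \<phi>cls[OF that] cls_one_extended[OF mr ext[OF that]] by simp
  \<comment> \<open>Exactness at the single step \<open>S\<close>. The dying and the generating
    hypotheses of \<open>well_ordered_splitting\<close> are all read through this criterion.\<close>
  have key: "\<phi> (below S) (cls D I) \<in> \<psi> S ` carrier (Pic_Int_rel D S) \<longleftrightarrow>
      extended (meet (upto S)) (I \<star> embK ` meet (upto S))"
    if S: "S \<in> \<Psi>" and I: "P.inv_mod D I" for S I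
  proof -
    define R where "R = meet (below S)"
    define T where "T = meet (upto S)"
    note m = matlis[OF S, folded R_def T_def]
    have Sr: "fsubring S" "D \<subseteq> S" using \<Psi>_ring S by auto
    have Tr: "fsubring T" "D \<subseteq> T" and Rr: "fsubring R" "D \<subseteq> R" using mr by (auto simp: R_def T_def)
    have RT: "R \<subseteq> T" "R \<subseteq> S" using m by (auto simp: matlis_pair_def)
    have q: "has_quotfield_univ R" by (rule has_quotfield_overring[OF Rr(2)])
    note Int = P.inv_mod_Int[OF m q _ P.inv_mod_ext[OF Tr(1)]]
    have IR: "P.inv_mod R (I \<star> embK ` R)" and IS: "P.inv_mod S (I \<star> embK ` S)"
      using P.inv_mod_extend[OF D(1) _ _ I] Rr Sr Tr by auto
    show ?thesis unfolding R_def[symmetric] T_def[symmetric]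
    proof
      assume "\<phi> (below S) (cls D I) \<in> \<psi> S ` carrier (Pic_Int_rel D S)"
      then obtain J where J: "P.inv_mod S J" "\<phi> (below S) (cls D I) = \<psi> S (cls S J)"
        unfolding cls_surj[OF Sr, symmetric] by blast
      then have "cls R (I \<star> embK ` R) = cls R (J \<inter> P.ext T)"
        using \<phi>cls[OF I] \<psi>cls[OF S] by (simp add: R_def T_def)
      then obtain H where H: "invertible_frac R H" "I \<star> embK ` R = (J \<inter> P.ext T) \<star> embK ` H"
        using cls_eq_iff[OF Rr IR Int(1)[OF J(1)]] by blast
      have "I \<star> embK ` T = I \<star> embK ` R \<star> embK ` T" using P.extend_extend Rr Tr RT by simp
      also have "\<dots> = P.ext T \<star> embK ` (H \<star> T)"
        by (simp add: H(2) P.extend_mult[OF Tr(1)] Int(3)[OF J(1)] P.e_image_set_prod)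
      finally have "I \<star> embK ` T = embK ` (H \<star> T) \<star> P.ext T" by (simp add: set_prod.commute)
      then show "extended T (I \<star> embK ` T)"
        using S_extend[OF H(1) Rr(1) Tr(1) Rr(2) RT(1)] by (auto simp: extended_def)
    next
      assume "extended T (I \<star> embK ` T)"
      then obtain H where H: "invertible_frac T H" "I \<star> embK ` T = embK ` H \<star> P.ext T"
        by (auto simp: extended_def)
      then have "S.inv_mod T H" using S_inv_mod_iff Tr by blast
      note HS = S.inv_mod_Int[OF m q S.inv_mod_ext[OF Sr(1)] this, unfolded S_ext_eq[OF Sr] image_ident]
      have HR: "invertible_frac R (S \<inter> H)" using HS(1) S_inv_mod_iff Rr by blast
      \<comment> \<open>\<open>?J\<close> agrees with \<open>I\<close> over \<open>S\<close> and is
        trivial over \<open>T\<close>. The discrepancy at \<open>T\<close> is the ideal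
        \<open>H\<close>, which glues with the unit ideal of \<open>S\<close> to an ideal of
        \<open>R\<close>.\<close>
      let ?J = "(I \<star> embK ` S) \<inter> P.ext T"
      have "I \<star> embK ` R = ?J \<star> embK ` (S \<inter> H)"
      proof (rule P.matlis_module_eqI[OF m q])
        show "I \<star> embK ` R \<star> embK ` R = I \<star> embK ` R" by (rule P.inv_mod_image[OF Rr(1) IR])
        show "?J \<star> embK ` (S \<inter> H) \<star> embK ` R = ?J \<star> embK ` (S \<inter> H)"
          by (rule set_prod_absorb[OF P.inv_mod_image[OF Rr(1) Int(1)[OF IS]]])
        show "I \<star> embK ` R \<star> embK ` S = ?J \<star> embK ` (S \<inter> H) \<star> embK ` S"
          using P.extend_extend[OF Rr(1) Sr(1) RT(2)] P.extend_extend[OF Sr(1) Sr(1) order_refl] Int(2)[OF IS] HS(2)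
          by (simp add: P.extend_mult[OF Sr(1)] P.e_image_set_prod[symmetric])
        show "I \<star> embK ` R \<star> embK ` T = ?J \<star> embK ` (S \<inter> H) \<star> embK ` T"
        proof -
          have "?J \<star> embK ` (S \<inter> H) \<star> embK ` T = P.ext T \<star> embK ` H"
            using Int(3)[OF IS] HS(3) by (simp add: P.extend_mult[OF Tr(1)] P.e_image_set_prod[symmetric])
          then show ?thesis
            using P.extend_extend[OF Rr(1) Tr(1) RT(1)] H(2) by (simp add: set_prod.commute[of "P.ext T"])
        qed
      qed
      then have "cls R (I \<star> embK ` R) = cls R ?J" using cls_eq_iff[OF Rr IR Int(1)[OF IS]] HR by blast
      then have "\<phi> (below S) (cls D I) = \<psi> S (cls S (I \<star> embK ` S))"
        using \<phi>cls[OF I] \<psi>cls[OF S IS] by (simp add: R_def T_def)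
      then show "\<phi> (below S) (cls D I) \<in> \<psi> S ` carrier (Pic_Int_rel D S)"
        using cls_closed[OF Sr IS] by blast
    qed
  qed
  have grp: "group (Pic_Int_rel D R)" if "fsubring R" "D \<subseteq> R" for R
    using comm_group_Pic[OF that] by (simp add: comm_group_def)
  obtain f where "f \<in> hom (sum_group \<Psi> P) ?G" "inj_on f (carrier (sum_group \<Psi> P))"
    "kernel ?G (Pic_Int_rel D (meet \<Psi>)) (\<phi> \<Psi>) = f ` carrier (sum_group \<Psi> P)"
  proof (rule well_ordered_splitting[where P = P and G = ?G and \<Psi> = \<Psi> and g = "\<lambda>S. \<phi> (below S)"
        and e = \<psi> and gf = "\<phi> \<Psi>" and Q = "\<lambda>S. Pic_Int_rel D (meet (below S))"
        and H = "Pic_Int_rel D (meet \<Psi>)" and r = r])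
    show "comm_group ?G" by (rule comm_group_Pic[OF D(1) order_refl])
    show "group (P S) \<and> free_abelian (P S)" if "S \<in> \<Psi>" for S
      using free[OF that] grp \<Psi>_ring[OF that] by (simp add: Pic that)
    show "\<psi> S \<in> hom (P S) (Pic_Int_rel D (meet (below S)))" if "S \<in> \<Psi>" for S
      using \<psi> that by (simp add: Pic)
    show "\<phi> (below S) \<in> hom ?G (Pic_Int_rel D (meet (below S))) \<and>
      \<phi> (below S) ` carrier ?G = carrier (Pic_Int_rel D (meet (below S)))" for S
      using \<phi> surj initial_below by blast
    show "p = \<one>\<^bsub>P S\<^esub>" if S: "S \<in> \<Psi>" and p: "p \<in> carrier (P S)" "\<psi> S p = \<one>\<^bsub>Pic_Int_rel D (meet (below S))\<^esub>" for S p
    proof -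
      have Sr: "fsubring S" "D \<subseteq> S" using \<Psi>_ring S by auto
      obtain I where I: "P.inv_mod S I" "p = cls S I" using p(1) cls_surj[OF Sr] by (auto simp: Pic S)
      note m = matlis[OF S]
      have q: "has_quotfield_univ (meet (below S))" by (rule has_quotfield_overring[OF D_subset_meet])
      note Int = P.inv_mod_Int[OF m q I(1) P.inv_mod_ext[OF fsubring_meet]]
      \<comment> \<open>Extension to \<open>S\<close> turns the glued module back into
        \<open>I\<close>, so triviality passes from \<open>meet (below S)\<close> to
        \<open>S\<close>.\<close>
      have "extended (meet (below S)) (I \<inter> P.ext (meet (upto S)))"
        using p(2) I \<psi>cls[OF S I(1)] cls_one_extended[OF mr Int(1)] by simp
      then have "extended S I"
        using extended_extend[OF fsubring_meet Sr(1) D_subset_meet] Int(2) m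
        by (metis Int_lower1 matlis_pair_def)
      then show ?thesis using cls_one_extended[OF Sr I(1)] I Pic S by simp
    qed
    show "\<phi> (below S) c = \<one>\<^bsub>Pic_Int_rel D (meet (below S))\<^esub>"
      if S: "S \<in> \<Psi>" "S' \<in> \<Psi>" "(S', S) \<in> r" and c: "c \<in> carrier ?G" "\<phi> (below S') c \<in> \<psi> S' ` carrier (P S')" for S S' c
    proof -
      obtain I where I: "P.inv_mod D I" "c = cls D I" using repr c by blast
      have "extended (meet (upto S')) (I \<star> embK ` meet (upto S'))"
        using key[OF S(2) I(1)] c I Pic S by simp
      moreover have sub: "meet (upto S') \<subseteq> meet (below S)"
        using S transD[OF r(2)] by (intro meet_mono) (auto simp: upto_def below_def)
      ultimately have "extended (meet (below S)) (I \<star> embK ` meet (below S))"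
        using extended_extend[OF fsubring_meet fsubring_meet D_subset_meet sub]
          P.extend_extend[OF fsubring_meet fsubring_meet sub] by metis
      then show ?thesis using \<phi>one[OF I(1)] I by simp
    qed
    show "\<phi> \<Psi> c = \<one>\<^bsub>Pic_Int_rel D (meet \<Psi>)\<^esub>"
      if S: "S \<in> \<Psi>" and c: "c \<in> carrier ?G" "\<phi> (below S) c \<in> \<psi> S ` carrier (P S)" for S c
    proof -
      obtain I where I: "P.inv_mod D I" "c = cls D I" using repr c by blast
      have "extended (meet (upto S)) (I \<star> embK ` meet (upto S))"
        using key[OF S I(1)] c I Pic S by simp
      moreover have sub: "meet (upto S) \<subseteq> meet \<Psi>" by (intro meet_mono) (auto simp: upto_def)
      ultimately have "extended (meet \<Psi>) (I \<star> embK ` meet \<Psi>)"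
        using extended_extend[OF fsubring_meet fsubring_meet D_subset_meet sub]
          P.extend_extend[OF fsubring_meet fsubring_meet sub] by metis
      then show ?thesis using \<phi>one[OF I(1)] I by simp
    qed
    \<comment> \<open>Stated for initial segments, so that \<open>below S\<close> and
      \<open>\<Psi>\<close> yield the two generating hypotheses.\<close>
    have gen: "\<exists>S\<in>W. \<phi> (below S) c \<in> \<psi> S ` carrier (P S)"
      if W: "initial W" and c: "c \<in> carrier ?G" "\<phi> W c = \<one>\<^bsub>Pic_Int_rel D (meet W)\<^esub>" "c \<noteq> \<one>\<^bsub>?G\<^esub>" for W c
    proof -
      obtain I where I: "P.inv_mod D I" "c = cls D I" using repr c by blast
      have "extended (meet W) (I \<star> embK ` meet W)" using \<phi>one[OF I(1)] I c by simp
      moreover have "\<not> extended D I" using cls_one_extended[OF D(1) order_refl I(1)] I c by simp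
      ultimately obtain S where S: "S \<in> W" "extended (meet (upto S)) (I \<star> embK ` meet (upto S))"
        using extended_descend[OF W I(1)] by blast
      then have "S \<in> \<Psi>" using W by (auto simp: initial_def)
      then have "\<phi> (below S) c \<in> \<psi> S ` carrier (P S)" using key[of S I] I S Pic by simp
      then show ?thesis using S(1) by blast
    qed
    show "\<exists>S'\<in>\<Psi>. (S', S) \<in> r \<and> \<phi> (below S') c \<in> \<psi> S' ` carrier (P S')"
      if "c \<in> carrier ?G" "\<phi> (below S) c = \<one>\<^bsub>Pic_Int_rel D (meet (below S))\<^esub>" "c \<noteq> \<one>\<^bsub>?G\<^esub>" for S c
      using gen[OF initial_below that] by (auto simp: below_def)
    show "\<exists>S\<in>\<Psi>. \<phi> (below S) c \<in> \<psi> S ` carrier (P S)"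
      if "c \<in> carrier ?G" "\<phi> \<Psi> c = \<one>\<^bsub>Pic_Int_rel D (meet \<Psi>)\<^esub>" "c \<noteq> \<one>\<^bsub>?G\<^esub>" for c
      using gen[OF initial_\<Psi> that] .
  qed (use \<phi> grp mr r in \<open>auto simp: Pic\<close>)
  then show ?thesis using \<phi>[of \<Psi>] surj[OF initial_\<Psi>] by blast
qed

end

section \<open>The derived sequence\<close>

context
  fixes D :: "'k::field set" and \<Theta> :: "'k set set" and N :: "'o::wellorder \<Rightarrow> 'k set set"
  assumes N: "derived_seq D \<Theta> N"
begin

lemma derived_seq_cases:
  obtains (zero) "N \<gamma> = \<Theta>"  "\<And>\<beta>. \<not> \<beta> < \<gamma>"
  | (succ) \<beta> where "\<beta> < \<gamma>" "\<And>\<delta>. \<delta> < \<gamma> \<Longrightarrow> \<delta> \<le> \<beta>" "N \<gamma> = {T \<in> N \<beta>. \<not> jaffard_overring (Tseq N \<beta>) T}"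
  | (lim) "N \<gamma> = (\<Inter>\<beta>\<in>{..<\<gamma>}. N \<beta>)" "\<exists>\<beta>. \<beta> < \<gamma>"
proof -
  consider "\<forall>\<beta>. \<not> \<beta> < \<gamma>" | "(\<exists>\<beta>. \<beta> < \<gamma>) \<and> (\<forall>\<beta><\<gamma>. \<exists>\<delta>. \<beta> < \<delta> \<and> \<delta> < \<gamma>)"
    | \<beta> where "\<beta> < \<gamma>" "\<forall>\<delta>. \<not> (\<beta> < \<delta> \<and> \<delta> < \<gamma>)" by blast
  then show thesis
  proof cases
    case 1 then show ?thesis using N zero unfolding derived_seq_def by blast
  next
    case 2
    then have "N \<gamma> = (\<Inter>\<beta>\<in>{..<\<gamma>}. N \<beta>)" using N unfolding derived_seq_def by simp
    then show ?thesis using 2 lim by blast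
  next
    case (3 \<beta>)
    then have "N \<gamma> = {T \<in> N \<beta>. \<not> jaffard_overring (Tseq N \<beta>) T}"
      using N unfolding derived_seq_def by simp
    moreover have "\<delta> \<le> \<beta>" if "\<delta> < \<gamma>" for \<delta> using 3 that by (meson not_le)
    ultimately show ?thesis using succ 3 by blast
  qed
qed

lemma derived_seq_antimono: "\<beta> \<le> \<gamma> \<Longrightarrow> N \<gamma> \<subseteq> N \<beta>"
proof (induction \<gamma> rule: less_induct)
  case (less \<gamma>)
  show ?case
  proof (cases "\<beta> = \<gamma>")
    case False
    then have "\<beta> < \<gamma>" using less by simp
    show ?thesis
    proof (cases rule: derived_seq_cases[of \<gamma>])
      case (succ \<delta>)
      then have "N \<delta> \<subseteq> N \<beta>" using less.IH \<open>\<beta> < \<gamma>\<close> by blast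
      then show ?thesis using succ by blast
    qed (use \<open>\<beta> < \<gamma>\<close> in auto)
  qed simp
qed

lemma derived_seq_subset: "N \<gamma> \<subseteq> \<Theta>"
proof (induction \<gamma> rule: less_induct)
  case (less \<gamma>)
  show ?case by (cases rule: derived_seq_cases[of \<gamma>]) (use less in blast)+
qed

text \<open>Unspecified for the overrings that remain in every \<open>N \<delta>\<close>.\<close>

definition level :: "'k set \<Rightarrow> 'o" where "level T = (LEAST \<delta>. T \<notin> N \<delta>)"

text \<open>An overring leaves at a successor: at zero \<open>N\<close> is all of
  \<open>\<Theta>\<close>, and at a limit it contains what lies in all earlier sets. Members missing
  from \<open>N \<beta>\<close> have level at most \<open>\<beta>\<close>.\<close>

lemma level_pred:
  assumes T: "T \<in> \<Theta> - N \<alpha>"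
  obtains \<beta> where "\<beta> < level T" "level T \<le> \<alpha>" "T \<in> N \<beta>" "jaffard_overring (\<Inter>(N \<beta>)) T"
    "\<And>S. S \<in> \<Theta> \<Longrightarrow> S \<notin> N \<beta> \<Longrightarrow> level S < level T"
proof -
  have le: "level S \<le> \<delta>" if "S \<notin> N \<delta>" for S \<delta> unfolding level_def using that by (rule Least_le)
  have nin: "T \<notin> N (level T)" unfolding level_def by (rule LeastI[of _ \<alpha>]) (use T in blast)
  have lev: "level T \<le> \<alpha>" using T le by blast
  have T': "T \<in> N \<delta>" if "\<delta> < level T" for \<delta> using le[of T \<delta>] that by (meson not_le)
  show thesis
  proof (cases rule: derived_seq_cases[of "level T"])
    case (succ \<beta>)
    have "level S < level T" if "S \<notin> N \<beta>" for S using le[OF that] succ by simp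
    then show ?thesis using that[of \<beta>] succ lev T' nin unfolding Tseq_def by blast
  qed (use nin T T' in auto)
qed

end

text \<open>The lexicographic product of the order on levels with an arbitrary well-order, which
  decides between elements of the same level.\<close>

lemma ex_well_order_refining:
  fixes lev :: "'a \<Rightarrow> 'o::wellorder"
  obtains r :: "('a \<times> 'a) set" where "wf r" "trans r" "total_on UNIV r" "\<And>x y. lev x < lev y \<Longrightarrow> (x, y) \<in> r"
proof -
  have "\<exists>w :: 'a rel. Well_order w \<and> Field w = UNIV" by (rule well_ordering)
  then obtain w :: "'a rel" where w: "Well_order w" "Field w = UNIV" by (elim exE conjE)
  then have tw: "trans w" "antisym w" "total_on UNIV w" and wfw: "wf (w - Id)"
    unfolding order_on_defs by simp_all
  define r where "r = inv_image ({(x, y). x < y} <*lex*> (w - Id)) (\<lambda>x. (lev x, x))"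
  have mem: "(x, y) \<in> r \<longleftrightarrow> lev x < lev y \<or> lev x = lev y \<and> (x, y) \<in> w \<and> x \<noteq> y" for x y
    by (auto simp: r_def)
  show ?thesis
  proof
    show "wf r" unfolding r_def by (intro wf_inv_image wf_lex_prod wf wfw)
    show "trans r"
    proof (rule transI)
      fix x y z assume "(x, y) \<in> r" "(y, z) \<in> r"
      then show "(x, z) \<in> r" unfolding mem
        using transD[OF tw(1), of x y z] antisymD[OF tw(2), of x y] by auto
    qed
    show "total_on UNIV r" unfolding total_on_def mem
      using tw(3) by (metis UNIV_I linorder_neqE total_on_def)
  qed (simp add: mem)
qed

theorem theorem7p3:
  fixes D :: "'k::field set" and \<Theta> :: "'k set set"
    and N :: "'o::wellorder \<Rightarrow> 'k set set" and \<alpha> :: 'o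
  assumes "fsubring D" and "has_quotfield_univ D"
    and "pre_jaffard D \<Theta>"
    and "derived_seq D \<Theta> N"
    and "\<forall>T \<in> \<Theta> - N \<alpha>. IntT D T = Int_poly T"
    and "\<forall>\<gamma> < \<alpha>. IntT D (Tseq N \<gamma>) = Int_poly (Tseq N \<gamma>)"
    and "\<forall>T \<in> \<Theta> - N \<alpha>. free_abelian (Pic_Int T)"
  shows "\<exists>f g. f \<in> hom (sum_group (\<Theta> - N \<alpha>) Pic_Int) (Pic_Int D) \<and>
               g \<in> hom (Pic_Int D) (Pic_Int_rel D (Tseq N \<alpha>)) \<and>
               inj_on f (carrier (sum_group (\<Theta> - N \<alpha>) Pic_Int)) \<and>
               g ` carrier (Pic_Int D) = carrier (Pic_Int_rel D (Tseq N \<alpha>)) \<and>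
               kernel (Pic_Int D) (Pic_Int_rel D (Tseq N \<alpha>)) g =
                 f ` carrier (sum_group (\<Theta> - N \<alpha>) Pic_Int)"
proof -
  note D = assms(1,2) and \<Theta> = assms(3) and N = assms(4)
  let ?\<Psi> = "\<Theta> - N \<alpha>"
  obtain r where r: "wf r" "trans r" "total_on UNIV r"
    "\<And>S T. level N S < level N T \<Longrightarrow> (S, T) \<in> r"
    using ex_well_order_refining[of "level N"] by metis
  have ov: "\<And>S. S \<in> \<Theta> \<Longrightarrow> overring D S \<and> flat_over D S" using pre_jaffardD[OF \<Theta>] by blast
  interpret int_poly_ring D by unfold_locales (rule D)+
  interpret well_ordered_family D \<Theta> ?\<Psi> r
  proof
    show "\<Inter>\<Theta> = D" by (rule pre_jaffard_Inter[OF D(1) \<Theta>])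
    show "compactin (zariski D) \<Theta>" by (rule pre_jaffardD(5)[OF \<Theta>])
    show "total_on ?\<Psi> r" using r(3) by (auto simp: total_on_def)
    fix S z assume S: "S \<in> ?\<Psi>"
    then obtain \<beta> where \<beta>: "\<beta> < level N S" "level N S \<le> \<alpha>" "S \<in> N \<beta>" "jaffard_overring (\<Inter>(N \<beta>)) S"
      "\<And>T. T \<in> \<Theta> \<Longrightarrow> T \<notin> N \<beta> \<Longrightarrow> level N T < level N S"
      using level_pred[OF N S] by metis
    have sub: "N \<beta> \<subseteq> \<Theta>" by (rule derived_seq_subset[OF N])
    have "\<exists>a\<in>S. \<exists>b\<in>\<Inter>(N \<beta> - {S}). z = a + b"
      by (rule jaffard_overring_complement[OF D _ _ \<beta>(3,4)]) (use sub ov pre_jaffardD(4)[OF \<Theta>] in blast)+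
    \<comment> \<open>A member of \<open>\<Theta>\<close> outside \<open>N \<beta>\<close> is
      outside \<open>N \<alpha>\<close> and has a smaller level, so it precedes \<open>S\<close> in
      \<open>r\<close>. Hence all members that remain after \<open>S\<close> lie in
      \<open>N \<beta> - {S}\<close>.\<close>
    moreover have "N \<alpha> \<subseteq> N \<beta>" using derived_seq_antimono[OF N, of \<beta> \<alpha>] \<beta> by simp
    then have "\<Theta> - {T \<in> ?\<Psi>. T = S \<or> (T, S) \<in> r} \<subseteq> N \<beta> - {S}" using \<beta>(5) r(4) S by blast
    then have "\<Inter>(N \<beta> - {S}) \<subseteq> \<Inter>(\<Theta> - {T \<in> ?\<Psi>. T = S \<or> (T, S) \<in> r})" by (rule Inter_anti_mono)
    ultimately show "\<exists>a\<in>S. \<exists>b\<in>\<Inter>(\<Theta> - {T \<in> ?\<Psi>. T = S \<or> (T, S) \<in> r}). z = a + b" by blast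
  qed (use ov r in \<open>auto simp: overring_def\<close>)
  have "meet ?\<Psi> = Tseq N \<alpha>"
    using derived_seq_subset[OF N, of \<alpha>] by (simp add: meet_def Tseq_def Diff_Diff_Int Int_absorb1)
  moreover have "Pic_Int D = Pic_Int_rel D D"
  proof -
    have "IntT D D = Int_poly D" using ext_eq[of D] P.ext_D by (simp add: inj_image_eq_iff inj_def)
    then show ?thesis by (simp add: Pic_Int_def Pic_Int_rel_def)
  qed
  \<comment> \<open>Hypothesis (i) for \<open>T\<close> turns the absolute group into the relative
    one.\<close>
  moreover have "Pic_Int T = Pic_Int_rel D T" if "T \<in> ?\<Psi>" for T
    using assms(5) that by (simp add: Pic_Int_def Pic_Int_rel_def)
  ultimately show ?thesis using exact_sequence[of Pic_Int] assms(7) by simp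
qed

end
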